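(* Let $N\geq 3$, $g\in C^1(\mathbb{R})$, and let $u$ be a bounded radial solution of $-\Delta u=g(u)$ in $\mathbb{R}^N$ which is stable outside a compact set. Then the limit $u_\infty:=\lim_{r\to\infty}u(r)\in\mathbb{R}$ exists, and $u$ satisfies either $(L')$ or $(S')$ (exactly one of them), where: $(L')$ $N\geq 11$ and there exist $M>0$, $r_0\geq 1$ such that $$|u(r)-u_\infty|\geq M r^{-N/2+\sqrt{N-1}+2}\quad\forall r\geq r_0.$$ Moreover, $|\nabla u|\notin L^p(\mathbb{R}^N\setminus\overline{B_1})$ for every $1\leq p\leq\frac{N}{N/2-\sqrt{N-1}-1}$. In particular $|\nabla u|\notin L^2(\mathbb{R}^N\setminus\overline{B_1})$. $(S')$ There exists $M>0$ such that $$|u(r)-u_\infty|\leq M r^{-N/2-\sqrt{N-1}+2}\quad\forall r\geq 1.$$ Moreover, $|\nabla u|\in L^p(\mathbb{R}^N\setminus\overline{B_1})$ for every $\frac{N}{N/2+\sqrt{N-1}-1}<p\leq\infty$. In particular $|\nabla u|\in L^2(\mathbb{R}^N\setminus\overline{B_1})$.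
   Context: $B_1$ is the open unit ball of $\mathbb{R}^N$. Solutions are classical: $u\in C^2(\mathbb{R}^N)$. A solution $u$ of $-\Delta u=g(u)$ in $\mathbb{R}^N$ is stable outside a compact set if there exists a compact set $K\subset\mathbb{R}^N$ such that $\int_{\mathbb{R}^N}\left(|\nabla v|^2-g'(u)v^2\right)dx\geq 0$ for every $v\in C^1(\mathbb{R}^N)$ with compact support in $\mathbb{R}^N\setminus K$. For radial $u$ one writes $u(r)$ for $u(x)$ with $r=|x|$. *)

theory Defs
  imports "HOL-Analysis.Analysis"
begin

definition partial_deriv :: "'a::euclidean_space \<Rightarrow> ('a \<Rightarrow> real) \<Rightarrow> 'a \<Rightarrow> real" where
  "partial_deriv b f x = frechet_derivative f (at x) b"

definition gradient :: "('a::euclidean_space \<Rightarrow> real) \<Rightarrow> 'a \<Rightarrow> 'a" where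
  "gradient f x = (\<Sum>b\<in>Basis. partial_deriv b f x *\<^sub>R b)"

definition laplacian :: "('a::euclidean_space \<Rightarrow> real) \<Rightarrow> 'a \<Rightarrow> real" where
  "laplacian f x = (\<Sum>b\<in>Basis. partial_deriv b (partial_deriv b f) x)"

(* Functions of class C^k on the whole space.  Pointwise differentiability is required at each
   level because frechet_derivative is unspecified where the derivative does not exist. *)
fun Ck :: "nat \<Rightarrow> ('a::euclidean_space \<Rightarrow> real) \<Rightarrow> bool" where
  "Ck 0 f \<longleftrightarrow> continuous_on UNIV f"
| "Ck (Suc k) f \<longleftrightarrow> (\<forall>x. f differentiable (at x)) \<and> (\<forall>b\<in>Basis. Ck k (partial_deriv b f))"

definition classical_solution :: "(real \<Rightarrow> real) \<Rightarrow> ('a::euclidean_space \<Rightarrow> real) \<Rightarrow> bool" where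
  "classical_solution g u \<longleftrightarrow> Ck 2 u \<and> (\<forall>x. - laplacian u x = g (u x))"

(* The integrand is continuous with compact support (for u continuous and g of class C^1), hence
   the Bochner integral never takes its default value 0 for a non-integrable function. *)
definition stable_outside_compact ::
  "(real \<Rightarrow> real) \<Rightarrow> ('a::euclidean_space \<Rightarrow> real) \<Rightarrow> bool" where
  "stable_outside_compact g u \<longleftrightarrow>
     (\<exists>K. compact K \<and>
       (\<forall>v. Ck 1 v \<and> compact (closure {x. v x \<noteq> 0}) \<and> closure {x. v x \<noteq> 0} \<subseteq> UNIV - K \<longrightarrow>
          0 \<le> (LINT x|lebesgue. (norm (gradient v x))\<^sup>2 - deriv g (u x) * (v x)\<^sup>2)))"

definition radial :: "('a::euclidean_space \<Rightarrow> real) \<Rightarrow> bool" where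
  "radial u \<longleftrightarrow> (\<forall>x y. norm x = norm y \<longrightarrow> u x = u y)"

(* For radial u and r \<ge> 0 this is the value of u at any x with norm x = r; the choice of the
   unit vector is irrelevant. *)
definition profile :: "('a::euclidean_space \<Rightarrow> real) \<Rightarrow> real \<Rightarrow> real" where
  "profile u r = u (r *\<^sub>R (SOME b. b \<in> Basis))"

(* Membership in L^p(S), meant for 1 \<le> p \<le> \<infinity>. *)
definition in_Lp :: "ereal \<Rightarrow> 'a::euclidean_space set \<Rightarrow> ('a \<Rightarrow> real) \<Rightarrow> bool" where
  "in_Lp p S f \<longleftrightarrow> f \<in> borel_measurable (lebesgue_on S) \<and>
     (if p = \<infinity> then \<exists>C. AE x in lebesgue_on S. \<bar>f x\<bar> \<le> C
      else integrable (lebesgue_on S) (\<lambda>x. \<bar>f x\<bar> powr real_of_ereal p))"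

definition slow_decay :: "(real^'n \<Rightarrow> real) \<Rightarrow> real \<Rightarrow> bool" where
  "slow_decay u u_inf \<longleftrightarrow>
     (let N = real CARD('n); \<Omega> = UNIV - closure (ball 0 1) in
        CARD('n) \<ge> 11 \<and>
        (\<exists>M>0. \<exists>r0\<ge>1. \<forall>r\<ge>r0.
           \<bar>profile u r - u_inf\<bar> \<ge> M * r powr (- N / 2 + sqrt (N - 1) + 2)) \<and>
        (\<forall>p. 1 \<le> p \<and> p \<le> ereal (N / (N / 2 - sqrt (N - 1) - 1)) \<longrightarrow>
           \<not> in_Lp p \<Omega> (\<lambda>x. norm (gradient u x))) \<and>
        \<not> in_Lp 2 \<Omega> (\<lambda>x. norm (gradient u x)))"

definition fast_decay :: "(real^'n \<Rightarrow> real) \<Rightarrow> real \<Rightarrow> bool" where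
  "fast_decay u u_inf \<longleftrightarrow>
     (let N = real CARD('n); \<Omega> = UNIV - closure (ball 0 1) in
        (\<exists>M>0. \<forall>r\<ge>1.
           \<bar>profile u r - u_inf\<bar> \<le> M * r powr (- N / 2 - sqrt (N - 1) + 2)) \<and>
        (\<forall>p. ereal (N / (N / 2 + sqrt (N - 1) - 1)) < p \<and> p \<le> \<infinity> \<longrightarrow>
           in_Lp p \<Omega> (\<lambda>x. norm (gradient u x))) \<and>
        in_Lp 2 \<Omega> (\<lambda>x. norm (gradient u x)))"

end

theory Submission imports Defs begin

text \<open>Write \<open>\<omega> = u'\<close>, \<open>c = sqrt (N - 1)\<close> and \<open>w r = r ^ (N - 1) * (\<omega> r)\<^sup>2\<close>. Differentiating the radial
  equation shows that \<open>\<omega>\<close> solves the linearized equation with the additional term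
  \<open>(N - 1) * \<omega> / r\<^sup>2\<close>, so that stability tested with \<open>\<omega> * \<eta>\<close> becomes the weighted Hardy inequality
  \<open>c\<^sup>2 * \<integral> w * \<eta>\<^sup>2 / r\<^sup>2 \<le> \<integral> w * \<eta>'\<^sup>2\<close> outside a ball. In particular \<open>\<omega>\<close> vanishes either
  identically or nowhere near infinity. In the latter case, if \<open>\<integral> 1 / w\<close> diverges at infinity, then
  test functions equal to \<open>r powr c\<close> up to \<open>S\<close> and nearly constant afterwards give
  \<open>\<integral>\<^bsub>S\<^esub> w / r\<^sup>2 \<le> C * S powr (-2 * c)\<close>, which yields fast decay. If it converges, the dual test functions with
  \<open>w * \<eta>' = - (min r S powr c)\<close> give \<open>\<integral>\<^bsub>S\<^esub> 1 / w \<le> C * S powr (-2 * c)\<close>, which yields slow decay.\<close>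

section \<open>A dichotomy for weights satisfying a Hardy inequality\<close>

text \<open>For a power weight \<open>w r = r powr k\<close> the Hardy inequality with constant
  \<open>c\<^sup>2\<close> near infinity forces \<open>k \<le> 1 - 2 * c\<close> or
  \<open>k \<ge> 1 + 2 * c\<close>. The integral of \<open>1 / w\<close> diverges in the first case
  and converges in the second, and the two borderline weights attain exactly the tail rate
  \<open>S powr (-2 * c)\<close> of each alternative. Solving
  \<open>r ^ (N - 1) * (\<omega> r)\<^sup>2 = r powr (1 - 2 * c)\<close> or
  \<open>= r powr (1 + 2 * c)\<close> for \<open>\<omega>\<close> and integrating once gives the two
  exponents of the theorem. The obstacle is that nothing is known about the shape of
  \<open>w\<close>: both alternatives come out as integral tails and reach \<open>u\<close> only
  through weighted mean inequalities. Divergence of \<open>\<integral> 1 / w\<close> means that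
  infinity has zero capacity for the weighted energy, so a test function can be brought back to 0 at
  negligible cost. In the convergent case this cut-off has a real cost, hence the prescribed flux.
  The dimension bound comes from boundedness of \<open>u\<close>: the slow exponent must satisfy
  \<open>- N / 2 + c + 2 < 0\<close>, which for \<open>N \<ge> 3\<close> means
  \<open>(N - 2) * (N - 10) > 0\<close>.\<close>

definition C1_on :: "real \<Rightarrow> real \<Rightarrow> (real \<Rightarrow> real) \<Rightarrow> (real \<Rightarrow> real) \<Rightarrow> bool" where
  "C1_on a b f f' \<longleftrightarrow>
     (\<forall>x\<in>{a..b}. (f has_real_derivative f' x) (at x within {a..b})) \<and> continuous_on {a..b} f'"

lemma C1_on_continuous: "C1_on a b f f' \<Longrightarrow> continuous_on {a..b} f"
  unfolding C1_on_def by (meson DERIV_continuous_on)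

text \<open>Test functions are assembled from pieces, and the Hardy inequality is only available for
  functions of class C1. Derivatives within the closed interval are one-sided at its end points, so
  at the joint the two one-sided limits combine because both the values and the derivatives
  match.\<close>

lemma C1_on_glue:
  assumes f: "C1_on a m f f'" and g: "C1_on m b g g'" and "a \<le> m" "m \<le> b"
    and "f m = g m" "f' m = g' m"
  shows "C1_on a b (\<lambda>x. if x \<le> m then f x else g x) (\<lambda>x. if x \<le> m then f' x else g' x)"
proof -
  have ab: "{a..b} = {a..m} \<union> {m..b}" using assms by auto
  have "((\<lambda>x. if x \<le> m then f x else g x) has_real_derivative (if x \<le> m then f' x else g' x))
     (at x within {a..b})" if x: "x \<in> {a..b}" for x
  proof -
    consider "x < m" | "x = m" | "x > m" by linarith
    then show ?thesis
    proof cases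
      case 1
      have "at x within {a..b} = at x within {a..m}"
        by (rule at_within_nhd[where S="{..<m}"]) (use 1 assms in auto)
      moreover have "((\<lambda>x. if x \<le> m then f x else g x) has_real_derivative f' x) (at x within {a..m})"
        by (rule has_field_derivative_transform_within[where d=1 and f=f])
           (use f 1 x in \<open>auto simp: C1_on_def\<close>)
      ultimately show ?thesis using 1 by simp
    next
      case 3
      have "at x within {a..b} = at x within {m..b}"
        by (rule at_within_nhd[where S="{m<..}"]) (use 3 assms in auto)
      moreover have "((\<lambda>x. if x \<le> m then f x else g x) has_real_derivative g' x) (at x within {m..b})"
        by (rule has_field_derivative_transform_within[where d=1 and f=g])
           (use g 3 x assms in \<open>auto simp: C1_on_def\<close>)
      ultimately show ?thesis using 3 by simp
    next
      case 2
      have 1: "((\<lambda>x. if x \<le> m then f x else g x) has_real_derivative f' m) (at m within {a..m})"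
        by (rule has_field_derivative_transform_within[where d=1 and f=f])
           (use f \<open>a \<le> m\<close> in \<open>auto simp: C1_on_def\<close>)
      have 2: "((\<lambda>x. if x \<le> m then f x else g x) has_real_derivative f' m) (at m within {m..b})"
        by (rule has_field_derivative_transform_within[where d=1 and f=g])
           (use g assms in \<open>auto simp: C1_on_def\<close>)
      from 1 2 have "((\<lambda>x. if x \<le> m then f x else g x) has_real_derivative f' m) (at m within {a..b})"
        unfolding ab has_field_derivative_iff Lim_within_Un by blast
      then show ?thesis using \<open>x = m\<close> by simp
    qed
  qed
  moreover have "continuous_on {a..b} (\<lambda>x. if x \<le> m then f' x else g' x)"
    unfolding ab
    by (rule continuous_on_If) (use f g assms in \<open>auto simp: C1_on_def\<close>)
  ultimately show ?thesis unfolding C1_on_def by blast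
qed

definition hardy_integrand ::
  "real \<Rightarrow> (real \<Rightarrow> real) \<Rightarrow> (real \<Rightarrow> real) \<Rightarrow> (real \<Rightarrow> real) \<Rightarrow> real \<Rightarrow> real" where
  "hardy_integrand c w \<eta> \<eta>' r = w r * ((\<eta>' r)\<^sup>2 - c\<^sup>2 * (\<eta> r)\<^sup>2 / r\<^sup>2)"

lemma hardy_integrand_continuous:
  assumes "C1_on a b \<eta> \<eta>'" "continuous_on {a..b} w" "a > 0"
  shows "continuous_on {a..b} (hardy_integrand c w \<eta> \<eta>')"
  unfolding hardy_integrand_def
  by (intro continuous_intros) (use assms C1_on_continuous in \<open>auto simp: C1_on_def\<close>)

lemma hardy_integral_glue:
  assumes f: "C1_on a m f f'" and g: "C1_on m b g g'" and "a \<le> m" "m \<le> b" "a > 0"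
    and "f m = g m" "f' m = g' m" and w: "continuous_on {a..b} w"
  shows "integral {a..b} (hardy_integrand c w (\<lambda>x. if x \<le> m then f x else g x) (\<lambda>x. if x \<le> m then f' x else g' x))
       = integral {a..m} (hardy_integrand c w f f') + integral {m..b} (hardy_integrand c w g g')"
    (is "integral _ ?h = _")
proof -
  have "?h integrable_on {a..b}"
    by (intro integrable_continuous_real hardy_integrand_continuous C1_on_glue assms)
  then have "integral {a..b} ?h = integral {a..m} ?h + integral {m..b} ?h"
    using assms by (simp add: Henstock_Kurzweil_Integration.integral_combine)
  moreover have "integral {a..m} ?h = integral {a..m} (hardy_integrand c w f f')"
    by (rule integral_cong) (auto simp: hardy_integrand_def)
  moreover have "integral {m..b} ?h = integral {m..b} (hardy_integrand c w g g')"
    by (rule integral_cong) (use assms in \<open>auto simp: hardy_integrand_def\<close>)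
  ultimately show ?thesis by simp
qed

lemma powr_C1_on: "a > 0 \<Longrightarrow> C1_on a b (\<lambda>r. r powr c) (\<lambda>r. c * r powr (c - 1))"
  unfolding C1_on_def
  by (auto intro!: derivative_eq_intros continuous_intros simp: has_field_derivative_at_within)

text \<open>The energy density vanishes pointwise, whatever the weight is. This lets a test function
  grow like \<open>r powr c\<close> over an arbitrarily long interval at no cost.\<close>

lemma hardy_integrand_powr: "r > 0 \<Longrightarrow> hardy_integrand c w (\<lambda>r. r powr c) (\<lambda>r. c * r powr (c - 1)) r = 0"
  by (simp add: hardy_integrand_def powr_diff power_mult_distrib power_divide)

text \<open>The differential equation is forgotten here. The test functions need only vanish at the
  end points, with no condition on their derivatives there, so the flux at the right end can be
  prescribed freely.\<close>

locale hardy_weight =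
  fixes w :: "real \<Rightarrow> real" and c R :: real
  assumes c_pos: "c > 0" and R_pos: "R > 0"
    and w_cont: "continuous_on {R<..} w" and w_pos: "\<And>r. r > R \<Longrightarrow> w r > 0"
    and hardy: "\<And>a b \<eta> \<eta>'. R < a \<Longrightarrow> a < b \<Longrightarrow> C1_on a b \<eta> \<eta>' \<Longrightarrow> \<eta> a = 0 \<Longrightarrow> \<eta> b = 0 \<Longrightarrow>
           0 \<le> integral {a..b} (hardy_integrand c w \<eta> \<eta>')"
begin

lemma w_cont_Icc: "R < a \<Longrightarrow> continuous_on {a..b} w"
  by (rule continuous_on_subset[OF w_cont]) auto

lemma w_nonzero: "R < r \<Longrightarrow> w r \<noteq> 0"
  using w_pos[of r] by simp

lemma inverse_w_integrable: "R < a \<Longrightarrow> (\<lambda>r. 1 / w r) integrable_on {a..b}"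
  by (intro integrable_continuous_real continuous_intros w_cont_Icc)
     (auto simp: w_nonzero)

lemma integral_inverse_w_mono:
  assumes "R < a" "a \<le> a'" "b' \<le> b"
  shows "integral {a'..b'} (\<lambda>r. 1 / w r) \<le> integral {a..b} (\<lambda>r. 1 / w r)"
  by (rule integral_subset_le) (use assms w_pos in \<open>auto intro!: inverse_w_integrable less_imp_le\<close>)

text \<open>The test function is the exact solution \<open>r powr c\<close> of the model equation up to \<open>S\<close>,
  levels off on \<open>{S..2 * S}\<close>, and then decreases to 0 with flux proportional to the cut-off
  \<open>min 1 (r - 2 * S)\<close>; the energy of this last part is at most the inverse of \<open>\<integral> 1 / w\<close>.\<close>

lemma decay_of_unbounded:
  assumes unb: "\<And>X. \<exists>B. integral {R + 1..B} (\<lambda>r. 1 / w r) > X"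
  shows "\<exists>C S0. S0 > R \<and> (\<forall>S\<ge>S0. \<forall>B\<ge>S. integral {S..B} (\<lambda>r. w r / r\<^sup>2) \<le> C * S powr (-2 * c))"
proof -
  define a where "a = R + 1"
  define a1 where "a1 = a + 1"
  have a: "R < a" "0 < a" "a < a1" "0 < a1" using R_pos by (auto simp: a_def a1_def)
  \<comment> \<open>The factor \<open>1 - (a1 - r)\<^sup>2\<close> rises from 0 at \<open>a\<close>
    to 1 at \<open>a1 = a + 1\<close> with zero slope at \<open>a1\<close>, so \<open>L\<close>
    joins \<open>r powr c\<close> in a C1 way. Its energy \<open>C0\<close> depends neither on
    \<open>S\<close> nor on \<open>B\<close>.\<close>
  define L where "L = (\<lambda>r. r powr c * (1 - (a1 - r)\<^sup>2))"
  define L' where "L' = (\<lambda>r. c * r powr (c - 1) * (1 - (a1 - r)\<^sup>2) + r powr c * (2 * (a1 - r)))"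
  have L: "C1_on a a1 L L'"
    unfolding C1_on_def L_def L'_def using a
    by (auto intro!: derivative_eq_intros continuous_intros simp: has_field_derivative_at_within)
  define C0 where "C0 = integral {a..a1} (hardy_integrand c w L L')"
  have main: "integral {2*S..B} (\<lambda>r. w r / r\<^sup>2) \<le> 4 * (C0 + 1) / c\<^sup>2 * S powr (-2 * c)"
    if S: "S \<ge> a1" and B: "B \<ge> 2 * S" for S B
  proof -
    have S0: "S > 0" "R < S" "a \<le> S" using a S by auto
    \<comment> \<open>Starting the flux at 0 makes the slope of the last piece at
      \<open>2 * S\<close> agree with the zero slope of \<open>P\<close>. Beyond
      \<open>2 * S + 1\<close> the cut-off is 1, so \<open>J\<close> inherits the divergence of the
      integral of \<open>1 / w\<close>.\<close>
    define \<theta> where "\<theta> = (\<lambda>r. min 1 (r - 2 * S))"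
    have \<theta>01: "0 \<le> \<theta> r \<and> \<theta> r \<le> 1" if "r \<ge> 2 * S" for r using that by (auto simp: \<theta>_def)
    have \<theta>w_nonneg: "0 \<le> \<theta> r / w r" if "r \<ge> 2 * S" for r
      using \<theta>01[OF that] w_pos[of r] that S0 by auto
    have cont_\<theta>: "continuous_on A \<theta>" for A unfolding \<theta>_def by (intro continuous_intros)
    have cont_\<theta>w: "continuous_on {2*S..E} (\<lambda>r. \<theta> r / w r)" for E
      by (intro continuous_intros cont_\<theta> w_cont_Icc) (use S0 in \<open>auto simp: w_nonzero\<close>)
    define J where "J = (\<lambda>r. integral {2*S..r} (\<lambda>r. \<theta> r / w r))"
    \<comment> \<open>The value \<open>P (2 * S)\<close> at which the decreasing piece has to
      start.\<close>
    define M where "M = S powr c * (1 + c / 2)"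
    have M_pos: "M > 0" unfolding M_def using S0 c_pos by (simp add: add_pos_pos)
    have J_mono: "J r \<le> J r'" if "r \<le> r'" for r r'
      unfolding J_def
      by (rule integral_subset_le)
         (use that in \<open>auto intro!: integrable_continuous_real cont_\<theta>w \<theta>w_nonneg\<close>)
    have J_nonneg: "0 \<le> J r" for r
      unfolding J_def
      by (rule integral_nonneg) (use S0 in \<open>auto intro!: integrable_continuous_real cont_\<theta>w \<theta>w_nonneg\<close>)
    \<comment> \<open>Two demands on \<open>J E\<close>: exceeding \<open>2 * J B\<close> keeps the
      last piece above \<open>M / 2\<close> on \<open>{2 * S..B}\<close>, and exceeding
      \<open>M\<^sup>2\<close> makes its gradient energy at most 1.\<close>
    obtain E where E: "integral {a..E} (\<lambda>r. 1 / w r) > integral {a..2*S+1} (\<lambda>r. 1 / w r) + max (2 * J B) (M\<^sup>2) + 1"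
      using unb unfolding a_def by blast
    have E_gt: "2 * S + 1 \<le> E"
    proof (rule ccontr)
      assume "\<not> ?thesis"
      then have "integral {a..E} (\<lambda>r. 1 / w r) \<le> integral {a..2*S+1} (\<lambda>r. 1 / w r)"
        by (intro integral_inverse_w_mono a) auto
      with E J_nonneg[of B] show False by (simp add: max_def split: if_splits)
    qed
    have JE: "J E > max (2 * J B) (M\<^sup>2) + 1"
    proof -
      have "integral {a..2*S+1} (\<lambda>r. 1 / w r) + integral {2*S+1..E} (\<lambda>r. 1 / w r) = integral {a..E} (\<lambda>r. 1 / w r)"
        by (rule Henstock_Kurzweil_Integration.integral_combine) (use E_gt a S0 in \<open>auto intro: inverse_w_integrable\<close>)
      moreover have "integral {2*S+1..E} (\<lambda>r. 1 / w r) = integral {2*S+1..E} (\<lambda>r. \<theta> r / w r)"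
        by (rule integral_cong) (auto simp: \<theta>_def)
      moreover have "integral {2*S+1..E} (\<lambda>r. \<theta> r / w r) \<le> J E"
        unfolding J_def
        by (rule integral_subset_le)
          (use E_gt in \<open>auto intro!: integrable_continuous_real cont_\<theta>w \<theta>w_nonneg
             continuous_on_subset[OF cont_\<theta>w]\<close>)
      ultimately show ?thesis using E by linarith
    qed
    then have JE_pos: "J E > 0" "J E > 2 * J B" "J E > M\<^sup>2" using J_nonneg[of B] by auto
    have BE: "B \<le> E"
    proof (rule ccontr)
      assume "\<not> ?thesis"
      then have "J E \<le> J B" using J_mono by auto
      with JE_pos J_nonneg[of B] show False by linarith
    qed
    \<comment> \<open>The slope \<open>P'\<close> is linear in \<open>r\<close>, equal to that of
      \<open>r powr c\<close> at \<open>S\<close> and to 0 at \<open>2 * S\<close>.\<close>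
    define P where "P = (\<lambda>r. S powr c * (1 + c * (1 - (2 - r / S)\<^sup>2) / 2))"
    define P' where "P' = (\<lambda>r. S powr (c - 1) * (c * (2 - r / S)))"
    have P: "C1_on S (2 * S) P P'"
      unfolding C1_on_def P_def P'_def using S0
      by (auto intro!: derivative_eq_intros continuous_intros simp: field_simps powr_diff power2_eq_square
          power4_eq_xxxx)
    define T where "T = (\<lambda>r. M * (1 - J r / J E))"
    define T' where "T' = (\<lambda>r. - M * (\<theta> r / w r) / J E)"
    have "C1_on (2 * S) E T T'"
    proof -
      have "(J has_real_derivative \<theta> x / w x) (at x within {2*S..E})" if "x \<in> {2*S..E}" for x
        unfolding J_def by (rule integral_has_real_derivative[OF cont_\<theta>w that])
      then have "(T has_real_derivative T' x) (at x within {2*S..E})" if "x \<in> {2*S..E}" for x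
        unfolding T_def T'_def using that JE_pos by (auto intro!: derivative_eq_intros)
      moreover have "continuous_on {2*S..E} T'"
        unfolding T'_def using JE_pos by (intro continuous_intros cont_\<theta>w) auto
      ultimately show ?thesis unfolding C1_on_def by blast
    qed
    note T = this
    have E0: "2 * S \<le> E" using E_gt by simp
    define f1 where "f1 = (\<lambda>r. if r \<le> 2 * S then P r else T r)"
    define f1' where "f1' = (\<lambda>r. if r \<le> 2 * S then P' r else T' r)"
    define f2 where "f2 = (\<lambda>r. if r \<le> S then r powr c else f1 r)"
    define f2' where "f2' = (\<lambda>r. if r \<le> S then c * r powr (c - 1) else f1' r)"
    define f3 where "f3 = (\<lambda>r. if r \<le> a1 then L r else f2 r)"
    define f3' where "f3' = (\<lambda>r. if r \<le> a1 then L' r else f2' r)"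
    have join1: "P (2 * S) = T (2 * S)" "P' (2 * S) = T' (2 * S)"
      using S0 by (auto simp: P_def P'_def T_def T'_def M_def \<theta>_def J_def)
    have f1: "C1_on S E f1 f1'"
      unfolding f1_def f1'_def by (rule C1_on_glue[OF P T]) (use S0 E0 join1 in auto)
    have i1: "integral {S..E} (hardy_integrand c w f1 f1') =
       integral {S..2*S} (hardy_integrand c w P P') + integral {2*S..E} (hardy_integrand c w T T')"
      unfolding f1_def f1'_def
      by (rule hardy_integral_glue[OF P T]) (use S0 E0 join1 in \<open>auto intro: w_cont_Icc\<close>)
    have join2: "S powr c = f1 S" "c * S powr (c - 1) = f1' S"
      using S0 by (auto simp: f1_def f1'_def P_def P'_def)
    have pw: "C1_on a1 S (\<lambda>r. r powr c) (\<lambda>r. c * r powr (c - 1))"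
      by (rule powr_C1_on) (use a in auto)
    have f2: "C1_on a1 E f2 f2'"
      unfolding f2_def f2'_def by (rule C1_on_glue[OF pw f1]) (use S S0 E0 join2 in auto)
    have i2: "integral {a1..E} (hardy_integrand c w f2 f2') =
       integral {a1..S} (hardy_integrand c w (\<lambda>r. r powr c) (\<lambda>r. c * r powr (c - 1))) +
       integral {S..E} (hardy_integrand c w f1 f1')"
      unfolding f2_def f2'_def
      by (rule hardy_integral_glue[OF pw f1]) (use a S S0 E0 join2 in \<open>auto intro: w_cont_Icc\<close>)
    have z: "integral {a1..S} (hardy_integrand c w (\<lambda>r. r powr c) (\<lambda>r. c * r powr (c - 1))) = 0"
      by (subst integral_cong[where g="\<lambda>_. 0"]) (use a in \<open>auto simp: hardy_integrand_powr\<close>)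
    have join3: "L a1 = f2 a1" "L' a1 = f2' a1"
      using S by (auto simp: L_def L'_def f2_def f2'_def)
    have f3: "C1_on a E f3 f3'"
      unfolding f3_def f3'_def by (rule C1_on_glue[OF L f2]) (use S S0 E0 a join3 in auto)
    have i3: "integral {a..E} (hardy_integrand c w f3 f3') =
       C0 + integral {a1..E} (hardy_integrand c w f2 f2')"
      unfolding f3_def f3'_def C0_def
      by (rule hardy_integral_glue[OF L f2]) (use a S S0 E0 join3 in \<open>auto intro: w_cont_Icc\<close>)
    have "f3 a = 0" using a by (simp add: f3_def L_def a1_def)
    moreover have "f3 E = 0"
      using S S0 E_gt a JE_pos by (auto simp: f3_def f2_def f1_def T_def)
    ultimately have pos: "0 \<le> integral {a..E} (hardy_integrand c w f3 f3')"
      using hardy[OF a(1) _ f3] S0 E_gt a S by auto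
    \<comment> \<open>It suffices that \<open>r * P' r \<le> c * P r\<close>. In terms of
      \<open>x = r / S\<close> this holds because \<open>x * (2 - x) \<le> 1\<close>, while
      \<open>P r\<close> is at least \<open>S powr c\<close>.\<close>
    have Pneg: "integral {S..2*S} (hardy_integrand c w P P') \<le> 0"
    proof -
      have "hardy_integrand c w P P' r \<le> 0" if r: "r \<in> {S..2*S}" for r
      proof -
        define x where "x = r / S"
        have x: "1 \<le> x" "x \<le> 2" using r S0 by (auto simp: x_def field_simps)
        have rx: "r = S * x" using S0 by (simp add: x_def)
        have "0 \<le> x * (2 - x)" using x by simp
        moreover have "x * (2 - x) \<le> 1 + c * (1 - (2 - x)\<^sup>2) / 2"
        proof -
          have "0 \<le> (x - 1)\<^sup>2" by simp
          then have "x * (2 - x) \<le> 1" by (simp add: power2_eq_square algebra_simps)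
          moreover have "(2 - x)\<^sup>2 \<le> 1" using x by (simp add: abs_square_le_1)
          ultimately show ?thesis using c_pos by (smt (verit) divide_nonneg_pos mult_nonneg_nonneg)
        qed
        ultimately have "(x * (2 - x))\<^sup>2 \<le> (1 + c * (1 - (2 - x)\<^sup>2) / 2)\<^sup>2"
          by (rule power_mono[rotated])
        then have "c\<^sup>2 * (S powr c)\<^sup>2 * (x * (2 - x))\<^sup>2 \<le> c\<^sup>2 * (S powr c)\<^sup>2 * (1 + c * (1 - (2 - x)\<^sup>2) / 2)\<^sup>2"
          by (intro mult_left_mono) auto
        moreover have "r * P' r = c * S powr c * (x * (2 - x))"
          using S0 by (simp add: P'_def rx powr_diff)
        moreover have "P r = S powr c * (1 + c * (1 - (2 - x)\<^sup>2) / 2)"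
          by (simp add: P_def x_def)
        ultimately have "(r * P' r)\<^sup>2 \<le> c\<^sup>2 * (P r)\<^sup>2" by (simp add: power_mult_distrib mult_ac)
        then have "(P' r)\<^sup>2 \<le> c\<^sup>2 * (P r)\<^sup>2 / r\<^sup>2"
          using r S0 by (simp add: power_mult_distrib field_simps)
        moreover have "w r > 0" using w_pos r S0 by auto
        ultimately show ?thesis unfolding hardy_integrand_def by (simp add: mult_le_0_iff)
      qed
      then have "integral {S..2*S} (hardy_integrand c w P P') \<le> integral {S..2*S} (\<lambda>_. 0)"
        by (intro integral_le integrable_continuous_real hardy_integrand_continuous[OF P] w_cont_Icc S0) auto
      then show ?thesis by simp
    qed
    \<comment> \<open>The gradient part is at most \<open>M\<^sup>2 / J E\<close>, using that the
      square of \<open>\<theta>\<close> is at most \<open>\<theta>\<close>. Of the negative part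
      only \<open>{2 * S..B}\<close> is kept, where the test function is at least
      \<open>S powr c / 2\<close>; this is the integral to be bounded.\<close>
    have Tint: "integral {2*S..E} (hardy_integrand c w T T') \<le>
        1 - c\<^sup>2 * (S powr c)\<^sup>2 / 4 * integral {2*S..B} (\<lambda>r. w r / r\<^sup>2)"
    proof -
      have cw: "continuous_on {2*S..E} (\<lambda>r. w r / r\<^sup>2)"
        by (intro continuous_intros w_cont_Icc) (use S0 in auto)
      define K where "K = c\<^sup>2 * (S powr c)\<^sup>2 / 4"
      define Z where "Z = (\<lambda>r. if r \<in> {2*S..B} then w r / r\<^sup>2 else 0)"
      have sub: "{2*S..B} \<subseteq> {2*S..E}" using BE by auto
      then have intB: "Z integrable_on {2*S..E}" "integral {2*S..E} Z = integral {2*S..B} (\<lambda>r. w r / r\<^sup>2)"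
        using integrable_continuous_real[OF continuous_on_subset[OF cw sub]]
        unfolding Z_def integrable_restrict_Int integral_restrict_Int by (simp_all only: Int_absorb2 Int_absorb1)
      have le: "hardy_integrand c w T T' r \<le> M\<^sup>2 / (J E)\<^sup>2 * (\<theta> r / w r) - K * Z r"
        if r: "r \<in> {2*S..E}" for r
      proof -
        have wr: "w r > 0" "r > 0" using w_pos r S0 by auto
        have "\<theta> r * \<theta> r \<le> \<theta> r" using \<theta>01[of r] r by (simp add: mult_left_le)
        then have "w r * (T' r)\<^sup>2 \<le> M\<^sup>2 / (J E)\<^sup>2 * (\<theta> r / w r)"
          unfolding T'_def using wr JE_pos M_pos
          by (auto simp: power_mult_distrib power_divide power2_eq_square field_simps intro!: mult_left_mono)
        moreover have "K * Z r \<le> w r * (c\<^sup>2 * (T r)\<^sup>2 / r\<^sup>2)"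
        proof (cases "r \<le> B")
          case True
          have "J r \<le> J B" using True J_mono by auto
          then have "J r / J E \<le> 1 / 2" using JE_pos by (simp add: field_simps)
          then have "M * (1 / 2) \<le> T r" unfolding T_def using M_pos by (intro mult_left_mono) auto
          then have "M / 2 \<le> T r" by simp
          moreover have "S powr c \<le> M" "0 \<le> S powr c" unfolding M_def using c_pos by (simp_all add: algebra_simps powr_ge_zero)
          ultimately have "(S powr c / 2)\<^sup>2 \<le> (T r)\<^sup>2" by (intro power_mono) auto
          then have "c\<^sup>2 * (S powr c / 2)\<^sup>2 \<le> c\<^sup>2 * (T r)\<^sup>2" by (intro mult_left_mono) auto
          then have "K \<le> c\<^sup>2 * (T r)\<^sup>2" by (simp add: K_def power_divide)
          then have "K * (w r / r\<^sup>2) \<le> c\<^sup>2 * (T r)\<^sup>2 * (w r / r\<^sup>2)" using wr by (intro mult_right_mono) auto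
          then show ?thesis using True r by (simp add: Z_def mult_ac)
        next
          case False
          then show ?thesis using wr by (simp add: Z_def)
        qed
        ultimately show ?thesis unfolding hardy_integrand_def by (simp add: right_diff_distrib)
      qed
      have iV: "(\<lambda>r. M\<^sup>2 / (J E)\<^sup>2 * (\<theta> r / w r)) integrable_on {2*S..E}" "(\<lambda>r. K * Z r) integrable_on {2*S..E}"
        by (intro integrable_on_mult_right intB integrable_continuous_real[OF cont_\<theta>w])+
      have iU: "(\<lambda>r. M\<^sup>2 / (J E)\<^sup>2 * (\<theta> r / w r) - K * Z r) integrable_on {2*S..E}"
        by (intro integrable_diff iV)
      have "integral {2*S..E} (hardy_integrand c w T T') \<le>
        integral {2*S..E} (\<lambda>r. M\<^sup>2 / (J E)\<^sup>2 * (\<theta> r / w r) - K * Z r)"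
        by (rule integral_le[OF integrable_continuous_real iU le])
           (use S0 in \<open>auto intro!: hardy_integrand_continuous[OF T] w_cont_Icc\<close>)
      also have "\<dots> = M\<^sup>2 / (J E)\<^sup>2 * J E - K * integral {2*S..B} (\<lambda>r. w r / r\<^sup>2)"
        unfolding integral_diff[OF iV(1) iV(2)] by (simp only: integral_mult_right intB J_def)
      also have "M\<^sup>2 / (J E)\<^sup>2 * J E \<le> 1" using JE_pos by (simp add: power2_eq_square)
      finally show ?thesis by (simp add: K_def)
    qed
    define I where "I = integral {2*S..B} (\<lambda>r. w r / r\<^sup>2)"
    define p where "p = S powr (-2 * c)"
    \<comment> \<open>The four pieces contribute at most \<open>C0\<close>, 0, 0 and
      \<open>1 - c\<^sup>2 * (S powr c)\<^sup>2 / 4 * I\<close>, and their sum is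
      nonnegative.\<close>
    have "c\<^sup>2 * (S powr c)\<^sup>2 / 4 * I \<le> C0 + 1"
      using pos i1 i2 i3 z Pneg Tint unfolding I_def by linarith
    then have "c\<^sup>2 * (S powr c)\<^sup>2 / 4 * I * p \<le> (C0 + 1) * p"
      unfolding p_def by (intro mult_right_mono powr_ge_zero)
    moreover have one: "(S powr c)\<^sup>2 * p = 1"
      using S0 unfolding p_def by (simp add: power2_eq_square flip: powr_add)
    have "c\<^sup>2 / 4 * I = c\<^sup>2 / 4 * I * ((S powr c)\<^sup>2 * p)" by (simp only: one mult_1_right)
    then have "c\<^sup>2 / 4 * I = c\<^sup>2 * (S powr c)\<^sup>2 / 4 * I * p" by (simp only: divide_inverse mult_ac)
    ultimately have "c\<^sup>2 / 4 * I \<le> (C0 + 1) * p" by linarith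
    then show ?thesis using c_pos unfolding I_def[symmetric] p_def[symmetric] by (simp add: field_simps)
  qed
  show ?thesis
  \<comment> \<open>The estimate starts at \<open>2 * S\<close>, so it is applied to
    \<open>S / 2\<close>; the factor \<open>2 powr (2 * c)\<close> comes from this halving.\<close>
  proof (rule exI[of _ "4 * (C0 + 1) / c\<^sup>2 * 2 powr (2 * c)"], rule exI[of _ "2 * a1"], intro conjI allI impI)
    show "2 * a1 > R" using a by auto
    fix S B assume S: "2 * a1 \<le> S" "S \<le> B"
    have "(S / 2) powr (- 2 * c) = 2 powr (2 * c) * S powr (-2 * c)"
      using S a by (simp add: powr_divide powr_minus field_simps)
    then show "integral {S..B} (\<lambda>r. w r / r\<^sup>2) \<le> 4 * (C0 + 1) / c\<^sup>2 * 2 powr (2 * c) * S powr (- 2 * c)"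
      using main[of "S / 2" B] S by (simp add: mult_ac)
  qed
qed


text \<open>The dual test function: its flux \<open>- w r * \<eta>' r = min r S powr c\<close> is prescribed,
  and \<open>2 * p * q \<le> p\<^sup>2 + q\<^sup>2\<close> makes the energy density on \<open>{a..S}\<close> a total derivative.\<close>

lemma dual_energy_estimate:
  assumes ab: "R < a" "a + 1 = a1" "a1 \<le> S" "S < B"
  defines "\<phi> \<equiv> \<lambda>r. min r S powr c"
  defines "K \<equiv> integral {a..B} (\<lambda>r. \<phi> r / w r)"
  shows "S powr (2 * c) * integral {S..B} (\<lambda>r. 1 / w r) \<le>
    8 * K\<^sup>2 * integral {a..a1} w + 2 * integral {a..a1} (\<lambda>r. (r powr c)\<^sup>2 / w r) + 2 * K * a1 powr c"
proof -
  have a0: "a > 0" "a1 > 0" "a \<le> a1" "a < a1" "S > 0" "a \<le> S" "R < S" "R < a1" "a1 \<le> B" using ab R_pos by auto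
  have \<phi>cont: "continuous_on {x..y} \<phi>" if "x \<ge> a" for x y
    unfolding \<phi>_def by (intro continuous_intros) (use that a0 in auto)
  have \<phi>wcont: "continuous_on {a..B} (\<lambda>r. \<phi> r / w r)"
    by (intro continuous_intros \<phi>cont w_cont_Icc) (use a0 ab in \<open>auto simp: w_nonzero\<close>)
  have \<phi>pos: "\<phi> r > 0" if "r \<ge> a" for r unfolding \<phi>_def using that a0 by auto
  have \<phi>w0: "\<phi> r / w r \<ge> 0" if "r \<ge> a" for r
    using \<phi>pos[OF that] w_pos[of r] ab that by simp
  \<comment> \<open>This is the integral of \<open>\<phi> / w\<close> over \<open>{r..B}\<close>,
    written from the left end so that its derivative is immediate. It decreases from
    \<open>K\<close> at \<open>a\<close> to 0 at \<open>B\<close>.\<close>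
  define \<eta> where "\<eta> = (\<lambda>r. K - integral {a..r} (\<lambda>r. \<phi> r / w r))"
  define \<eta>' where "\<eta>' = (\<lambda>r. - (\<phi> r / w r))"
  have d\<eta>: "(\<eta> has_real_derivative \<eta>' x) (at x within {a..B})" if "x \<in> {a..B}" for x
    unfolding \<eta>_def \<eta>'_def
    by (auto intro!: derivative_eq_intros integral_has_real_derivative[OF \<phi>wcont that])
  have C1\<eta>: "C1_on x y \<eta> \<eta>'" if "a \<le> x" "y \<le> B" for x y
    unfolding C1_on_def
  proof safe
    fix z assume "z \<in> {x..y}"
    then show "(\<eta> has_real_derivative \<eta>' z) (at z within {x..y})"
      using that by (intro DERIV_subset[OF d\<eta>]) auto
  next
    show "continuous_on {x..y} \<eta>'" unfolding \<eta>'_def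
      by (rule continuous_on_subset[of "{a..B}"]) (use that in \<open>auto intro!: continuous_intros \<phi>wcont\<close>)
  qed
  have \<eta>alt: "\<eta> r = integral {r..B} (\<lambda>r. \<phi> r / w r)" if "r \<in> {a..B}" for r
  proof -
    have "integral {a..r} (\<lambda>r. \<phi> r / w r) + integral {r..B} (\<lambda>r. \<phi> r / w r) = K"
      unfolding K_def by (rule Henstock_Kurzweil_Integration.integral_combine)
        (use that \<phi>wcont in \<open>auto intro: integrable_continuous_real\<close>)
    then show ?thesis by (simp add: \<eta>_def)
  qed
  have \<eta>0: "0 \<le> \<eta> r" if "r \<in> {a..B}" for r
    unfolding \<eta>alt[OF that] by (rule integral_nonneg)
      (use that \<phi>w0 \<phi>wcont in \<open>auto intro!: integrable_continuous_real intro: continuous_on_subset\<close>)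
  have \<eta>K: "\<eta> r \<le> K" if "r \<in> {a..B}" for r
  proof -
    have "0 \<le> integral {a..r} (\<lambda>r. \<phi> r / w r)"
      by (rule integral_nonneg)
        (use that \<phi>w0 \<phi>wcont in \<open>auto intro!: integrable_continuous_real intro: continuous_on_subset\<close>)
    then show ?thesis by (simp add: \<eta>_def)
  qed
  have "K \<ge> 0" using \<eta>0[of a] a0 by (auto simp: \<eta>_def)
  define s where "s = (\<lambda>r. 1 - (a1 - r)\<^sup>2)"
  define f where "f = (\<lambda>r. s r * \<eta> r)"
  define f' where "f' = (\<lambda>r. 2 * (a1 - r) * \<eta> r + s r * \<eta>' r)"
  have s01: "0 \<le> s r \<and> s r \<le> 1" if "r \<in> {a..a1}" for r
    using that ab unfolding s_def by (auto simp: abs_square_le_1)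
  have C1f: "C1_on a a1 f f'"
  proof -
    have "(f has_real_derivative f' x) (at x within {a..a1})" if "x \<in> {a..a1}" for x
      unfolding f_def f'_def s_def using C1\<eta>[of a a1] that a0
      by (auto intro!: derivative_eq_intros simp: C1_on_def)
    moreover have "continuous_on {a..a1} f'"
      unfolding f'_def s_def
      by (intro continuous_intros C1_on_continuous[OF C1\<eta>] ) (use C1\<eta>[of a a1] a0 in \<open>auto simp: C1_on_def\<close>)
    ultimately show ?thesis unfolding C1_on_def by blast
  qed
  have join: "f a1 = \<eta> a1" "f' a1 = \<eta>' a1" by (auto simp: f_def f'_def s_def)
  define h where "h = (\<lambda>x. if x \<le> a1 then f x else \<eta> x)"
  define h' where "h' = (\<lambda>x. if x \<le> a1 then f' x else \<eta>' x)"
  have "0 \<le> integral {a..B} (hardy_integrand c w h h')"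
  proof (rule hardy)
    show "C1_on a B h h'"
      unfolding h_def h'_def by (rule C1_on_glue[OF C1f C1\<eta>]) (use a0 join in auto)
    have "s a = 0" using ab by (auto simp: s_def)
    then show "h a = 0" using a0 by (simp add: h_def f_def)
    show "h B = 0" using ab a0 by (simp add: h_def \<eta>alt)
  qed (use ab in auto)
  also have "\<dots> = integral {a..a1} (hardy_integrand c w f f') + integral {a1..B} (hardy_integrand c w \<eta> \<eta>')"
    unfolding h_def h'_def
    by (rule hardy_integral_glue[OF C1f C1\<eta>]) (use a0 ab join in \<open>auto intro: w_cont_Icc\<close>)
  also have "integral {a1..B} (hardy_integrand c w \<eta> \<eta>') =
      integral {a1..S} (hardy_integrand c w \<eta> \<eta>') + integral {S..B} (hardy_integrand c w \<eta> \<eta>')"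
    by (rule Henstock_Kurzweil_Integration.integral_combine[symmetric])
       (use a0 ab in \<open>auto intro!: integrable_continuous_real hardy_integrand_continuous[OF C1\<eta>] w_cont_Icc\<close>)
  finally have tot: "0 \<le> integral {a..a1} (hardy_integrand c w f f') +
      (integral {a1..S} (hardy_integrand c w \<eta> \<eta>') + integral {S..B} (hardy_integrand c w \<eta> \<eta>'))" .
  have left: "integral {a..a1} (hardy_integrand c w f f') \<le>
     8 * K\<^sup>2 * integral {a..a1} w + 2 * integral {a..a1} (\<lambda>r. (r powr c)\<^sup>2 / w r)"
  proof -
    have iw: "w integrable_on {a..a1}" "(\<lambda>r. (r powr c)\<^sup>2 / w r) integrable_on {a..a1}"
      by (intro integrable_continuous_real continuous_intros w_cont_Icc; use ab a0 in \<open>auto simp: w_nonzero\<close>)+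
    have "integral {a..a1} (hardy_integrand c w f f') \<le>
       integral {a..a1} (\<lambda>r. 8 * K\<^sup>2 * w r + 2 * ((r powr c)\<^sup>2 / w r))"
    proof (rule integral_le)
      show "hardy_integrand c w f f' integrable_on {a..a1}"
        by (intro integrable_continuous_real hardy_integrand_continuous[OF C1f] w_cont_Icc) (use ab a0 in auto)
      show "(\<lambda>r. 8 * K\<^sup>2 * w r + 2 * ((r powr c)\<^sup>2 / w r)) integrable_on {a..a1}"
        by (intro integrable_add integrable_on_mult_right iw)
      fix r assume r: "r \<in> {a..a1}"
      have wr: "w r > 0" using w_pos r ab by auto
      have "hardy_integrand c w f f' r \<le> w r * (f' r)\<^sup>2"
        unfolding hardy_integrand_def using wr by (intro mult_left_mono) auto
      also have "(f' r)\<^sup>2 \<le> 2 * (2 * (a1 - r) * \<eta> r)\<^sup>2 + 2 * (s r * \<eta>' r)\<^sup>2"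
        unfolding f'_def power2_sum using sum_squares_bound[of "2 * (a1 - r) * \<eta> r" "s r * \<eta>' r"] by simp
      also have "(2 * (a1 - r) * \<eta> r)\<^sup>2 \<le> (2 * 1 * K)\<^sup>2"
        using r a0 ab \<eta>0[of r] \<eta>K[of r] by (intro power_mono mult_mono) auto
      also have "(s r * \<eta>' r)\<^sup>2 \<le> (1 * \<eta>' r)\<^sup>2"
        unfolding power_mult_distrib using s01[OF r] by (intro mult_right_mono power_mono) auto
      also have "(1 * \<eta>' r)\<^sup>2 = (r powr c)\<^sup>2 / (w r)\<^sup>2"
        using r ab by (simp add: \<eta>'_def \<phi>_def power_divide)
      also have "w r * (2 * (2 * 1 * K)\<^sup>2 + 2 * ((r powr c)\<^sup>2 / (w r)\<^sup>2)) =
          8 * K\<^sup>2 * w r + 2 * ((r powr c)\<^sup>2 / w r)"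
        using wr by (simp add: power2_eq_square field_simps)
      finally show "hardy_integrand c w f f' r \<le> 8 * K\<^sup>2 * w r + 2 * ((r powr c)\<^sup>2 / w r)"
        using wr by simp
    qed
    also have "\<dots> = 8 * K\<^sup>2 * integral {a..a1} w + 2 * integral {a..a1} (\<lambda>r. (r powr c)\<^sup>2 / w r)"
      by (subst integral_add[OF integrable_on_mult_right[OF iw(1)] integrable_on_mult_right[OF iw(2)]])
         (simp only: integral_mult_right)
    finally show ?thesis .
  qed
  \<comment> \<open>With \<open>p = - \<eta>'\<close> and \<open>q = c * \<eta> / r\<close> the
    density is bounded by the derivative of \<open>- 2 * \<eta> r * r powr c\<close>, so only
    boundary terms remain.\<close>
  have mid: "integral {a1..S} (hardy_integrand c w \<eta> \<eta>') \<le> 2 * \<eta> a1 * a1 powr c - 2 * \<eta> S * S powr c"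
  proof -
    have "((\<lambda>r. - 2 * (\<eta>' r * r powr c + \<eta> r * (c * r powr (c - 1)))) has_integral
       (- 2 * (\<eta> S * S powr c)) - (- 2 * (\<eta> a1 * a1 powr c))) {a1..S}"
      by (rule fundamental_theorem_of_calculus)
         (use C1\<eta>[of a1 S] powr_C1_on[of a1 S c] ab a0 in
           \<open>auto simp: C1_on_def simp flip: has_real_derivative_iff_has_vector_derivative intro!: derivative_eq_intros\<close>)
    note fi = this
    have "integral {a1..S} (hardy_integrand c w \<eta> \<eta>') \<le> (- 2 * (\<eta> S * S powr c)) - (- 2 * (\<eta> a1 * a1 powr c))"
    proof (rule has_integral_le[OF integrable_integral fi])
      show "hardy_integrand c w \<eta> \<eta>' integrable_on {a1..S}"
        by (intro integrable_continuous_real hardy_integrand_continuous[OF C1\<eta>] w_cont_Icc) (use ab a0 in auto)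
      fix r assume r: "r \<in> {a1..S}"
      have wr: "w r > 0" "r > 0" using w_pos r ab a0 by auto
      define p where "p = r powr c / w r"
      define q where "q = c * \<eta> r / r"
      have "0 \<le> w r * (p - q)\<^sup>2" using wr by simp
      then have "w r * (p\<^sup>2 - q\<^sup>2) \<le> 2 * p * w r * (p - q)" by (simp add: power2_eq_square algebra_simps)
      moreover have "hardy_integrand c w \<eta> \<eta>' r = w r * (p\<^sup>2 - q\<^sup>2)"
        using r unfolding hardy_integrand_def p_def q_def \<eta>'_def \<phi>_def
        by (simp add: power_mult_distrib power_divide)
      moreover have "- 2 * (\<eta>' r * r powr c + \<eta> r * (c * r powr (c - 1))) = 2 * p * w r * (p - q)"
        using wr r unfolding p_def q_def \<eta>'_def \<phi>_def
        by (simp add: powr_diff field_simps)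
      ultimately show "hardy_integrand c w \<eta> \<eta>' r \<le> - 2 * (\<eta>' r * r powr c + \<eta> r * (c * r powr (c - 1)))"
        by simp
    qed
    then show ?thesis by simp
  qed
  \<comment> \<open>The flux is constant beyond \<open>S\<close>, so dropping the potential leaves
    \<open>S powr c * \<eta> S\<close>. The boundary term \<open>- 2 * \<eta> S * S powr c\<close>
    of the middle part outweighs it, and the surplus \<open>S powr c * \<eta> S\<close> is the
    left-hand side of the claim.\<close>
  have right: "integral {S..B} (hardy_integrand c w \<eta> \<eta>') \<le> S powr c * \<eta> S"
  proof -
    have "integral {S..B} (hardy_integrand c w \<eta> \<eta>') \<le> integral {S..B} (\<lambda>r. S powr c * (\<phi> r / w r))"
    proof (rule integral_le)
      show "hardy_integrand c w \<eta> \<eta>' integrable_on {S..B}"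
        by (intro integrable_continuous_real hardy_integrand_continuous[OF C1\<eta>] w_cont_Icc) (use ab a0 in auto)
      show "(\<lambda>r. S powr c * (\<phi> r / w r)) integrable_on {S..B}"
        by (intro integrable_on_mult_right integrable_continuous_real continuous_on_subset[OF \<phi>wcont]) (use a0 in auto)
      fix r assume r: "r \<in> {S..B}"
      have wr: "w r > 0" using w_pos r a0 by auto
      have "hardy_integrand c w \<eta> \<eta>' r \<le> w r * (\<eta>' r)\<^sup>2"
        unfolding hardy_integrand_def using wr by (intro mult_left_mono) auto
      also have "\<dots> = S powr c * (\<phi> r / w r)"
        using wr r by (simp add: \<eta>'_def \<phi>_def power2_eq_square)
      finally show "hardy_integrand c w \<eta> \<eta>' r \<le> S powr c * (\<phi> r / w r)" .
    qed
    then show ?thesis unfolding integral_mult_right using a0 ab by (simp add: \<eta>alt)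
  qed
  have "\<eta> S = S powr c * integral {S..B} (\<lambda>r. 1 / w r)"
  proof -
    have "integral {S..B} (\<lambda>r. \<phi> r / w r) = integral {S..B} (\<lambda>r. S powr c * (1 / w r))"
      by (rule integral_cong) (auto simp: \<phi>_def)
    then show ?thesis unfolding integral_mult_right using a0 ab by (simp add: \<eta>alt)
  qed
  then have "S powr (2 * c) * integral {S..B} (\<lambda>r. 1 / w r) = S powr c * \<eta> S"
    by (simp flip: powr_add)
  moreover have "\<eta> a1 * a1 powr c \<le> K * a1 powr c" using \<eta>K[of a1] a0 by (intro mult_right_mono) auto
  ultimately show ?thesis using tot left mid right by (simp add: algebra_simps)
qed


text \<open>With \<open>K S = \<integral> min r S powr c / w\<close>, the energy estimate bounds \<open>K'\<close> by a multiple of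
  \<open>S powr (- c - 1) * (K S)\<^sup>2\<close>. Integrating this inequality for \<open>1 / K\<close> shows that \<open>K\<close> stays bounded.\<close>

lemma inverse_decay_of_bounded:
  assumes bdd: "\<And>B. integral {R + 1..B} (\<lambda>r. 1 / w r) \<le> X"
  shows "\<exists>C S0. S0 > R \<and> (\<forall>S\<ge>S0. \<forall>B\<ge>S. integral {S..B} (\<lambda>r. 1 / w r) \<le> C * S powr (-2 * c))"
proof -
  define a where "a = R + 1"
  define a1 where "a1 = a + 1"
  have a: "R < a" "0 < a" "a < a1" "0 < a1" using R_pos by (auto simp: a_def a1_def)
  define A where "A = (\<lambda>r. integral {a..r} (\<lambda>r. 1 / w r))"
  define F where "F = (\<lambda>r. integral {a..r} (\<lambda>r. r powr c / w r))"
  have cw: "continuous_on {x..y} (\<lambda>r. 1 / w r)" if "a \<le> x" for x y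
    by (intro continuous_intros w_cont_Icc) (use a that in \<open>auto simp: w_nonzero\<close>)
  have cF: "continuous_on {x..y} (\<lambda>r. r powr c / w r)" if "a \<le> x" for x y
    by (intro continuous_intros w_cont_Icc) (use a that in \<open>auto simp: w_nonzero\<close>)
  have wpos: "0 \<le> r powr c / w r" "0 < w r" if "a \<le> r" for r
    using w_pos[of r] that a by auto
  have A_mono: "A x \<le> A y" if "x \<le> y" for x y
    unfolding A_def using that by (intro integral_inverse_w_mono a) auto
  have A_split: "integral {S..B} (\<lambda>r. 1 / w r) = A B - A S" if "a \<le> S" "S \<le> B" for S B
    using Henstock_Kurzweil_Integration.integral_combine[of a S B "\<lambda>r. 1 / w r"] that cw
    by (auto simp: A_def integrable_continuous_real)
  have F_split: "integral {S..B} (\<lambda>r. r powr c / w r) = F B - F S" if "a \<le> S" "S \<le> B" for S B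
    using Henstock_Kurzweil_Integration.integral_combine[of a S B "\<lambda>r. r powr c / w r"] that cF
    by (auto simp: F_def integrable_continuous_real)
  have F_mono: "F x \<le> F y" if "a \<le> x" "x \<le> y" for x y
  proof -
    have "0 \<le> integral {x..y} (\<lambda>r. r powr c / w r)"
      by (rule integral_nonneg) (use that wpos in \<open>auto intro!: integrable_continuous_real cF\<close>)
    then show ?thesis using F_split that by simp
  qed
  have F_le: "F y - F x \<le> y powr c * (A y - A x)" if "a \<le> x" "x \<le> y" for x y
  proof -
    have "integral {x..y} (\<lambda>r. r powr c / w r) \<le> integral {x..y} (\<lambda>r. y powr c * (1 / w r))"
    proof (rule integral_le)
      show "(\<lambda>r. y powr c * (1 / w r)) integrable_on {x..y}"
        by (intro integrable_on_mult_right integrable_continuous_real cw that)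
      show "(\<lambda>r. r powr c / w r) integrable_on {x..y}"
        by (intro integrable_continuous_real cF that)
      fix r assume "r \<in> {x..y}"
      then show "r powr c / w r \<le> y powr c * (1 / w r)"
        using wpos[of r] that a c_pos by (auto intro!: divide_right_mono powr_mono2)
    qed
    then show ?thesis unfolding integral_mult_right using that F_split A_split by simp
  qed
  \<comment> \<open>This gives a lower bound for \<open>K\<close> independent of \<open>S\<close>
    and \<open>B\<close>, by which the constant and linear terms of the energy estimate are absorbed
    into its quadratic term.\<close>
  have "F a1 > 0"
  proof -
    have "a powr c * (A a1 - A a) \<le> F a1 - F a"
    proof -
      have "integral {a..a1} (\<lambda>r. a powr c * (1 / w r)) \<le> integral {a..a1} (\<lambda>r. r powr c / w r)"
      proof (rule integral_le)
        show "(\<lambda>r. a powr c * (1 / w r)) integrable_on {a..a1}"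
          by (intro integrable_on_mult_right integrable_continuous_real cw) auto
        show "(\<lambda>r. r powr c / w r) integrable_on {a..a1}"
          by (intro integrable_continuous_real cF) auto
        fix r assume "r \<in> {a..a1}"
        then show "a powr c * (1 / w r) \<le> r powr c / w r"
          using wpos[of r] a c_pos by (auto intro!: divide_right_mono powr_mono2)
      qed
      then show ?thesis unfolding integral_mult_right using a F_split[of a a1] A_split[of a a1] by simp
    qed
    moreover have "0 < A a1 - A a"
    proof -
      have "integral {a..a1} (\<lambda>r. 1 / w r) \<noteq> 0"
      proof
        assume "integral {a..a1} (\<lambda>r. 1 / w r) = 0"
        then have "\<forall>x\<in>{a..a1}. 1 / w x = 0"
          using integral_eq_0_iff[OF cw[of a a1] a(3)] wpos(2) by (simp add: less_imp_le)
        then have "1 / w a = 0" using a by auto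
        then show False using wpos(2)[of a] by simp
      qed
      then show ?thesis using A_split[of a a1] A_mono[of a a1] a by auto
    qed
    moreover have "0 < a powr c" using a by simp
    ultimately have "0 < F a1 - F a" by (meson less_le_trans mult_pos_pos)
    then show ?thesis by (simp add: F_def)
  qed
  define k0 where "k0 = F a1"
  have k0: "k0 > 0" using \<open>F a1 > 0\<close> by (simp add: k0_def)
  \<comment> \<open>A closed form of the integral of \<open>min r S powr c / w\<close>. When it is
    differentiated in \<open>S\<close>, the two terms containing \<open>1 / w S\<close> cancel and
    leave \<open>c * S powr (c - 1) * (A B - A S)\<close>.\<close>
  define K where "K = (\<lambda>B S. F S + S powr c * (A B - A S))"
  have K_eq: "integral {a..B} (\<lambda>r. min r S powr c / w r) = K B S" if "a \<le> S" "S \<le> B" for S B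
  proof -
    have "integral {a..S} (\<lambda>r. min r S powr c / w r) + integral {S..B} (\<lambda>r. min r S powr c / w r)
       = integral {a..B} (\<lambda>r. min r S powr c / w r)"
      by (rule Henstock_Kurzweil_Integration.integral_combine)
         (use that a in \<open>auto intro!: integrable_continuous_real continuous_intros w_cont_Icc simp: w_nonzero\<close>)
    moreover have "integral {a..S} (\<lambda>r. min r S powr c / w r) = F S"
      unfolding F_def by (rule integral_cong) auto
    moreover have "integral {S..B} (\<lambda>r. min r S powr c / w r) = integral {S..B} (\<lambda>r. S powr c * (1 / w r))"
      by (rule integral_cong) auto
    ultimately show ?thesis unfolding integral_mult_right using that A_split[of S B] by (simp add: K_def)
  qed
  have K_ge: "k0 \<le> K B S" if "a1 \<le> S" "S \<le> B" for S B
  proof -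
    have "0 \<le> S powr c * (A B - A S)" using A_mono[of S B] that by (intro mult_nonneg_nonneg) auto
    then show ?thesis unfolding K_def k0_def using F_mono[of a1 S] that a by simp
  qed
  define Wi where "Wi = integral {a..a1} w"
  define V where "V = integral {a..a1} (\<lambda>r. (r powr c)\<^sup>2 / w r)"
  define D where "D = 8 * Wi + 2 * V / k0\<^sup>2 + 2 * a1 powr c / k0"
  have "Wi \<ge> 0" unfolding Wi_def
    by (rule integral_nonneg) (use a wpos in \<open>auto intro!: integrable_continuous_real w_cont_Icc less_imp_le\<close>)
  moreover have "V \<ge> 0" unfolding V_def
    by (rule integral_nonneg)
       (use a wpos in \<open>auto intro!: integrable_continuous_real continuous_intros w_cont_Icc divide_nonneg_pos simp: w_nonzero\<close>)
  ultimately have D: "D > 0" unfolding D_def using k0 a by (intro add_nonneg_pos) auto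
  have est: "S powr (2 * c) * (A B - A S) \<le> D * (K B S)\<^sup>2" if S: "a1 \<le> S" "S \<le> B" for S B
  proof (cases "S = B")
    case True
    then show ?thesis using D by simp
  next
    case False
    define k where "k = K B S"
    have k: "k0 \<le> k" using K_ge S by (simp add: k_def)
    have "S powr (2 * c) * (A B - A S) \<le> 8 * k\<^sup>2 * Wi + 2 * V + 2 * k * a1 powr c"
      using dual_energy_estimate[of a a1 S B] a S False K_eq[of S B] A_split[of S B]
      by (simp add: a1_def Wi_def V_def k_def)
    moreover have "2 * V \<le> 2 * V / k0\<^sup>2 * k\<^sup>2"
    proof -
      have "k0\<^sup>2 \<le> k\<^sup>2" using k k0 by (intro power_mono) auto
      then have "V * k0\<^sup>2 \<le> V * k\<^sup>2" using \<open>V \<ge> 0\<close> by (intro mult_left_mono) auto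
      then show ?thesis using k0 by (simp add: field_simps)
    qed
    moreover have "2 * k * a1 powr c \<le> 2 * a1 powr c / k0 * k\<^sup>2"
    proof -
      have "k * k0 * a1 powr c \<le> k * k * a1 powr c" using k k0 by (intro mult_left_mono mult_right_mono) auto
      then show ?thesis using k0 by (simp add: field_simps power2_eq_square)
    qed
    ultimately show ?thesis unfolding D_def k_def[symmetric] by (simp add: algebra_simps)
  qed
  \<comment> \<open>Convergence of the integral of \<open>1 / w\<close> makes its tail as small as
    wanted. The threshold \<open>1 / (4 * D)\<close> is what the initial condition for the
    differential inequality requires.\<close>
  obtain m where m: "a \<le> m" "\<And>B. A B - A m \<le> 1 / (4 * D)"
  proof -
    have bd: "bdd_above (A ` UNIV)" using bdd unfolding bdd_above_def A_def a_def by auto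
    define L where "L = (SUP r. A r)"
    have "L - 1 / (4 * D) < L" using D by simp
    then obtain m where "L - 1 / (4 * D) < A m" unfolding L_def
      using less_cSUP_iff[OF _ bd] by auto
    moreover have "A m \<le> A (max a m)" by (rule A_mono) auto
    moreover have "A B \<le> L" for B unfolding L_def by (rule cSUP_upper[OF _ bd]) auto
    ultimately have "A B - A (max a m) \<le> 1 / (4 * D)" for B by (smt (verit))
    then show thesis by (intro that[of "max a m"]) auto
  qed
  \<comment> \<open>Large enough for \<open>4 * D * F m \<le> S0 powr c\<close>. Then the mass
    before \<open>m\<close> and the tail after it each contribute at most
    \<open>S0 powr c / 4\<close> to \<open>D * K B S0\<close>.\<close>
  define S0 where "S0 = max a1 m + (4 * D * F m) powr (1 / c)"
  have "0 \<le> (4 * D * F m) powr (1 / c)" by simp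
  then have S0: "S0 \<ge> a1" "S0 \<ge> m" "S0 > 0" using a unfolding S0_def by linarith+
  have Fm: "F m \<ge> 0" using F_mono[of a m] m by (simp add: F_def)
  have S0c: "4 * D * F m \<le> S0 powr c"
  proof -
    have "4 * D * F m = ((4 * D * F m) powr (1 / c)) powr c"
      using c_pos Fm D by (simp add: powr_powr)
    also have "\<dots> \<le> S0 powr c"
      unfolding S0_def using a c_pos by (intro powr_mono2) auto
    finally show ?thesis .
  qed
  have KS0: "D * K B S0 \<le> S0 powr c / 2" if "S0 \<le> B" for B
  proof -
    have "K B S0 \<le> F m + S0 powr c * (A S0 - A m) + S0 powr c * (A B - A S0)"
      unfolding K_def using F_le[of m S0] m S0 by simp
    also have "\<dots> = F m + S0 powr c * (A B - A m)" by (simp add: algebra_simps)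
    also have "\<dots> \<le> F m + S0 powr c * (1 / (4 * D))" using m by (intro add_left_mono mult_left_mono) auto
    finally have "D * K B S0 \<le> D * (F m + S0 powr c * (1 / (4 * D)))" using D by (intro mult_left_mono) auto
    also have "\<dots> \<le> S0 powr c / 2" using S0c D by (simp add: field_simps)
    finally show ?thesis .
  qed
  \<comment> \<open>By \<open>est\<close>, the function \<open>1 / K B s - D * s powr (- c)\<close>
    is increasing in \<open>s\<close>. A quadratic differential inequality alone allows blow-up; the
    smallness at \<open>S0\<close> gives \<open>D * S0 powr (- c) \<le> 1 / (2 * K B S0)\<close>,
    hence \<open>K B S \<le> 2 * K B S0\<close>, uniformly in \<open>B\<close>.\<close>
  have K_bound: "D * K B S \<le> S0 powr c" if S: "S0 \<le> S" "S \<le> B" for S B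
  proof -
    have Kp: "K B s > 0" if "s \<in> {S0..S}" for s using K_ge[of s B] that S S0 k0 by auto
    have "1 / K B S0 - D * S0 powr (- c) \<le> 1 / K B S - D * S powr (- c)"
    proof (rule DERIV_nonneg_imp_increasing_open[of S0 S "\<lambda>s. 1 / K B s - D * s powr (- c)"])
      have dA: "(A has_real_derivative 1 / w x) (at x)" if "x > a" for x
      proof -
        have "(A has_real_derivative 1 / w x) (at x within {a..x+1})"
          unfolding A_def by (rule integral_has_real_derivative[OF cw]) (use that in auto)
        then show ?thesis using at_within_interior[of x "{a..x+1}"] that by simp
      qed
      have dF: "(F has_real_derivative x powr c / w x) (at x)" if "x > a" for x
      proof -
        have "(F has_real_derivative x powr c / w x) (at x within {a..x+1})"
          unfolding F_def by (rule integral_has_real_derivative[OF cF]) (use that in auto)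
        then show ?thesis using at_within_interior[of x "{a..x+1}"] that by simp
      qed
      have dK: "(K B has_real_derivative c * x powr (c - 1) * (A B - A x)) (at x)" if "x > a" for x
        unfolding K_def using that a
        by (auto intro!: derivative_eq_intros dA dF simp: field_simps)
      show "continuous_on {S0..S} (\<lambda>s. 1 / K B s - D * s powr (- c))"
      proof (intro continuous_intros)
        have "continuous_on {S0..S} (K B)"
          by (rule DERIV_continuous_on[OF has_field_derivative_at_within[OF dK]]) (use S0 a in auto)
        then show "continuous_on {S0..S} (K B)" .
      qed (use Kp S0 in \<open>force+\<close>)
      fix x assume x: "S0 < x" "x < S"
      have "((\<lambda>s. 1 / K B s - D * s powr (- c)) has_real_derivative
          - (c * x powr (c - 1) * (A B - A x)) / (K B x)\<^sup>2 - D * (- c * x powr (- c - 1))) (at x)"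
        using x S0 a Kp[of x]
        by (auto intro!: derivative_eq_intros dK simp: power2_eq_square)
      moreover have "0 \<le> - (c * x powr (c - 1) * (A B - A x)) / (K B x)\<^sup>2 - D * (- c * x powr (- c - 1))"
      proof -
        have x0: "x > 0" using x S0 by simp
        have "x powr (2 * c) * (A B - A x) \<le> D * (K B x)\<^sup>2"
          using est[of x B] x S S0 by auto
        then have "c * x powr (- c - 1) * (x powr (2 * c) * (A B - A x)) \<le> c * x powr (- c - 1) * (D * (K B x)\<^sup>2)"
          using c_pos by (intro mult_left_mono) auto
        moreover have px: "x powr (- c - 1) * x powr (2 * c) = x powr (c - 1)"
          using x0 by (simp flip: powr_add)
        have "c * x powr (- c - 1) * (x powr (2 * c) * (A B - A x)) = c * x powr (c - 1) * (A B - A x)"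
          by (simp only: mult.assoc flip: px)
        ultimately have "c * x powr (c - 1) * (A B - A x) \<le> c * x powr (- c - 1) * (D * (K B x)\<^sup>2)"
          by simp
        then have "c * x powr (c - 1) * (A B - A x) / (K B x)\<^sup>2 \<le> c * x powr (- c - 1) * D"
          using Kp[of x] x by (simp add: field_simps)
        then show ?thesis by (simp add: mult_ac)
      qed
      ultimately show "\<exists>y. ((\<lambda>s. 1 / K B s - D * s powr (- c)) has_real_derivative y) (at x) \<and> 0 \<le> y" by blast
    qed (use S in auto)
    moreover have "0 \<le> D * S powr (- c)" using D by simp
    ultimately have 1: "1 / K B S0 - D * S0 powr (- c) \<le> 1 / K B S" by linarith
    have "D * S0 powr (- c) \<le> 1 / (2 * K B S0)"
      using KS0[of B] S Kp[of S0] S0 by (simp add: powr_minus field_simps)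
    with 1 have "1 / (2 * K B S0) \<le> 1 / K B S" by (simp add: field_simps)
    then have "K B S \<le> 2 * K B S0" using Kp[of S] Kp[of S0] S by (simp add: field_simps)
    then have "D * K B S \<le> D * (2 * K B S0)" using D by (intro mult_left_mono) auto
    then show ?thesis using KS0[of B] S by simp
  qed
  show ?thesis
  proof (rule exI[of _ "(S0 powr c)\<^sup>2 / D"], rule exI[of _ S0], intro conjI allI impI)
    show "S0 > R" using S0 a by auto
    fix S B assume S: "S0 \<le> S" "S \<le> B"
    have Spos: "S > 0" using S S0 by auto
    have "K B S \<ge> 0" using K_ge[of S B] S S0 k0 by auto
    then have "(D * K B S)\<^sup>2 \<le> (S0 powr c)\<^sup>2" using K_bound[OF S] D by (intro power_mono) auto
    then have "D * (K B S)\<^sup>2 \<le> (S0 powr c)\<^sup>2 / D" using D by (simp add: field_simps power2_eq_square)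
    then have "S powr (2 * c) * (A B - A S) \<le> (S0 powr c)\<^sup>2 / D" using est[of S B] S S0 by auto
    then have "A B - A S \<le> (S0 powr c)\<^sup>2 / D / S powr (2 * c)"
      by (subst pos_le_divide_eq) (use Spos in \<open>auto simp: mult.commute\<close>)
    then have "A B - A S \<le> (S0 powr c)\<^sup>2 / D * S powr (- (2 * c))"
      by (simp add: powr_minus divide_inverse)
    then show "integral {S..B} (\<lambda>r. 1 / w r) \<le> (S0 powr c)\<^sup>2 / D * S powr (- 2 * c)"
      using A_split[of S B] S S0 a by simp
  qed
qed

lemma decay_dichotomy:
  obtains C S0 where "S0 > R" "\<And>S B. S0 \<le> S \<Longrightarrow> S \<le> B \<Longrightarrow> integral {S..B} (\<lambda>r. w r / r\<^sup>2) \<le> C * S powr (-2 * c)"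
  | C S0 where "S0 > R" "\<And>S B. S0 \<le> S \<Longrightarrow> S \<le> B \<Longrightarrow> integral {S..B} (\<lambda>r. 1 / w r) \<le> C * S powr (-2 * c)"
proof (cases "\<exists>X. \<forall>B. integral {R + 1..B} (\<lambda>r. 1 / w r) \<le> X")
  case True
  then obtain X where "\<And>B. integral {R + 1..B} (\<lambda>r. 1 / w r) \<le> X" by blast
  from inverse_decay_of_bounded[OF this] show ?thesis using that(2) by blast
next
  case False
  then have "\<exists>B. integral {R + 1..B} (\<lambda>r. 1 / w r) > X" for X by (simp add: not_le)
  from decay_of_unbounded[OF this] show ?thesis using that(1) by blast
qed

end

section \<open>Consequences of the two decay rates for the profile\<close>

lemma integral_powr_le:
  fixes e :: real
  assumes "0 < S" "S \<le> B" "e < - 1"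
  shows "integral {S..B} (\<lambda>r. r powr e) \<le> S powr (e + 1) / (- (e + 1))"
proof -
  have "((\<lambda>r. r powr e) has_integral B powr (e + 1) / (e + 1) - S powr (e + 1) / (e + 1)) {S..B}"
  proof (rule fundamental_theorem_of_calculus)
    fix x assume "x \<in> {S..B}"
    then have "((\<lambda>r. r powr (e + 1) / (e + 1)) has_real_derivative x powr e) (at x)"
      using assms by (auto intro!: derivative_eq_intros)
    then show "((\<lambda>r. r powr (e + 1) / (e + 1)) has_vector_derivative x powr e) (at x within {S..B})"
      by (metis has_field_derivative_at_within has_real_derivative_iff_has_vector_derivative)
  qed (use assms in auto)
  then have "integral {S..B} (\<lambda>r. r powr e) = B powr (e + 1) / (e + 1) - S powr (e + 1) / (e + 1)"
    by (rule integral_unique)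
  moreover have "B powr (e + 1) / (e + 1) \<le> 0" using assms by (simp add: divide_nonneg_neg)
  ultimately show ?thesis unfolding divide_minus_right by linarith
qed

text \<open>Integration by parts against the tail integral: a weight \<open>r powr \<beta>\<close>
  costs \<open>\<beta>\<close> in the exponent of the decay as long as
  \<open>\<beta> < \<gamma>\<close>, with the factor
  \<open>\<gamma> / (\<gamma> - \<beta>)\<close>.\<close>

lemma weighted_tail_bound:
  fixes f :: "real \<Rightarrow> real"
  assumes S0: "S0 > 0" and f: "continuous_on {S0..} f" and f0: "\<And>r. r \<ge> S0 \<Longrightarrow> f r \<ge> 0"
    and tail: "\<And>S B. S0 \<le> S \<Longrightarrow> S \<le> B \<Longrightarrow> integral {S..B} f \<le> C * S powr (- \<gamma>)"
    and \<beta>: "0 \<le> \<beta>" "\<beta> < \<gamma>" and S: "S0 \<le> S" "S \<le> B"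
  shows "integral {S..B} (\<lambda>r. r powr \<beta> * f r) \<le> C * (1 + \<beta> / (\<gamma> - \<beta>)) * S powr (\<beta> - \<gamma>)"
proof -
  have cf: "continuous_on {x..y} f" if "S0 \<le> x" for x y
    by (rule continuous_on_subset[OF f]) (use that in auto)
  have cpf: "continuous_on {S..B} (\<lambda>r. r powr \<beta> * f r)"
    using S S0 by (intro continuous_intros cf) auto
  have C0: "C \<ge> 0" using tail[of S0 S0] S0 by (simp add: zero_le_mult_iff)
  define F where "F = (\<lambda>r. integral {S..B} f - integral {S..r} f)"
  have F_eq: "F r = integral {r..B} f" if "r \<in> {S..B}" for r
    using Henstock_Kurzweil_Integration.integral_combine[of S r B f] that S cf
    by (auto simp: F_def integrable_continuous_real)
  have dF: "(F has_real_derivative - f x) (at x within {S..B})" if "x \<in> {S..B}" for x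
    unfolding F_def by (auto intro!: derivative_eq_intros integral_has_real_derivative[OF cf] that S)
  \<comment> \<open>Partial integral, boundary term and the exact tail of
    \<open>\<beta> * C * r powr (\<beta> - \<gamma> - 1)\<close>. Its derivative is nonpositive
    precisely because of the tail bound, so comparing its values at \<open>S\<close> and
    \<open>B\<close> replaces the integration by parts.\<close>
  define \<Psi> where "\<Psi> = (\<lambda>r. integral {S..r} (\<lambda>r. r powr \<beta> * f r) + r powr \<beta> * F r
     + \<beta> * C / (\<gamma> - \<beta>) * r powr (\<beta> - \<gamma>))"
  have d\<Psi>: "(\<Psi> has_real_derivative \<beta> * x powr (\<beta> - 1) * (F x - C * x powr (- \<gamma>))) (at x within {S..B})"
    if x: "x \<in> {S..B}" for x
  proof -
    have pw: "((\<lambda>r. r powr e) has_real_derivative e * x powr (e - 1)) (at x within {S..B})" for e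
      by (rule has_field_derivative_at_within[OF has_real_derivative_powr]) (use x S S0 in auto)
    have "(\<Psi> has_real_derivative x powr \<beta> * f x + ((\<beta> * x powr (\<beta> - 1)) * F x + (- f x) * x powr \<beta>)
       + \<beta> * C / (\<gamma> - \<beta>) * ((\<beta> - \<gamma>) * x powr (\<beta> - \<gamma> - 1))) (at x within {S..B})"
      unfolding \<Psi>_def
      by (rule DERIV_add[OF DERIV_add[OF integral_has_real_derivative[OF cpf x] DERIV_mult[OF pw dF[OF x]]] DERIV_cmult[OF pw]])
    moreover have "x powr (\<beta> - \<gamma> - 1) = x powr (\<beta> - 1) * x powr (- \<gamma>)"
      unfolding powr_add[symmetric] by (rule arg_cong[where f="(powr) x"]) simp
    then have "\<beta> * C / (\<gamma> - \<beta>) * ((\<beta> - \<gamma>) * x powr (\<beta> - \<gamma> - 1)) = - (\<beta> * C * (x powr (\<beta> - 1) * x powr (- \<gamma>)))"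
      using \<beta> by (simp add: field_simps)
    then have "x powr \<beta> * f x + ((\<beta> * x powr (\<beta> - 1)) * F x + (- f x) * x powr \<beta>)
       + \<beta> * C / (\<gamma> - \<beta>) * ((\<beta> - \<gamma>) * x powr (\<beta> - \<gamma> - 1)) = \<beta> * x powr (\<beta> - 1) * (F x - C * x powr (- \<gamma>))"
      by (simp only: right_diff_distrib mult_ac)
    ultimately show ?thesis by simp
  qed
  have "\<Psi> B \<le> \<Psi> S"
  proof (rule DERIV_nonpos_imp_decreasing_open[OF S(2)])
    show "continuous_on {S..B} \<Psi>" by (rule DERIV_continuous_on[OF d\<Psi>])
    fix x assume x: "S < x" "x < B"
    have "at x within {S..B} = at x" by (rule at_within_interior) (use x in auto)
    then have "(\<Psi> has_real_derivative \<beta> * x powr (\<beta> - 1) * (F x - C * x powr (- \<gamma>))) (at x)"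
      using d\<Psi>[of x] x by simp
    moreover have "F x - C * x powr (- \<gamma>) \<le> 0" using tail[of x B] F_eq[of x] x S by simp
    then have "\<beta> * x powr (\<beta> - 1) * (F x - C * x powr (- \<gamma>)) \<le> 0"
      using \<beta> by (intro mult_nonneg_nonpos) auto
    ultimately show "\<exists>y. (\<Psi> has_real_derivative y) (at x) \<and> y \<le> 0" by blast
  qed
  moreover have "integral {S..B} (\<lambda>r. r powr \<beta> * f r) \<le> \<Psi> B"
    using \<beta> C0 by (simp add: \<Psi>_def F_def)
  moreover have "\<Psi> S \<le> S powr \<beta> * (C * S powr (- \<gamma>)) + \<beta> * C / (\<gamma> - \<beta>) * S powr (\<beta> - \<gamma>)"
    unfolding \<Psi>_def using tail[OF S] by (auto simp: F_def intro!: mult_left_mono)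
  moreover have "S powr \<beta> * (C * S powr (- \<gamma>)) = C * S powr (\<beta> - \<gamma>)"
    by (simp add: powr_diff powr_minus divide_inverse)
  ultimately have "integral {S..B} (\<lambda>r. r powr \<beta> * f r) \<le> C * S powr (\<beta> - \<gamma>) + \<beta> * C / (\<gamma> - \<beta>) * S powr (\<beta> - \<gamma>)"
    by linarith
  then show ?thesis by (simp add: algebra_simps)
qed

section \<open>Fast case: upper bounds for increments and for power integrals of the
  derivative\<close>

locale fast_profile =
  fixes U \<omega> :: "real \<Rightarrow> real" and n :: nat and c C S0 :: real
  assumes n: "n \<ge> 3" and c: "c > 1" and S0: "S0 \<ge> 1"
    and dU: "\<And>r. r \<ge> 1 \<Longrightarrow> (U has_real_derivative \<omega> r) (at r)"
    and \<omega>_cont: "continuous_on {1..} \<omega>"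
    and tail: "\<And>S B. S0 \<le> S \<Longrightarrow> S \<le> B \<Longrightarrow>
      integral {S..B} (\<lambda>r. r ^ (n - 1) * (\<omega> r)\<^sup>2 / r\<^sup>2) \<le> C * S powr (-2 * c)"
begin

lemma weighted_square_bound:
  assumes "2 \<le> \<beta>" "\<beta> < 2 * c" "S0 \<le> S" "S \<le> B"
  shows "integral {S..B} (\<lambda>r. r powr (\<beta> - 2) * (r ^ (n - 1) * (\<omega> r)\<^sup>2)) \<le> C * (1 + \<beta> / (2 * c - \<beta>)) * S powr (\<beta> - 2 * c)"
proof -
  have "integral {S..B} (\<lambda>r. r powr (\<beta> - 2) * (r ^ (n - 1) * (\<omega> r)\<^sup>2)) =
    integral {S..B} (\<lambda>r. r powr \<beta> * (r ^ (n - 1) * (\<omega> r)\<^sup>2 / r\<^sup>2))"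
    by (rule integral_cong) (use assms S0 in \<open>auto simp: powr_diff powr_numeral\<close>)
  also have "\<dots> \<le> C * (1 + \<beta> / (2 * c - \<beta>)) * S powr (\<beta> - 2 * c)"
    by (rule weighted_tail_bound[of S0])
       (use assms S0 tail in \<open>auto intro!: continuous_intros continuous_on_subset[OF \<omega>_cont]\<close>)
  finally show ?thesis .
qed

text \<open>A Cauchy-Schwarz estimate in additive form: the integrand is split between
  \<open>r ^ (n - 1) * (\<omega> r)\<^sup>2\<close>, controlled by the tail, and
  \<open>r powr (1 - real n)\<close>, which is integrable at infinity since
  \<open>n \<ge> 3\<close>.\<close>

lemma increment_bound:
  "\<exists>M>0. \<forall>S\<ge>S0. \<forall>B\<ge>S. \<bar>U B - U S\<bar> \<le> M * S powr (- real n / 2 - c + 2)"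
proof -
  define C' where "C' = C * (1 + 2 / (2 * c - 2))"
  have bound: "\<bar>U B - U S\<bar> \<le> (C' / 2 + 1 / (2 * real (n - 2))) * S powr (- real n / 2 - c + 2)" if S: "S0 \<le> S" "S \<le> B" for S B
  proof -
    have Sp: "S > 0" using S S0 by auto
    \<comment> \<open>The splitting parameter that balances both parts:
      \<open>l * S powr (2 - 2 * c)\<close> and \<open>S powr (2 - real n) / l\<close> are the same
      power of \<open>S\<close>.\<close>
    define l where "l = S powr (c - real n / 2)"
    have l: "l > 0" using Sp by (simp add: l_def)
    have cont: "continuous_on {S..B} \<omega>" by (rule continuous_on_subset[OF \<omega>_cont]) (use S S0 in auto)
    have "(\<omega> has_integral U B - U S) {S..B}"
    proof (rule fundamental_theorem_of_calculus[OF S(2)])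
      fix x assume "x \<in> {S..B}"
      then show "(U has_vector_derivative \<omega> x) (at x within {S..B})"
        using has_field_derivative_at_within[OF dU[of x]] S S0
        unfolding has_real_derivative_iff_has_vector_derivative by simp
    qed
    then have "U B - U S = integral {S..B} \<omega>" by (simp add: integral_unique)
    also have "\<bar>\<dots>\<bar> \<le> integral {S..B} (\<lambda>r. l / 2 * (r powr (2 - 2) * (r ^ (n - 1) * (\<omega> r)\<^sup>2)) + 1 / (2 * l) * r powr (1 - real n))"
    proof (subst real_norm_def[symmetric], rule integral_norm_bound_integral)
      show "\<omega> integrable_on {S..B}" by (rule integrable_continuous_real[OF cont])
      show "(\<lambda>r. l / 2 * (r powr (2 - 2) * (r ^ (n - 1) * (\<omega> r)\<^sup>2)) + 1 / (2 * l) * r powr (1 - real n)) integrable_on {S..B}"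
        by (intro integrable_continuous_real continuous_intros cont) (use Sp in auto)
      fix r assume r: "r \<in> {S..B}"
      have rp: "r > 0" using r Sp by auto
      define k where "k = r ^ (n - 1)"
      have k: "k > 0" using rp by (simp add: k_def)
      have kk: "r powr (1 - real n) = 1 / k"
      proof -
        have "1 - real n = - real (n - 1)" using n by (simp add: of_nat_diff)
        then have "r powr (1 - real n) = inverse (r powr real (n - 1))" by (simp only: powr_minus)
        then show ?thesis by (simp only: powr_realpow[OF rp] k_def inverse_eq_divide)
      qed
      have "0 \<le> (l * k * \<bar>\<omega> r\<bar> - 1)\<^sup>2" by simp
      then have "2 * (l * k * \<bar>\<omega> r\<bar>) \<le> (l * k * \<bar>\<omega> r\<bar>)\<^sup>2 + 1" unfolding power2_diff by simp
      then have "2 * (l * k * \<bar>\<omega> r\<bar>) / (2 * l * k) \<le> ((l * k * \<bar>\<omega> r\<bar>)\<^sup>2 + 1) / (2 * l * k)"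
        using l k by (intro divide_right_mono) auto
      also have "2 * (l * k * \<bar>\<omega> r\<bar>) / (2 * l * k) = \<bar>\<omega> r\<bar>" using l k by simp
      also have "((l * k * \<bar>\<omega> r\<bar>)\<^sup>2 + 1) / (2 * l * k) = l / 2 * (k * (\<omega> r)\<^sup>2) + 1 / (2 * l) * (1 / k)"
        using l k by (simp add: power2_eq_square add_divide_distrib)
      finally show "norm (\<omega> r) \<le> l / 2 * (r powr (2 - 2) * (r ^ (n - 1) * (\<omega> r)\<^sup>2)) + 1 / (2 * l) * r powr (1 - real n)"
        using rp by (simp add: kk k_def)
    qed
    also have "\<dots> = l / 2 * integral {S..B} (\<lambda>r. r powr (2 - 2) * (r ^ (n - 1) * (\<omega> r)\<^sup>2)) + 1 / (2 * l) * integral {S..B} (\<lambda>r. r powr (1 - real n))"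
    proof -
      have i1: "(\<lambda>r. r powr (2 - 2) * (r ^ (n - 1) * (\<omega> r)\<^sup>2)) integrable_on {S..B}" and i2: "(\<lambda>r. r powr (1 - real n)) integrable_on {S..B}"
        by (intro integrable_continuous_real continuous_intros cont; use Sp in auto)+
      show ?thesis
        unfolding integral_add[OF integrable_on_mult_right[OF i1] integrable_on_mult_right[OF i2]] integral_mult_right by (rule refl)
    qed
    also have "\<dots> \<le> l / 2 * (C' * S powr (2 - 2 * c)) + 1 / (2 * l) * (S powr (2 - real n) / real (n - 2))"
    proof (intro add_mono mult_left_mono)
      show "integral {S..B} (\<lambda>r. r powr (2 - 2) * (r ^ (n - 1) * (\<omega> r)\<^sup>2)) \<le> C' * S powr (2 - 2 * c)"
        unfolding C'_def by (rule weighted_square_bound) (use c S in auto)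
      show "integral {S..B} (\<lambda>r. r powr (1 - real n)) \<le> S powr (2 - real n) / real (n - 2)"
        using integral_powr_le[OF Sp S(2), of "1 - real n"] n by (simp add: of_nat_diff)
    qed (use l in auto)
    finally have le: "\<bar>U B - U S\<bar> \<le> l / 2 * (C' * S powr (2 - 2 * c)) + 1 / (2 * l) * (S powr (2 - real n) / real (n - 2))"
      by simp
    have "l * S powr (2 - 2 * c) = S powr (- real n / 2 - c + 2)"
      unfolding l_def powr_add[symmetric] by (rule arg_cong[where f="(powr) S"]) (simp add: field_simps)
    then have lS: "l / 2 * (C' * S powr (2 - 2 * c)) = C' / 2 * S powr (- real n / 2 - c + 2)" by simp
    have Sl: "S powr (2 - real n) / l = S powr (- real n / 2 - c + 2)"
      unfolding l_def powr_diff[symmetric] by (rule arg_cong[where f="(powr) S"]) (simp add: field_simps)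
    have "1 / (2 * l) * (S powr (2 - real n) / real (n - 2)) = 1 / (2 * real (n - 2)) * S powr (- real n / 2 - c + 2)"
      unfolding Sl[symmetric] by simp
    with le lS show ?thesis by (simp only: distrib_right)
  qed
  define M where "M = \<bar>C' / 2 + 1 / (2 * real (n - 2))\<bar> + 1"
  show ?thesis
  proof (intro exI[of _ M] conjI allI impI)
    fix S B assume "S0 \<le> S" "S \<le> B"
    show "\<bar>U B - U S\<bar> \<le> M * S powr (- real n / 2 - c + 2)"
    proof (rule order_trans[OF bound mult_right_mono])
      show "C' / 2 + 1 / (2 * real (n - 2)) \<le> M" unfolding M_def by (rule add_increasing2[OF _ abs_ge_self]) simp
    qed (use \<open>S0 \<le> S\<close> \<open>S \<le> B\<close> in auto)
  next
    show "M > 0" unfolding M_def by (rule add_nonneg_pos) auto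
  qed
qed

text \<open>For \<open>p \<ge> 2\<close> the bound \<open>L\<close> reduces the claim to the
  weighted square integral. For \<open>p < 2\<close> the radii are split according to whether the
  derivative exceeds a power \<open>r powr (- \<tau>)\<close>.\<close>

lemma power_integral_bound:
  assumes bd: "\<And>r. r \<ge> 1 \<Longrightarrow> \<bar>\<omega> r\<bar> \<le> L" and p: "p > 0" "n < p * (n / 2 + c - 1)"
  shows "\<exists>D. \<forall>B\<ge>1. integral {1..B} (\<lambda>r. r ^ (n - 1) * \<bar>\<omega> r\<bar> powr p) \<le> D"
proof -
  have cont: "continuous_on {x..y} \<omega>" if "x \<ge> 1" for x y
    by (rule continuous_on_subset[OF \<omega>_cont]) (use that in auto)
  have ci: "continuous_on {x..y} (\<lambda>r. r ^ (n - 1) * \<bar>\<omega> r\<bar> powr p)" if "x \<ge> 1" for x y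
    by (intro continuous_intros continuous_on_powr' cont that) (use p in auto)
  have ii: "(\<lambda>r. r ^ (n - 1) * \<bar>\<omega> r\<bar> powr p) integrable_on {x..y}" if "x \<ge> 1" for x y
    by (rule integrable_continuous_real[OF ci[OF that]])
  have "\<exists>D. \<forall>B\<ge>S0. integral {S0..B} (\<lambda>r. r ^ (n - 1) * \<bar>\<omega> r\<bar> powr p) \<le> D"
  proof (cases "p \<ge> 2")
    case True
    have "integral {S0..B} (\<lambda>r. r ^ (n - 1) * \<bar>\<omega> r\<bar> powr p) \<le> L powr (p - 2) * (C * (1 + 2 / (2 * c - 2)) * S0 powr (2 - 2 * c))"
      if B: "B \<ge> S0" for B
    proof -
      have "integral {S0..B} (\<lambda>r. r ^ (n - 1) * \<bar>\<omega> r\<bar> powr p) \<le>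
         integral {S0..B} (\<lambda>r. L powr (p - 2) * (r powr (2 - 2) * (r ^ (n - 1) * (\<omega> r)\<^sup>2)))"
      proof (rule integral_le)
        show "(\<lambda>r. r ^ (n - 1) * \<bar>\<omega> r\<bar> powr p) integrable_on {S0..B}"
          by (intro integrable_continuous_real ci S0)
        show "(\<lambda>r. L powr (p - 2) * (r powr (2 - 2) * (r ^ (n - 1) * (\<omega> r)\<^sup>2))) integrable_on {S0..B}"
          by (intro integrable_continuous_real continuous_intros cont S0) (use S0 in auto)
        fix r assume r: "r \<in> {S0..B}"
        have "\<bar>\<omega> r\<bar> powr p = \<bar>\<omega> r\<bar> powr (p - 2) * (\<omega> r)\<^sup>2"
          by (cases "\<omega> r = 0") (auto simp: powr_diff powr_numeral)
        also have "\<dots> \<le> L powr (p - 2) * (\<omega> r)\<^sup>2"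
          using bd[of r] r S0 True by (intro mult_right_mono powr_mono2) auto
        finally have "r ^ (n - 1) * \<bar>\<omega> r\<bar> powr p \<le> r ^ (n - 1) * (L powr (p - 2) * (\<omega> r)\<^sup>2)"
          using r S0 by (intro mult_left_mono) auto
        then show "r ^ (n - 1) * \<bar>\<omega> r\<bar> powr p \<le> L powr (p - 2) * (r powr (2 - 2) * (r ^ (n - 1) * (\<omega> r)\<^sup>2))"
          using r S0 by (simp add: mult_ac)
      qed
      also have "\<dots> \<le> L powr (p - 2) * (C * (1 + 2 / (2 * c - 2)) * S0 powr (2 - 2 * c))"
        unfolding integral_mult_right by (intro mult_left_mono weighted_square_bound) (use c B in auto)
      finally show ?thesis .
    qed
    then show ?thesis by blast
  next
    case False
    \<comment> \<open>Small values are integrable if \<open>\<tau> * p > n\<close>; large values are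
      bounded by the square with weight \<open>r powr (\<tau> * (2 - p))\<close>, which needs
      \<open>\<tau> * (2 - p) + 2 < 2 * c\<close>. Such a \<open>\<tau>\<close> exists exactly under
      the assumed condition on \<open>p\<close>.\<close>
    have "n / p < (2 * c - 2) / (2 - p)"
      using p False by (simp add: field_simps)
    then obtain \<tau> where \<tau>: "n / p < \<tau>" "\<tau> < (2 * c - 2) / (2 - p)" using dense by blast
    then have \<tau>n: "\<tau> * p > n" and \<tau>c: "\<tau> * (2 - p) < 2 * c - 2" using p False by (auto simp: field_simps)
    have "0 < n / p" using n p by simp
    then have \<tau>0: "\<tau> > 0" using \<tau> by linarith
    define \<beta> where "\<beta> = \<tau> * (2 - p) + 2"
    have \<beta>: "2 \<le> \<beta>" "\<beta> < 2 * c" using \<tau>c \<tau>0 False by (auto simp: \<beta>_def)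
    have "integral {S0..B} (\<lambda>r. r ^ (n - 1) * \<bar>\<omega> r\<bar> powr p) \<le>
       C * (1 + \<beta> / (2 * c - \<beta>)) * S0 powr (\<beta> - 2 * c) + S0 powr (n - 1 - \<tau> * p + 1) / (- (n - 1 - \<tau> * p + 1))"
      if B: "B \<ge> S0" for B
    proof -
      have i1: "(\<lambda>r. r powr (\<beta> - 2) * (r ^ (n - 1) * (\<omega> r)\<^sup>2)) integrable_on {S0..B}"
        and i2: "(\<lambda>r. r powr (n - 1 - \<tau> * p)) integrable_on {S0..B}"
        by (intro integrable_continuous_real continuous_intros cont S0; use S0 in auto)+
      have "integral {S0..B} (\<lambda>r. r ^ (n - 1) * \<bar>\<omega> r\<bar> powr p) \<le>
         integral {S0..B} (\<lambda>r. r powr (\<beta> - 2) * (r ^ (n - 1) * (\<omega> r)\<^sup>2) + r powr (n - 1 - \<tau> * p))"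
      proof (rule integral_le)
        show "(\<lambda>r. r ^ (n - 1) * \<bar>\<omega> r\<bar> powr p) integrable_on {S0..B}"
          by (intro integrable_continuous_real ci S0)
        show "(\<lambda>r. r powr (\<beta> - 2) * (r ^ (n - 1) * (\<omega> r)\<^sup>2) + r powr (n - 1 - \<tau> * p)) integrable_on {S0..B}"
          by (intro integrable_add i1 i2)
        fix r assume "r \<in> {S0..B}"
        then have rp: "r > 0" using S0 by auto
        have rn: "r ^ (n - 1) = r powr (n - 1)" using powr_realpow[OF rp, of "n - 1"] n by (simp add: of_nat_diff)
        have "\<bar>\<omega> r\<bar> powr p \<le> r powr (\<beta> - 2) * (\<omega> r)\<^sup>2 + r powr (- \<tau> * p)"
        proof (cases "\<bar>\<omega> r\<bar> \<le> r powr (- \<tau>)")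
          case True
          then have "\<bar>\<omega> r\<bar> powr p \<le> (r powr (- \<tau>)) powr p" using p by (intro powr_mono2) auto
          also have "\<dots> = r powr (- \<tau> * p)" by (simp add: powr_powr)
          finally show ?thesis by (simp add: add_increasing)
        next
          case False
          have pos: "\<bar>\<omega> r\<bar> > 0" using False rp by (smt (verit) powr_gt_zero)
          have "\<bar>\<omega> r\<bar> powr p = \<bar>\<omega> r\<bar> powr (p - 2) * (\<omega> r)\<^sup>2"
            using pos by (auto simp: powr_diff powr_numeral)
          also have "\<bar>\<omega> r\<bar> powr (p - 2) \<le> (r powr (- \<tau>)) powr (p - 2)"
            using False \<open>\<not> p \<ge> 2\<close> rp by (intro powr_mono2') auto
          also have "(r powr (- \<tau>)) powr (p - 2) = r powr (\<beta> - 2)"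
            by (simp add: powr_powr \<beta>_def algebra_simps)
          finally show ?thesis by (simp add: add_increasing2 mult_right_mono)
        qed
        then have "r ^ (n - 1) * \<bar>\<omega> r\<bar> powr p \<le> r ^ (n - 1) * (r powr (\<beta> - 2) * (\<omega> r)\<^sup>2 + r powr (- \<tau> * p))"
          using rp by (intro mult_left_mono) auto
        also have "r ^ (n - 1) * r powr (- \<tau> * p) = r powr (n - 1 - \<tau> * p)"
          unfolding rn using n by (simp add: of_nat_diff flip: powr_add)
        then have "r ^ (n - 1) * (r powr (\<beta> - 2) * (\<omega> r)\<^sup>2 + r powr (- \<tau> * p)) =
           r powr (\<beta> - 2) * (r ^ (n - 1) * (\<omega> r)\<^sup>2) + r powr (n - 1 - \<tau> * p)"
          by (simp add: distrib_left mult_ac)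
        finally show "r ^ (n - 1) * \<bar>\<omega> r\<bar> powr p \<le> r powr (\<beta> - 2) * (r ^ (n - 1) * (\<omega> r)\<^sup>2) + r powr (n - 1 - \<tau> * p)" .
      qed
      also have "\<dots> \<le> C * (1 + \<beta> / (2 * c - \<beta>)) * S0 powr (\<beta> - 2 * c) + S0 powr (n - 1 - \<tau> * p + 1) / (- (n - 1 - \<tau> * p + 1))"
        unfolding integral_add[OF i1 i2]
        by (intro add_mono weighted_square_bound integral_powr_le) (use \<beta> B S0 \<tau>n n in \<open>auto simp: of_nat_diff\<close>)
      finally show ?thesis .
    qed
    then show ?thesis by blast
  qed
  then obtain D where D: "\<And>B. B \<ge> S0 \<Longrightarrow> integral {S0..B} (\<lambda>r. r ^ (n - 1) * \<bar>\<omega> r\<bar> powr p) \<le> D" by blast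
  have "integral {1..B} (\<lambda>r. r ^ (n - 1) * \<bar>\<omega> r\<bar> powr p) \<le> integral {1..S0} (\<lambda>r. r ^ (n - 1) * \<bar>\<omega> r\<bar> powr p) + D" if "B \<ge> 1" for B
  proof -
    have "integral {1..B} (\<lambda>r. r ^ (n - 1) * \<bar>\<omega> r\<bar> powr p) \<le> integral {1..max B S0} (\<lambda>r. r ^ (n - 1) * \<bar>\<omega> r\<bar> powr p)"
      by (rule integral_subset_le) (auto intro!: ii[simplified])
    also have "\<dots> = integral {1..S0} (\<lambda>r. r ^ (n - 1) * \<bar>\<omega> r\<bar> powr p) + integral {S0..max B S0} (\<lambda>r. r ^ (n - 1) * \<bar>\<omega> r\<bar> powr p)"
      by (rule Henstock_Kurzweil_Integration.integral_combine[symmetric]) (use S0 in \<open>auto intro!: ii[simplified]\<close>)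
    finally show ?thesis using D[of "max B S0"] by simp
  qed
  then show ?thesis by blast
qed

end

section \<open>Slow case: lower bounds on dyadic shells for a profile with positive
  derivative\<close>

locale slow_profile =
  fixes U \<omega> :: "real \<Rightarrow> real" and n :: nat and c C S0 :: real
  assumes n: "n \<ge> 1" and S0: "S0 \<ge> 1"
    and dU: "\<And>r. r \<ge> S0 \<Longrightarrow> (U has_real_derivative \<omega> r) (at r)"
    and \<omega>_cont: "continuous_on {S0..} \<omega>" and \<omega>_pos: "\<And>r. r \<ge> S0 \<Longrightarrow> \<omega> r > 0"
    and tail: "\<And>S B. S0 \<le> S \<Longrightarrow> S \<le> B \<Longrightarrow>
      integral {S..B} (\<lambda>r. 1 / (r ^ (n - 1) * (\<omega> r)\<^sup>2)) \<le> C * S powr (-2 * c)"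
begin

lemma \<omega>_cont_Icc: "S0 \<le> x \<Longrightarrow> continuous_on {x..y} \<omega>"
  by (rule continuous_on_subset[OF \<omega>_cont]) auto

lemma \<omega>_nonzero: "S0 \<le> r \<Longrightarrow> \<omega> r \<noteq> 0"
  using \<omega>_pos[of r] by simp

lemma increment_eq: "S0 \<le> S \<Longrightarrow> S \<le> B \<Longrightarrow> U B - U S = integral {S..B} \<omega>"
proof -
  assume S: "S0 \<le> S" "S \<le> B"
  have "(\<omega> has_integral U B - U S) {S..B}"
  proof (rule fundamental_theorem_of_calculus[OF S(2)])
    fix x assume "x \<in> {S..B}"
    then show "(U has_vector_derivative \<omega> x) (at x within {S..B})"
      using has_field_derivative_at_within[OF dU[of x]] S
      unfolding has_real_derivative_iff_has_vector_derivative by simp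
  qed
  then show ?thesis by (simp add: integral_unique)
qed

text \<open>An upper bound for the integral of the inverse square of a positive function is a lower
  bound for its own integral, by a Hoelder inequality used in linearized form.\<close>

lemma doubling_increment_bound:
  "\<exists>M>0. \<forall>r\<ge>S0. U (2 * r) - U r \<ge> M * r powr (- real n / 2 + c + 2)"
proof -
  define C' where "C' = 2 ^ (n - 1) * max C 1"
  have C': "C' > 0" by (simp add: C'_def)
  have main: "U (2 * r) - U r \<ge> 1 / sqrt C' * r powr (- real n / 2 + c + 2)" if r: "r \<ge> S0" for r
  proof -
    have rp: "r > 0" using r S0 by auto
    define Y where "Y = C' * r powr (n - 1 - 2 * c)"
    have Y: "Y > 0" using C' rp by (simp add: Y_def)
    \<comment> \<open>\<open>Y\<close> bounds the integral of
      \<open>1 / (\<omega> s)\<^sup>2\<close> over \<open>{r..2*r}\<close>. With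
      \<open>x\<^sup>2 * Y = r\<close> the cubic term contributes \<open>x * r\<close>, so that of
      \<open>3 * x * r\<close> the amount \<open>2 * x * r\<close> is left for twice the
      increment.\<close>
    define x where "x = sqrt (r / Y)"
    have x: "x > 0" "x\<^sup>2 = r / Y" using rp Y by (auto simp: x_def)
    have \<omega>0: "\<omega> s > 0" "s > 0" if "s \<in> {r..2*r}" for s using \<omega>_pos[of s] that r rp by auto
    have i1: "(\<lambda>s. 1 / (s ^ (n - 1) * (\<omega> s)\<^sup>2)) integrable_on {r..2*r}"
      by (intro integrable_continuous_real continuous_intros \<omega>_cont_Icc r) (use r rp \<omega>_nonzero in auto)
    have i2: "\<omega> integrable_on {r..2*r}"
      by (intro integrable_continuous_real \<omega>_cont_Icc r)
    have "integral {r..2*r} (\<lambda>s. 3 * x) \<le>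
        integral {r..2*r} (\<lambda>s. x ^ 3 * (2 * r) ^ (n - 1) * (1 / (s ^ (n - 1) * (\<omega> s)\<^sup>2)) + 2 * \<omega> s)"
    proof (rule integral_le)
      show "(\<lambda>s. x ^ 3 * (2 * r) ^ (n - 1) * (1 / (s ^ (n - 1) * (\<omega> s)\<^sup>2)) + 2 * \<omega> s) integrable_on {r..2*r}"
        by (intro integrable_add integrable_on_mult_right i1 i2)
      fix s assume s: "s \<in> {r..2*r}"
      define y where "y = \<omega> s"
      have y: "y > 0" using \<omega>0[OF s] by (simp add: y_def)
      \<comment> \<open>The product expands to \<open>x ^ 3 - 3 * x * y\<^sup>2 + 2 * y ^ 3\<close>:
        the mean inequality for \<open>x ^ 3 / y\<^sup>2\<close>, \<open>y\<close> and
        \<open>y\<close>.\<close>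
      have "0 \<le> (x - y)\<^sup>2 * (x + 2 * y)" using x y by simp
      then have "3 * x * y\<^sup>2 \<le> x ^ 3 + 2 * y ^ 3" by (simp add: power2_eq_square power3_eq_cube algebra_simps)
      then have "3 * x * y\<^sup>2 / y\<^sup>2 \<le> (x ^ 3 + 2 * y ^ 3) / y\<^sup>2" by (intro divide_right_mono) auto
      then have a: "3 * x \<le> x ^ 3 / y\<^sup>2 + 2 * y" using y by (simp add: add_divide_distrib power3_eq_cube power2_eq_square)
      have "1 \<le> (2 * r) ^ (n - 1) / s ^ (n - 1)"
      proof -
        have "s ^ (n - 1) \<le> (2 * r) ^ (n - 1)" using s \<omega>0[OF s] by (intro power_mono) auto
        then show ?thesis using \<omega>0[OF s] by (simp add: le_divide_eq del: power_mult_distrib)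
      qed
      then have "x ^ 3 / y\<^sup>2 * 1 \<le> x ^ 3 / y\<^sup>2 * ((2 * r) ^ (n - 1) / s ^ (n - 1))"
        using x y by (intro mult_left_mono) auto
      with a show "3 * x \<le> x ^ 3 * (2 * r) ^ (n - 1) * (1 / (s ^ (n - 1) * (\<omega> s)\<^sup>2)) + 2 * \<omega> s"
        by (simp add: y_def mult.commute)
    qed auto
    also have "\<dots> = x ^ 3 * (2 * r) ^ (n - 1) * integral {r..2*r} (\<lambda>s. 1 / (s ^ (n - 1) * (\<omega> s)\<^sup>2)) + 2 * integral {r..2*r} \<omega>"
      unfolding integral_add[OF integrable_on_mult_right[OF i1] integrable_on_mult_right[OF i2]] integral_mult_right by (rule refl)
    also have "integral {r..2*r} \<omega> = U (2 * r) - U r" using increment_eq[of r "2 * r"] r rp by simp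
    also have "integral {r..2*r} (\<lambda>s. 1 / (s ^ (n - 1) * (\<omega> s)\<^sup>2)) \<le> max C 1 * r powr (-2 * c)"
      using order_trans[OF tail[of r "2 * r"] mult_right_mono[of C "max C 1"]] r rp by simp
    also have "integral {r..2*r} (\<lambda>s. 3 * x) = 3 * x * r" using rp by simp
    finally have "3 * x * r \<le> x ^ 3 * (2 * r) ^ (n - 1) * (max C 1 * r powr (-2 * c)) + 2 * (U (2 * r) - U r)"
      using x rp by simp
    also have "x ^ 3 * (2 * r) ^ (n - 1) * (max C 1 * r powr (-2 * c)) = x * r"
    proof -
      have "r ^ (n - 1) * r powr (- 2 * c) = r powr (real (n - 1) + (- 2 * c))"
        unfolding powr_add powr_realpow[OF rp] by (rule refl)
      also have "real (n - 1) + (- 2 * c) = n - 1 - 2 * c" using n by (simp add: of_nat_diff)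
      finally have e1: "r ^ (n - 1) * r powr (- 2 * c) = r powr (n - 1 - 2 * c)" .
      have "(2 * r) ^ (n - 1) * (max C 1 * r powr (-2 * c)) = Y"
        unfolding Y_def C'_def power_mult_distrib e1[symmetric] by (simp only: mult_ac)
      then have "x ^ 3 * (2 * r) ^ (n - 1) * (max C 1 * r powr (-2 * c)) = x * (x\<^sup>2 * Y)"
        by (simp only: mult.assoc power3_eq_cube power2_eq_square)
      also have "x\<^sup>2 * Y = r" using x Y by simp
      finally show ?thesis .
    qed
    finally have "x * r \<le> U (2 * r) - U r" by (simp add: mult.commute)
    also have "x * r = 1 / sqrt C' * r powr (- real n / 2 + c + 2)"
    proof -
      have "r / Y = 1 / C' * r powr (1 - (n - 1 - 2 * c))"
        unfolding Y_def powr_diff[of r 1] using rp by simp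
      also have "r powr (1 - (n - 1 - 2 * c)) = (r powr (- real n / 2 + c + 1))\<^sup>2"
        unfolding power2_eq_square powr_add[symmetric]
          by (rule arg_cong[where f="(powr) r"]) (use n in \<open>simp add: field_simps of_nat_diff\<close>)
      finally have "x = 1 / sqrt C' * r powr (- real n / 2 + c + 1)"
        unfolding x_def by (simp add: real_sqrt_mult real_sqrt_divide)
      moreover have "r powr (- real n / 2 + c + 1) * r = r powr (- real n / 2 + c + 2)"
      proof -
        have "r powr (- real n / 2 + c + 2) = r powr ((- real n / 2 + c + 1) + 1)" by (simp add: algebra_simps)
        also have "\<dots> = r powr (- real n / 2 + c + 1) * r" unfolding powr_add using rp by simp
        finally show ?thesis by simp
      qed
      ultimately show ?thesis by simp
    qed
    finally show ?thesis .
  qed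
  show ?thesis
    by (rule exI[of _ "1 / sqrt C'"]) (use main C' in auto)
qed

text \<open>Every shell \<open>{r..2*r}\<close> contributes at least a fixed
  \<open>\<delta>\<close>. This remains true at the critical exponent, where the power of
  \<open>r\<close> is 0 and the divergence is logarithmic.\<close>

lemma power_integral_unbounded:
  assumes p: "p \<ge> 1" "p * (n / 2 - c - 1) \<le> n"
  shows "\<exists>B\<ge>S0. integral {S0..B} (\<lambda>r. r ^ (n - 1) * \<omega> r powr p) > D"
proof -
  obtain M where M: "M > 0" "\<And>r. r \<ge> S0 \<Longrightarrow> U (2 * r) - U r \<ge> M * r powr (- real n / 2 + c + 2)"
    using doubling_increment_bound by blast
  have cont: "continuous_on {x..y} (\<lambda>r. r ^ (n - 1) * \<omega> r powr p)" "continuous_on {x..y} (\<lambda>r. \<omega> r powr p)"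
    if "x \<ge> S0" for x y
    by (intro continuous_intros \<omega>_cont_Icc that; use that \<omega>_nonzero in auto)+
  define \<delta> where "\<delta> = (M / 2) powr p"
  have \<delta>: "\<delta> > 0" using M by (simp add: \<delta>_def)
  have shell: "\<delta> \<le> integral {r..2*r} (\<lambda>r. r ^ (n - 1) * \<omega> r powr p)" if r: "r \<ge> S0" for r
  proof -
    have rp: "r \<ge> 1" "r > 0" using r S0 by auto
    \<comment> \<open>Half of the lower bound for the mean of \<open>\<omega>\<close> over
      \<open>{r..2*r}\<close>. Values below \<open>A\<close> account for at most half of the
      increment, so values above \<open>A\<close> carry the rest, and there
      \<open>\<omega> s\<close> is at most
      \<open>A powr (1 - p) * \<omega> s powr p\<close>.\<close>
    define A where "A = M / 2 * r powr (- real n / 2 + c + 1)"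
    have A: "A > 0" using M rp by (simp add: A_def)
    have Ar: "2 * A * r = M * r powr (- real n / 2 + c + 2)"
    proof -
      have "r powr (- real n / 2 + c + 2) = r powr ((- real n / 2 + c + 1) + 1)" by (simp add: algebra_simps)
      also have "\<dots> = r powr (- real n / 2 + c + 1) * r" unfolding powr_add using rp by simp
      finally show ?thesis by (simp add: A_def)
    qed
    have i1: "(\<lambda>s. \<omega> s powr p) integrable_on {r..2*r}" by (intro integrable_continuous_real cont r)
    have "2 * A * r \<le> integral {r..2*r} \<omega>"
      using M(2)[OF r] increment_eq[of r "2 * r"] r rp unfolding Ar by simp
    also have "\<dots> \<le> integral {r..2*r} (\<lambda>s. A + A powr (1 - p) * \<omega> s powr p)"
    proof (rule integral_le)
      show "\<omega> integrable_on {r..2*r}" by (intro integrable_continuous_real \<omega>_cont_Icc r)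
      show "(\<lambda>s. A + A powr (1 - p) * \<omega> s powr p) integrable_on {r..2*r}"
        by (intro integrable_add integrable_on_mult_right i1) auto
      fix s assume "s \<in> {r..2*r}"
      then have \<omega>s: "\<omega> s > 0" using \<omega>_pos[of s] r by auto
      show "\<omega> s \<le> A + A powr (1 - p) * \<omega> s powr p"
      proof (cases "\<omega> s \<le> A")
        case True
        have "0 \<le> A powr (1 - p) * \<omega> s powr p" by simp
        then show ?thesis using True by linarith
      next
        case False
        have "\<omega> s = \<omega> s powr ((1 - p) + p)" using \<omega>s by simp
        also have "\<dots> = \<omega> s powr (1 - p) * \<omega> s powr p" by (rule powr_add)
        also have "\<dots> \<le> A powr (1 - p) * \<omega> s powr p"
          using False A p by (intro mult_right_mono powr_mono2') auto
        finally show ?thesis using A by linarith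
      qed
    qed
    also have "\<dots> = A * r + A powr (1 - p) * integral {r..2*r} (\<lambda>s. \<omega> s powr p)"
      using rp by (subst integral_add[OF _ integrable_on_mult_right[OF i1]]) (auto simp: integral_mult_right)
    finally have "A * r \<le> A powr (1 - p) * integral {r..2*r} (\<lambda>s. \<omega> s powr p)" by simp
    then have "A powr (p - 1) * (A * r) \<le> A powr (p - 1) * (A powr (1 - p) * integral {r..2*r} (\<lambda>s. \<omega> s powr p))"
      by (intro mult_left_mono) auto
    moreover have A1: "A powr (p - 1) * A powr (1 - p) = 1" unfolding powr_add[symmetric] using A by simp
    moreover have A2: "A powr (p - 1) * A = A powr p" using A by (simp add: powr_diff)
    ultimately have "A powr p * r \<le> integral {r..2*r} (\<lambda>s. \<omega> s powr p)"
      unfolding mult.assoc[symmetric] A1 A2 by simp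
    then have "r ^ (n - 1) * (A powr p * r) \<le> r ^ (n - 1) * integral {r..2*r} (\<lambda>s. \<omega> s powr p)"
      using rp by (intro mult_left_mono) auto
    also have "\<dots> = integral {r..2*r} (\<lambda>s. r ^ (n - 1) * \<omega> s powr p)" by (simp only: integral_mult_right)
    also have "\<dots> \<le> integral {r..2*r} (\<lambda>s. s ^ (n - 1) * \<omega> s powr p)"
    proof (rule integral_le)
      show "(\<lambda>s. r ^ (n - 1) * \<omega> s powr p) integrable_on {r..2*r}" by (intro integrable_on_mult_right i1)
      show "(\<lambda>s. s ^ (n - 1) * \<omega> s powr p) integrable_on {r..2*r}" by (intro integrable_continuous_real cont r)
    qed (use rp in \<open>auto intro!: mult_right_mono power_mono\<close>)
    finally have 1: "r ^ (n - 1) * (A powr p * r) \<le> integral {r..2*r} (\<lambda>s. s ^ (n - 1) * \<omega> s powr p)" .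
    have "A powr p = \<delta> * r powr ((- real n / 2 + c + 1) * p)"
      unfolding A_def \<delta>_def using M rp by (subst powr_mult) (simp_all only: powr_powr)
    moreover have "r ^ (n - 1) * r = r powr n" using rp n by (simp add: powr_realpow power_eq_if)
    ultimately have "r ^ (n - 1) * (A powr p * r) = \<delta> * (r powr n * r powr ((- real n / 2 + c + 1) * p))"
      by (simp add: mult_ac)
    also have "r powr n * r powr ((- real n / 2 + c + 1) * p) = r powr (n - p * (n / 2 - c - 1))"
      unfolding powr_add[symmetric] by (rule arg_cong[where f="(powr) r"]) (simp add: algebra_simps)
    also have "\<delta> * \<dots> \<ge> \<delta> * 1"
      using \<delta> rp p by (intro mult_left_mono) (auto simp: ge_one_powr_ge_zero)
    finally show ?thesis using 1 by linarith
  qed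
  have sum: "real k * \<delta> \<le> integral {S0..2 ^ k * S0} (\<lambda>r. r ^ (n - 1) * \<omega> r powr p)" for k
  proof (induction k)
    case 0
    then show ?case by simp
  next
    case (Suc k)
    have k: "S0 \<le> 2 ^ k * S0" using S0 by simp
    have "integral {S0..2 ^ k * S0} (\<lambda>r. r ^ (n - 1) * \<omega> r powr p) + integral {2 ^ k * S0..2 * (2 ^ k * S0)} (\<lambda>r. r ^ (n - 1) * \<omega> r powr p)
      = integral {S0..2 * (2 ^ k * S0)} (\<lambda>r. r ^ (n - 1) * \<omega> r powr p)"
    proof (rule Henstock_Kurzweil_Integration.integral_combine[OF k])
      show "2 ^ k * S0 \<le> 2 * (2 ^ k * S0)" using k S0 by linarith
    qed (intro integrable_continuous_real cont order_refl)
    then show ?case using Suc shell[OF k] by (simp add: algebra_simps)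
  qed
  obtain k :: nat where "D / \<delta> < k" using reals_Archimedean2 by blast
  then have "D < real k * \<delta>" using \<delta> by (simp add: field_simps)
  then show ?thesis using sum[of k] S0 by (intro exI[of _ "2 ^ k * S0"]) auto
qed

end

section \<open>From stability to the Hardy inequality\<close>

text \<open>Composing with this smooth truncation, which vanishes on \<open>{-\<epsilon>..\<epsilon>}\<close>, turns a \<open>C\<^sup>1\<close> function that
  vanishes at the end points of an interval into one whose extension by 0 is \<open>C\<^sup>1\<close>.\<close>

definition trunc :: "real \<Rightarrow> real \<Rightarrow> real" where
  "trunc \<epsilon> s = sqrt ((max 0 (s - \<epsilon>))\<^sup>2 + \<epsilon>\<^sup>2) - sqrt ((max 0 (- s - \<epsilon>))\<^sup>2 + \<epsilon>\<^sup>2)"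

definition trunc' :: "real \<Rightarrow> real \<Rightarrow> real" where
  "trunc' \<epsilon> s = max 0 (s - \<epsilon>) / sqrt ((max 0 (s - \<epsilon>))\<^sup>2 + \<epsilon>\<^sup>2) +
     max 0 (- s - \<epsilon>) / sqrt ((max 0 (- s - \<epsilon>))\<^sup>2 + \<epsilon>\<^sup>2)"

text \<open>Squaring removes the kink at 0, where the difference quotient is bounded by the
  increment itself. This is why \<open>trunc\<close> is built from squares under a root.\<close>

lemma has_real_derivative_max_0_square:
  "((\<lambda>x::real. (max 0 x)\<^sup>2) has_real_derivative 2 * max 0 x) (at x)"
proof -
  consider "x < 0" | "x > 0" | "x = 0" by linarith
  then show ?thesis
  proof cases
    case 1
    have "((\<lambda>x::real. (max 0 x)\<^sup>2) has_real_derivative 0) (at x)"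
      by (rule has_field_derivative_transform_within_open[of "\<lambda>_. 0" _ _ "{..<0}"]) (use 1 in auto)
    then show ?thesis using 1 by simp
  next
    case 2
    have "((\<lambda>x::real. (max 0 x)\<^sup>2) has_real_derivative 2 * x) (at x)"
      by (rule has_field_derivative_transform_within_open[of "\<lambda>x. x\<^sup>2" _ _ "{0<..}"])
         (use 2 in \<open>auto intro!: derivative_eq_intros\<close>)
    then show ?thesis using 2 by simp
  next
    case 3
    have "((\<lambda>h. (max 0 (0 + h))\<^sup>2 / h) \<longlongrightarrow> 0) (at (0::real))"
    proof (rule Lim_null_comparison)
      show "\<forall>\<^sub>F h in at (0::real). norm ((max 0 (0 + h))\<^sup>2 / h) \<le> \<bar>h\<bar>"
        by (intro always_eventually allI) (auto simp: max_def power2_eq_square)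
      show "((\<lambda>h::real. \<bar>h\<bar>) \<longlongrightarrow> 0) (at 0)" by (intro tendsto_eq_intros) auto
    qed
    then show ?thesis using 3 by (simp add: DERIV_def)
  qed
qed

lemma has_real_derivative_trunc:
  assumes "\<epsilon> > 0"
  shows "(trunc \<epsilon> has_real_derivative trunc' \<epsilon> s) (at s)"
proof -
  have pos: "(max 0 x)\<^sup>2 + \<epsilon>\<^sup>2 > 0" for x using assms by (simp add: add_nonneg_pos)
  have d: "((\<lambda>s. sqrt ((max 0 (h s))\<^sup>2 + \<epsilon>\<^sup>2)) has_real_derivative
      max 0 (h s) / sqrt ((max 0 (h s))\<^sup>2 + \<epsilon>\<^sup>2) * h') (at s)"
    if "(h has_real_derivative h') (at s)" for h h'
  proof -
    have "((\<lambda>s. (max 0 (h s))\<^sup>2 + \<epsilon>\<^sup>2) has_real_derivative 2 * max 0 (h s) * h' + 0) (at s)"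
      by (rule DERIV_add[OF DERIV_chain2[OF has_real_derivative_max_0_square that] DERIV_const])
    from DERIV_chain2[OF DERIV_real_sqrt[OF pos] this] show ?thesis
      by (rule DERIV_cong) (simp add: field_simps)
  qed
  show ?thesis
    unfolding trunc_def trunc'_def
    by (rule DERIV_cong[OF DERIV_diff[OF d[of "\<lambda>s. s - \<epsilon>" 1] d[of "\<lambda>s. - s - \<epsilon>" "- 1"]]])
       (auto intro!: derivative_eq_intros)
qed

lemma continuous_on_trunc': "\<epsilon> > 0 \<Longrightarrow> continuous_on A (trunc' \<epsilon>)"
  unfolding trunc'_def by (intro continuous_intros) (auto simp: add_nonneg_eq_0_iff)

lemma continuous_on_trunc: "continuous_on A (trunc \<epsilon>)"
  unfolding trunc_def by (intro continuous_intros)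

lemma trunc_eq_0:
  assumes "\<bar>s\<bar> \<le> \<epsilon>"
  shows "trunc \<epsilon> s = 0" "trunc' \<epsilon> s = 0"
proof -
  have "max 0 (s - \<epsilon>) = 0" "max 0 (- s - \<epsilon>) = 0" using assms by auto
  then show "trunc \<epsilon> s = 0" "trunc' \<epsilon> s = 0" unfolding trunc_def trunc'_def by simp_all
qed

lemma trunc'_bound:
  assumes "\<epsilon> > 0" shows "\<bar>trunc' \<epsilon> s\<bar> \<le> 1"
proof -
  have a: "0 \<le> x / sqrt (x\<^sup>2 + \<epsilon>\<^sup>2)" "x / sqrt (x\<^sup>2 + \<epsilon>\<^sup>2) \<le> 1" if "x \<ge> 0" for x
  proof -
    have "x \<le> sqrt (x\<^sup>2 + \<epsilon>\<^sup>2)" by (rule real_le_rsqrt) simp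
    moreover have "sqrt (x\<^sup>2 + \<epsilon>\<^sup>2) > 0" using assms by (simp add: add_nonneg_pos)
    ultimately show "0 \<le> x / sqrt (x\<^sup>2 + \<epsilon>\<^sup>2)" "x / sqrt (x\<^sup>2 + \<epsilon>\<^sup>2) \<le> 1" using that by auto
  qed
  show ?thesis
  proof (cases "s \<ge> 0")
    case True
    then have "max 0 (- s - \<epsilon>) = 0" using assms by simp
    then show ?thesis using a[of "max 0 (s - \<epsilon>)"] by (simp add: trunc'_def)
  next
    case False
    then have "max 0 (s - \<epsilon>) = 0" using assms by simp
    then show ?thesis using a[of "max 0 (- s - \<epsilon>)"] by (simp add: trunc'_def)
  qed
qed

text \<open>Together with \<open>trunc'_bound\<close> this controls the passage to the limit:
  truncating does not increase the gradient term, and it changes the zeroth-order term by a multiple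
  of \<open>\<epsilon>\<close>.\<close>

lemma trunc_bounds:
  assumes "\<epsilon> > 0" shows "\<bar>trunc \<epsilon> s\<bar> \<le> \<bar>s\<bar>" "\<bar>trunc \<epsilon> s - s\<bar> \<le> 2 * \<epsilon>"
proof -
  have a: "\<epsilon> \<le> sqrt (x\<^sup>2 + \<epsilon>\<^sup>2)" "x \<le> sqrt (x\<^sup>2 + \<epsilon>\<^sup>2)" "sqrt (x\<^sup>2 + \<epsilon>\<^sup>2) \<le> x + \<epsilon>" if "x \<ge> 0" for x
    using assms that by (auto intro!: real_le_rsqrt real_le_lsqrt simp: power2_sum)
  have "\<bar>trunc \<epsilon> s\<bar> \<le> \<bar>s\<bar> \<and> \<bar>trunc \<epsilon> s - s\<bar> \<le> 2 * \<epsilon>"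
  proof (cases "\<bar>s\<bar> \<le> \<epsilon>")
    case True
    then show ?thesis using trunc_eq_0[OF True] assms by simp
  next
    case False
    show ?thesis
    proof (cases "s \<ge> 0")
      case True
      then have "trunc \<epsilon> s = sqrt ((s - \<epsilon>)\<^sup>2 + \<epsilon>\<^sup>2) - \<epsilon>" using assms False by (simp add: trunc_def)
      with a[of "s - \<epsilon>"] False True assms show ?thesis by linarith
    next
      case neg: False
      then have "trunc \<epsilon> s = \<epsilon> - sqrt ((- s - \<epsilon>)\<^sup>2 + \<epsilon>\<^sup>2)" using assms False by (simp add: trunc_def)
      with a[of "- s - \<epsilon>"] False neg assms show ?thesis by linarith
    qed
  qed
  then show "\<bar>trunc \<epsilon> s\<bar> \<le> \<bar>s\<bar>" "\<bar>trunc \<epsilon> s - s\<bar> \<le> 2 * \<epsilon>" by auto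
qed

text \<open>The clamping \<open>k\<close> extends the function constantly beyond the interval, with
  a possible corner at \<open>a\<close> and \<open>b\<close>. Near these points its absolute value
  is below \<open>\<epsilon>\<close>, so the truncation is locally 0 and the corner
  disappears.\<close>

lemma trunc_extension:
  assumes v: "C1_on a b v v'" and "a < b" "v a = 0" "v b = 0" "\<epsilon> > 0"
  defines "k \<equiv> \<lambda>r. max a (min b r)"
  shows "((\<lambda>r. trunc \<epsilon> (v (k r))) has_real_derivative trunc' \<epsilon> (v (k r)) * v' (k r)) (at r)"
    and "continuous_on UNIV (\<lambda>r. trunc' \<epsilon> (v (k r)) * v' (k r))"
proof -
  have k: "k r \<in> {a..b}" for r using \<open>a < b\<close> by (auto simp: k_def)
  have k_cont: "continuous_on A k" for A unfolding k_def by (intro continuous_intros)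
  have vk: "continuous_on UNIV (\<lambda>r. v (k r))"
    by (rule continuous_on_compose2[OF C1_on_continuous[OF v] k_cont]) (use k in auto)
  show "continuous_on UNIV (\<lambda>r. trunc' \<epsilon> (v (k r)) * v' (k r))"
  proof (intro continuous_on_mult)
    show "continuous_on UNIV (\<lambda>r. trunc' \<epsilon> (v (k r)))"
      by (rule continuous_on_compose2[OF continuous_on_trunc'[OF \<open>\<epsilon> > 0\<close>] vk]) auto
    show "continuous_on UNIV (\<lambda>r. v' (k r))"
      by (rule continuous_on_compose2[of "{a..b}" v' UNIV k]) (use v k k_cont in \<open>auto simp: C1_on_def\<close>)
  qed
  show "((\<lambda>r. trunc \<epsilon> (v (k r))) has_real_derivative trunc' \<epsilon> (v (k r)) * v' (k r)) (at r)"
  proof (cases "\<bar>v (k r)\<bar> < \<epsilon>")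
    case True
    have "open {r. \<bar>v (k r)\<bar> < \<epsilon>}"
      by (intro open_Collect_less continuous_intros vk)
    then have "((\<lambda>r. trunc \<epsilon> (v (k r))) has_real_derivative 0) (at r)"
      by (rule has_field_derivative_transform_within_open[of "\<lambda>_. 0", OF DERIV_const]) (use True in \<open>auto simp: trunc_eq_0\<close>)
    then show ?thesis using True by (simp add: trunc_eq_0)
  next
    case False
    have r: "a < r" "r < b"
    proof -
      have "k r \<noteq> a" "k r \<noteq> b" using False assms by auto
      then show "a < r" "r < b" by (auto simp: k_def max_def min_def split: if_splits)
    qed
    then have kr: "k r = r" by (simp add: k_def)
    have atr: "at r within {a..b} = at r" by (rule at_within_interior) (use r in auto)
    have "(v has_real_derivative v' r) (at r within {a..b})" using v r by (simp add: C1_on_def)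
    then have dv: "(v has_real_derivative v' r) (at r)" unfolding atr .
    have "((\<lambda>r. trunc \<epsilon> (v r)) has_real_derivative trunc' \<epsilon> (v r) * v' r) (at r)"
      by (rule DERIV_chain2[OF has_real_derivative_trunc[OF \<open>\<epsilon> > 0\<close>] dv])
    then have "((\<lambda>r. trunc \<epsilon> (v (k r))) has_real_derivative trunc' \<epsilon> (v r) * v' r) (at r)"
      by (rule has_field_derivative_transform_within_open[of _ _ _ "{a<..<b}"]) (use r in \<open>auto simp: k_def\<close>)
    then show ?thesis by (simp add: kr)
  qed
qed

section \<open>The radial equation: Hardy inequality, zeros and boundedness of the
  derivative\<close>

locale radial_profile =
  fixes g U \<omega> \<omega>' :: "real \<Rightarrow> real" and n :: nat and R :: real
  assumes n: "n \<ge> 3" and R: "R > 0"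
    and dg: "\<And>x. (g has_real_derivative deriv g x) (at x)" and g'_cont: "continuous_on UNIV (deriv g)"
    and dU: "\<And>r. r > 0 \<Longrightarrow> (U has_real_derivative \<omega> r) (at r)"
    and d\<omega>: "\<And>r. r > 0 \<Longrightarrow> (\<omega> has_real_derivative \<omega>' r) (at r)"
    and ode: "\<And>r. r > 0 \<Longrightarrow> \<omega>' r = - g (U r) - (real n - 1) / r * \<omega> r"
    and U_bounded: "bounded (range U)"
    and stable: "\<And>a b V V'. R < a \<Longrightarrow> a < b \<Longrightarrow> (\<And>r. (V has_real_derivative V' r) (at r)) \<Longrightarrow>
      continuous_on UNIV V' \<Longrightarrow> (\<And>r. r \<notin> {a..b} \<Longrightarrow> V r = 0) \<Longrightarrow>
      0 \<le> integral {a..b} (\<lambda>r. r ^ (n - 1) * ((V' r)\<^sup>2 - deriv g (U r) * (V r)\<^sup>2))"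
begin

lemma d_power: "x > 0 \<Longrightarrow> ((\<lambda>r. r ^ (n - 1)) has_real_derivative (real n - 1) * x ^ (n - 1) / x) (at x)"
proof -
  assume x: "x > 0"
  define k where "k = n - 2"
  have k: "n = Suc (Suc k)" using n by (simp add: k_def)
  show ?thesis by (rule DERIV_cong[OF DERIV_pow]) (use x in \<open>simp add: k\<close>)
qed

lemma \<omega>_cont: "continuous_on {0<..} \<omega>"
  by (intro continuous_at_imp_continuous_on ballI DERIV_isCont[OF d\<omega>]) auto

lemma U_cont: "continuous_on {0<..} U"
  by (intro continuous_at_imp_continuous_on ballI DERIV_isCont[OF dU]) auto

lemma g_cont: "continuous_on A g"
  by (intro continuous_at_imp_continuous_on ballI DERIV_isCont[OF dg])

lemma gU_cont: "continuous_on {0<..} (\<lambda>r. g (U r))"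
  by (rule continuous_on_compose2[OF g_cont[of UNIV] U_cont]) auto

lemma g'U_cont: "continuous_on {0<..} (\<lambda>r. deriv g (U r))"
  by (rule continuous_on_compose2[OF g'_cont U_cont]) auto

lemma \<omega>'_cont: "continuous_on {0<..} \<omega>'"
proof -
  have "continuous_on {0<..} (\<lambda>r. - g (U r) - (real n - 1) / r * \<omega> r)"
    by (intro continuous_intros gU_cont \<omega>_cont) auto
  then show ?thesis by (rule continuous_on_eq) (simp add: ode)
qed

lemma Icc_cont:
  assumes "0 < a"
  shows "continuous_on {a..b} \<omega>" "continuous_on {a..b} \<omega>'" "continuous_on {a..b} (\<lambda>r. deriv g (U r))"
  by (rule continuous_on_subset[OF \<omega>_cont] continuous_on_subset[OF \<omega>'_cont] continuous_on_subset[OF g'U_cont];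
      use assms in auto)+

text \<open>The assumption \<open>stable\<close> asks for C1 functions on the whole line, whereas
  here the derivative may jump at the end points. The truncations are admissible and lose at most
  \<open>\<epsilon> * E\<close> with \<open>E\<close> independent of \<open>\<epsilon>\<close>, so
  the limit yields the inequality.\<close>

lemma stable_C1_on:
  assumes ab: "R < a" "a < b" and v: "C1_on a b v v'" and v0: "v a = 0" "v b = 0"
  shows "0 \<le> integral {a..b} (\<lambda>r. r ^ (n - 1) * ((v' r)\<^sup>2 - deriv g (U r) * (v r)\<^sup>2))" (is "0 \<le> ?Q")
proof -
  define G where "G = (\<lambda>r. deriv g (U r))"
  have a0: "a > 0" using ab R by simp
  have cG: "continuous_on {a..b} G" unfolding G_def by (rule Icc_cont[OF a0])
  have cv: "continuous_on {a..b} v" "continuous_on {a..b} v'"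
    using v C1_on_continuous by (auto simp: C1_on_def)
  have i1: "(\<lambda>r. r ^ (n - 1) * ((v' r)\<^sup>2 - G r * (v r)\<^sup>2)) integrable_on {a..b}"
    and i2: "(\<lambda>r. r ^ (n - 1) * (\<bar>G r\<bar> * (4 * \<bar>v r\<bar>))) integrable_on {a..b}"
    by (intro integrable_continuous_real continuous_intros cG cv)+
  define E where "E = integral {a..b} (\<lambda>r. r ^ (n - 1) * (\<bar>G r\<bar> * (4 * \<bar>v r\<bar>)))"
  have approx: "0 \<le> ?Q + \<epsilon> * E" if \<epsilon>: "\<epsilon> > 0" for \<epsilon>
  proof -
    define k where "k = (\<lambda>r. max a (min b r))"
    have kr: "k r = r" if "r \<in> {a..b}" for r using that by (auto simp: k_def)
    have ext: "((\<lambda>r. trunc \<epsilon> (v (k r))) has_real_derivative trunc' \<epsilon> (v (k r)) * v' (k r)) (at r)"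
      "continuous_on UNIV (\<lambda>r. trunc' \<epsilon> (v (k r)) * v' (k r))" for r
      unfolding k_def by (rule trunc_extension[OF v ab(2) v0 \<epsilon>])+
    have "0 \<le> integral {a..b} (\<lambda>r. r ^ (n - 1) * ((trunc' \<epsilon> (v (k r)) * v' (k r))\<^sup>2 - deriv g (U r) * (trunc \<epsilon> (v (k r)))\<^sup>2))"
    proof (rule stable[OF ab, where V="\<lambda>r. trunc \<epsilon> (v (k r))" and V'="\<lambda>r. trunc' \<epsilon> (v (k r)) * v' (k r)", OF ext])
      fix r assume "r \<notin> {a..b}"
      then have "k r = a \<or> k r = b" using ab by (auto simp: k_def)
      then show "trunc \<epsilon> (v (k r)) = 0" using v0 \<epsilon> by (auto simp: trunc_eq_0)
    qed
    also have "\<dots> = integral {a..b} (\<lambda>r. r ^ (n - 1) * ((trunc' \<epsilon> (v r) * v' r)\<^sup>2 - G r * (trunc \<epsilon> (v r))\<^sup>2))"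
      by (rule integral_cong) (simp add: kr G_def)
    also have "\<dots> \<le> integral {a..b} (\<lambda>r. r ^ (n - 1) * ((v' r)\<^sup>2 - G r * (v r)\<^sup>2) + \<epsilon> * (r ^ (n - 1) * (\<bar>G r\<bar> * (4 * \<bar>v r\<bar>))))"
    proof (rule integral_le)
      have "continuous_on {a..b} (\<lambda>r. trunc \<epsilon> (v r))" "continuous_on {a..b} (\<lambda>r. trunc' \<epsilon> (v r))"
        by (rule continuous_on_compose2[OF continuous_on_trunc[of UNIV] cv(1)]
            continuous_on_compose2[OF continuous_on_trunc'[OF \<epsilon>, of UNIV] cv(1)]; simp)+
      then show "(\<lambda>r. r ^ (n - 1) * ((trunc' \<epsilon> (v r) * v' r)\<^sup>2 - G r * (trunc \<epsilon> (v r))\<^sup>2)) integrable_on {a..b}"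
        by (intro integrable_continuous_real continuous_intros cG cv)
      show "(\<lambda>r. r ^ (n - 1) * ((v' r)\<^sup>2 - G r * (v r)\<^sup>2) + \<epsilon> * (r ^ (n - 1) * (\<bar>G r\<bar> * (4 * \<bar>v r\<bar>)))) integrable_on {a..b}"
        by (intro integrable_add integrable_on_mult_right i1 i2)
      fix r assume r: "r \<in> {a..b}"
      define t where "t = trunc \<epsilon> (v r)"
      have "(trunc' \<epsilon> (v r) * v' r)\<^sup>2 \<le> (v' r)\<^sup>2"
        using trunc'_bound[OF \<epsilon>, of "v r"]
        by (simp add: power_mult_distrib mult_left_le_one_le abs_square_le_1)
      moreover have "\<bar>G r * (v r)\<^sup>2 - G r * t\<^sup>2\<bar> \<le> \<epsilon> * (\<bar>G r\<bar> * (4 * \<bar>v r\<bar>))"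
      proof -
        have "(v r)\<^sup>2 - t\<^sup>2 = - ((t - v r) * (t + v r))" by (simp add: power2_eq_square algebra_simps)
        then have "\<bar>(v r)\<^sup>2 - t\<^sup>2\<bar> = \<bar>t - v r\<bar> * \<bar>t + v r\<bar>" by (simp only: abs_minus_cancel abs_mult)
        also have "\<dots> \<le> (2 * \<epsilon>) * (2 * \<bar>v r\<bar>)"
          using trunc_bounds[OF \<epsilon>, of "v r"] \<epsilon> unfolding t_def by (intro mult_mono) auto
        finally have "\<bar>G r\<bar> * \<bar>(v r)\<^sup>2 - t\<^sup>2\<bar> \<le> \<bar>G r\<bar> * ((2 * \<epsilon>) * (2 * \<bar>v r\<bar>))"
          by (intro mult_left_mono) auto
        then show ?thesis by (simp add: mult_ac flip: right_diff_distrib abs_mult)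
      qed
      ultimately have "(trunc' \<epsilon> (v r) * v' r)\<^sup>2 - G r * t\<^sup>2 \<le> (v' r)\<^sup>2 - G r * (v r)\<^sup>2 + \<epsilon> * (\<bar>G r\<bar> * (4 * \<bar>v r\<bar>))"
        by linarith
      then have "r ^ (n - 1) * ((trunc' \<epsilon> (v r) * v' r)\<^sup>2 - G r * t\<^sup>2) \<le>
          r ^ (n - 1) * ((v' r)\<^sup>2 - G r * (v r)\<^sup>2 + \<epsilon> * (\<bar>G r\<bar> * (4 * \<bar>v r\<bar>)))"
        using r a0 by (intro mult_left_mono) auto
      also have "\<dots> = r ^ (n - 1) * ((v' r)\<^sup>2 - G r * (v r)\<^sup>2) + \<epsilon> * (r ^ (n - 1) * (\<bar>G r\<bar> * (4 * \<bar>v r\<bar>)))"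
        by (simp only: distrib_left mult.left_commute)
      finally show "r ^ (n - 1) * ((trunc' \<epsilon> (v r) * v' r)\<^sup>2 - G r * (trunc \<epsilon> (v r))\<^sup>2) \<le>
          r ^ (n - 1) * ((v' r)\<^sup>2 - G r * (v r)\<^sup>2) + \<epsilon> * (r ^ (n - 1) * (\<bar>G r\<bar> * (4 * \<bar>v r\<bar>)))"
        unfolding t_def .
    qed
    also have "\<dots> = ?Q + \<epsilon> * E"
      unfolding integral_add[OF i1 integrable_on_mult_right[OF i2]] integral_mult_right E_def by (simp add: G_def)
    finally show ?thesis .
  qed
  have "E \<ge> 0" unfolding E_def using a0 by (intro integral_nonneg i2) auto
  show ?thesis
  proof (rule ccontr)
    define q where "q = ?Q"
    define d where "d = E + 1"
    assume "\<not> 0 \<le> ?Q"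
    then have q: "q < 0" by (simp add: q_def)
    have d: "d > 0" using \<open>E \<ge> 0\<close> by (simp add: d_def)
    define \<epsilon> where "\<epsilon> = - q / (2 * d)"
    have "\<epsilon> > 0" unfolding \<epsilon>_def using q d by (intro divide_pos_pos) auto
    then have "\<epsilon> * E \<le> \<epsilon> * d" unfolding d_def by simp
    also have "\<dots> = - q / 2" using d by (simp add: \<epsilon>_def)
    finally show False using approx[OF \<open>\<epsilon> > 0\<close>, folded q_def] q by linarith
  qed
qed

text \<open>Stability tested with \<open>\<omega> * \<eta>\<close>: since \<open>\<omega>\<close> solves the linearized equation up to the term
  \<open>(n - 1) * \<omega> / r\<^sup>2\<close>, the potential \<open>deriv g (U r)\<close> disappears.\<close>

lemma hardy_inequality:
  assumes ab: "R < a" "a < b" and \<eta>: "C1_on a b \<eta> \<eta>'" and 0: "\<omega> a * \<eta> a = 0" "\<omega> b * \<eta> b = 0"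
  shows "0 \<le> integral {a..b} (hardy_integrand (sqrt (real n - 1)) (\<lambda>r. r ^ (n - 1) * (\<omega> r)\<^sup>2) \<eta> \<eta>')"
    (is "_ \<le> integral _ ?h")
proof -
  have a0: "a > 0" using ab R by simp
  define G where "G = (\<lambda>r. deriv g (U r))"
  define v where "v = (\<lambda>r. \<omega> r * \<eta> r)"
  define v' where "v' = (\<lambda>r. \<omega>' r * \<eta> r + \<omega> r * \<eta>' r)"
  \<comment> \<open>No third derivative of the solution is assumed: \<open>\<omega>'\<close> is
    differentiable because the right-hand side of the equation is.\<close>
  have d\<omega>': "(\<omega>' has_real_derivative - G r * \<omega> r - (real n - 1) / r * \<omega>' r + (real n - 1) / r\<^sup>2 * \<omega> r) (at r)" if "r > 0" for r
  proof -
    have "((\<lambda>r. - g (U r) - (real n - 1) / r * \<omega> r) has_real_derivative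
        - G r * \<omega> r - (real n - 1) / r * \<omega>' r + (real n - 1) / r\<^sup>2 * \<omega> r) (at r)"
      using that DERIV_chain2[OF dg dU[OF that]]
      by (auto intro!: derivative_eq_intros d\<omega> simp: G_def field_simps power2_eq_square)
    then show ?thesis
      by (rule has_field_derivative_transform_within_open[of _ _ _ "{0<..}"]) (use that ode in auto)
  qed
  have C1v: "C1_on a b v v'"
  proof -
    have "(v has_real_derivative v' x) (at x within {a..b})" if "x \<in> {a..b}" for x
    proof -
      have "(\<omega> has_real_derivative \<omega>' x) (at x within {a..b})"
        by (rule has_field_derivative_at_within[OF d\<omega>]) (use that a0 in auto)
      then show ?thesis unfolding v_def v'_def using \<eta> that
        by (auto intro!: derivative_eq_intros simp: C1_on_def)
    qed
    moreover have "continuous_on {a..b} v'"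
      unfolding v'_def using \<eta> C1_on_continuous[OF \<eta>] Icc_cont[OF a0, of b]
      by (auto intro!: continuous_intros simp: C1_on_def)
    ultimately show ?thesis unfolding C1_on_def by blast
  qed
  \<comment> \<open>The difference between the stability density of \<open>\<omega> * \<eta>\<close>
    and the Hardy density is the derivative of \<open>\<Phi>\<close>. For the boundary terms it is
    enough that the product \<open>\<omega> * \<eta>\<close> vanishes, so \<open>\<eta>\<close> may
    be nonzero at a zero of \<open>\<omega>\<close>.\<close>
  define \<Phi> where "\<Phi> = (\<lambda>r. r ^ (n - 1) * \<omega>' r * \<omega> r * (\<eta> r)\<^sup>2)"
  have "((\<lambda>r. r ^ (n - 1) * ((v' r)\<^sup>2 - G r * (v r)\<^sup>2) - ?h r) has_integral \<Phi> b - \<Phi> a) {a..b}"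
  proof (rule fundamental_theorem_of_calculus)
    fix x assume x: "x \<in> {a..b}"
    have x0: "x > 0" using x a0 by auto
    have d1: "(\<omega> has_real_derivative \<omega>' x) (at x within {a..b})"
      by (rule has_field_derivative_at_within[OF d\<omega>[OF x0]])
    have d2: "(\<omega>' has_real_derivative - G x * \<omega> x - (real n - 1) / x * \<omega>' x + (real n - 1) / x\<^sup>2 * \<omega> x) (at x within {a..b})"
      by (rule has_field_derivative_at_within[OF d\<omega>'[OF x0]])
    have d3: "(\<eta> has_real_derivative \<eta>' x) (at x within {a..b})" using \<eta> x by (simp add: C1_on_def)
    have d4: "((\<lambda>r. r ^ (n - 1)) has_real_derivative (real n - 1) * x ^ (n - 1) / x) (at x within {a..b})"
      by (rule has_field_derivative_at_within[OF d_power[OF x0]])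
    have "(\<Phi> has_real_derivative x ^ (n - 1) * ((v' x)\<^sup>2 - G x * (v x)\<^sup>2) - ?h x) (at x within {a..b})"
      unfolding \<Phi>_def
    proof (rule DERIV_cong[OF DERIV_mult[OF DERIV_mult[OF DERIV_mult[OF d4 d2] d1] DERIV_power[OF d3, of 2]]])
      define m where "m = real n - 1"
      have sq: "(sqrt m)\<^sup>2 = m" using n by (simp add: m_def)
      define P where "P = x ^ (n - 1)"
      show "(((real n - 1) * x ^ (n - 1) / x * \<omega>' x + (- G x * \<omega> x - (real n - 1) / x * \<omega>' x + (real n - 1) / x\<^sup>2 * \<omega> x) * x ^ (n - 1)) * \<omega> x
          + \<omega>' x * (x ^ (n - 1) * \<omega>' x)) * (\<eta> x)\<^sup>2 + real 2 * (\<eta>' x * \<eta> x ^ (2 - Suc 0)) * (x ^ (n - 1) * \<omega>' x * \<omega> x)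
        = x ^ (n - 1) * ((v' x)\<^sup>2 - G x * (v x)\<^sup>2) - ?h x"
        unfolding hardy_integrand_def v_def v'_def m_def[symmetric] P_def[symmetric] sq using x0
        by (simp add: field_simps power2_eq_square)
    qed
    then show "(\<Phi> has_vector_derivative x ^ (n - 1) * ((v' x)\<^sup>2 - G x * (v x)\<^sup>2) - ?h x) (at x within {a..b})"
      by (simp add: has_real_derivative_iff_has_vector_derivative)
  qed (use ab in auto)
  moreover have "\<Phi> a = 0" "\<Phi> b = 0" using 0 by (auto simp: \<Phi>_def)
  ultimately have 1: "integral {a..b} (\<lambda>r. r ^ (n - 1) * ((v' r)\<^sup>2 - G r * (v r)\<^sup>2) - ?h r) = 0"
    by (simp add: integral_unique)
  have ih: "?h integrable_on {a..b}"
    by (intro integrable_continuous_real hardy_integrand_continuous[OF \<eta>] continuous_intros Icc_cont a0)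
  have iv: "(\<lambda>r. r ^ (n - 1) * ((v' r)\<^sup>2 - G r * (v r)\<^sup>2)) integrable_on {a..b}"
    using C1v C1_on_continuous[OF C1v] Icc_cont[OF a0, of b]
    by (auto intro!: integrable_continuous_real continuous_intros simp: C1_on_def G_def)
  have "integral {a..b} ?h = integral {a..b} (\<lambda>r. r ^ (n - 1) * ((v' r)\<^sup>2 - G r * (v r)\<^sup>2))"
    using 1 integral_diff[OF iv ih] by simp
  moreover have "v a = 0" "v b = 0" using 0 by (auto simp: v_def)
  ultimately show ?thesis using stable_C1_on[OF ab C1v] by (simp add: G_def)
qed

text \<open>Between two zeros of \<open>\<omega>\<close> the constant 1 is an admissible
  \<open>\<eta>\<close>. It has no gradient energy, so the integral of the weight over the square of
  the radius must vanish.\<close>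

lemma zero_between_zeros:
  assumes ab: "R < a" "a < b" and 0: "\<omega> a = 0" "\<omega> b = 0" and r: "r \<in> {a..b}"
  shows "\<omega> r = 0"
proof -
  have a0: "a > 0" using ab R by simp
  have c: "C1_on a b (\<lambda>_. 1) (\<lambda>_. 0)" by (auto simp: C1_on_def)
  define f where "f = (\<lambda>r. (real n - 1) * (r ^ (n - 1) * (\<omega> r)\<^sup>2 / r\<^sup>2))"
  have fc: "continuous_on {a..b} f"
    unfolding f_def by (intro continuous_intros Icc_cont a0) (use a0 in auto)
  have "0 \<le> integral {a..b} (hardy_integrand (sqrt (real n - 1)) (\<lambda>r. r ^ (n - 1) * (\<omega> r)\<^sup>2) (\<lambda>_. 1) (\<lambda>_. 0))"
    by (rule hardy_inequality[OF ab c]) (use 0 in auto)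
  also have "\<dots> = integral {a..b} (\<lambda>r. - f r)"
    by (rule integral_cong) (use n in \<open>auto simp: hardy_integrand_def f_def\<close>)
  finally have "integral {a..b} f \<le> 0" by simp
  moreover have f0: "f x \<ge> 0" if "x \<in> {a..b}" for x using that a0 n by (auto simp: f_def)
  then have "integral {a..b} f \<ge> 0" by (intro integral_nonneg integrable_continuous_real fc)
  ultimately have "\<forall>x\<in>{a..b}. f x = 0" using integral_eq_0_iff[OF fc ab(2) f0] by simp
  then have "f r = 0" using r by blast
  then show ?thesis using a0 r n by (auto simp: f_def)
qed

text \<open>If zeros beyond \<open>R\<close> occur at arbitrarily large radii, then by
  \<open>zero_between_zeros\<close> everything after the first chosen zero is 0; otherwise the zeros
  are bounded.\<close>

lemma eventually_zero_or_nonzero: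
  obtains S0 where "S0 > R" "\<And>r. r \<ge> S0 \<Longrightarrow> \<omega> r = 0"
  | S0 where "S0 > R" "\<And>r. r > S0 \<Longrightarrow> \<omega> r \<noteq> 0"
proof (cases "\<exists>a>R. \<omega> a = 0 \<and> (\<forall>S. \<exists>b>S. \<omega> b = 0)")
  case True
  then obtain a where a: "a > R" "\<omega> a = 0" "\<And>S. \<exists>b>S. \<omega> b = 0" by blast
  have "\<omega> r = 0" if r: "r \<ge> a" for r
  proof -
    obtain b where "b > r" "\<omega> b = 0" using a by blast
    then show ?thesis using zero_between_zeros[of a b r] a r by auto
  qed
  then show ?thesis using that(1)[of a] a by blast
next
  case False
  show ?thesis
  proof (cases "\<exists>a>R. \<omega> a = 0")
    case True
    then obtain S where "\<And>b. b > S \<Longrightarrow> \<omega> b \<noteq> 0" using False by blast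
    then show ?thesis using that(2)[of "max S (R + 1)"] by auto
  next
    case False
    then show ?thesis using that(2)[of "R + 1"] by auto
  qed
qed

text \<open>The mean value theorem bounds the derivative at some \<open>s\<close> in
  \<open>{r..r + 1}\<close> by \<open>2 * M\<close>. The equation in divergence form transports this
  back to \<open>r\<close>; the powers of the radius are comparable since
  \<open>r + 1 \<le> 2 * r\<close>.\<close>

lemma \<omega>_bounded: "\<exists>L. \<forall>r\<ge>1. \<bar>\<omega> r\<bar> \<le> L"
proof -
  obtain M where M: "\<And>r. \<bar>U r\<bar> \<le> M" using U_bounded by (auto simp: bounded_iff)
  have "compact (g ` {-M..M})" by (intro compact_continuous_image g_cont compact_Icc)
  then obtain Gm where Gm: "\<And>x. x \<in> {-M..M} \<Longrightarrow> \<bar>g x\<bar> \<le> Gm"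
    using compact_imp_bounded by (force simp: bounded_iff)
  have gU: "\<bar>g (U r)\<bar> \<le> Gm" for r using M[of r] by (intro Gm) (auto simp: abs_le_iff)
  have "\<bar>\<omega> r\<bar> \<le> 2 ^ (n - 1) * (2 * M + Gm)" if r: "r \<ge> 1" for r
  proof -
    have "\<exists>s. r < s \<and> s < r + 1 \<and> U (r + 1) - U r = (r + 1 - r) * \<omega> s"
      by (rule MVT2) (use r dU in auto)
    then obtain s where s: "r < s" "s < r + 1" "\<omega> s = U (r + 1) - U r" by auto
    have \<omega>s: "\<bar>\<omega> s\<bar> \<le> 2 * M" using s(3) M[of r] M[of "r + 1"] by linarith
    define \<Psi> where "\<Psi> = (\<lambda>x. x ^ (n - 1) * \<omega> x)"
    have d\<Psi>: "(\<Psi> has_real_derivative - (x ^ (n - 1) * g (U x))) (at x)" if x: "x > 0" for x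
    proof -
      show ?thesis unfolding \<Psi>_def
        by (rule DERIV_cong[OF DERIV_mult[OF d_power[OF x] d\<omega>[OF x]]]) (use x in \<open>simp add: ode field_simps\<close>)
    qed
    have "\<exists>t. r < t \<and> t < s \<and> \<Psi> s - \<Psi> r = (s - r) * - (t ^ (n - 1) * g (U t))"
      by (rule MVT2) (use r s d\<Psi> in auto)
    then obtain t where t: "r < t" "t < s" "\<Psi> s - \<Psi> r = (s - r) * - (t ^ (n - 1) * g (U t))" by blast
    have p: "s ^ (n - 1) \<le> (2 * r) ^ (n - 1)" "t ^ (n - 1) \<le> (2 * r) ^ (n - 1)"
      by (rule power_mono; use r s t in linarith)+
    have "\<bar>\<Psi> s\<bar> \<le> (2 * r) ^ (n - 1) * (2 * M)"
      unfolding \<Psi>_def abs_mult using p \<omega>s r s by (intro mult_mono) auto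
    moreover have "\<bar>(s - r) * - (t ^ (n - 1) * g (U t))\<bar> \<le> 1 * ((2 * r) ^ (n - 1) * Gm)"
      unfolding abs_mult abs_minus_cancel using p r s t gU[of t] by (intro mult_mono) auto
    ultimately have "\<bar>\<Psi> r\<bar> \<le> (2 * r) ^ (n - 1) * (2 * M) + (2 * r) ^ (n - 1) * Gm" using t(3) by linarith
    also have "\<dots> = r ^ (n - 1) * (2 ^ (n - 1) * (2 * M + Gm))" by (simp add: power_mult_distrib algebra_simps)
    finally have "r ^ (n - 1) * \<bar>\<omega> r\<bar> \<le> r ^ (n - 1) * (2 ^ (n - 1) * (2 * M + Gm))"
      using r by (simp add: \<Psi>_def abs_mult)
    then show ?thesis using r by simp
  qed
  then show ?thesis by blast
qed

end

text \<open>Membership of the gradient in \<open>L^p\<close> is expressed by bounded radial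
  integrals, and the threshold for \<open>p\<close> is multiplied out. The translation to the space
  norm is \<open>in_Lp_radial_iff\<close>.\<close>

definition fast_profile_conclusion :: "nat \<Rightarrow> (real \<Rightarrow> real) \<Rightarrow> (real \<Rightarrow> real) \<Rightarrow> real \<Rightarrow> bool" where
  "fast_profile_conclusion n U \<omega> l \<longleftrightarrow>
     (\<exists>M>0. \<forall>r\<ge>1. \<bar>U r - l\<bar> \<le> M * r powr (- real n / 2 - sqrt (real n - 1) + 2)) \<and>
     (\<forall>p>0. real n < p * (real n / 2 + sqrt (real n - 1) - 1) \<longrightarrow>
        (\<exists>D. \<forall>B\<ge>1. integral {1..B} (\<lambda>r. r ^ (n - 1) * \<bar>\<omega> r\<bar> powr p) \<le> D))"

definition slow_profile_conclusion :: "nat \<Rightarrow> (real \<Rightarrow> real) \<Rightarrow> (real \<Rightarrow> real) \<Rightarrow> real \<Rightarrow> bool" where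
  "slow_profile_conclusion n U \<omega> l \<longleftrightarrow> n \<ge> 11 \<and>
     (\<exists>M>0. \<exists>r0\<ge>1. \<forall>r\<ge>r0. M * r powr (- real n / 2 + sqrt (real n - 1) + 2) \<le> \<bar>U r - l\<bar>) \<and>
     (\<forall>p\<ge>1. p * (real n / 2 - sqrt (real n - 1) - 1) \<le> real n \<longrightarrow>
        \<not> (\<exists>D. \<forall>B\<ge>1. integral {1..B} (\<lambda>r. r ^ (n - 1) * \<bar>\<omega> r\<bar> powr p) \<le> D))"

context fast_profile begin

text \<open>With a negative exponent \<open>increment_bound\<close> is a Cauchy criterion. The limit
  is taken along the integers, and letting the right end of the increments tend to infinity gives
  the rate for all radii.\<close>

lemma limit_exists:
  assumes e: "- real n / 2 - c + 2 < 0"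
  shows "\<exists>l M. M > 0 \<and> (U \<longlongrightarrow> l) at_top \<and> (\<forall>r\<ge>S0. \<bar>U r - l\<bar> \<le> M * r powr (- real n / 2 - c + 2))"
proof -
  define e where "e = - real n / 2 - c + 2"
  obtain M where M: "M > 0" "\<And>S B. S \<ge> S0 \<Longrightarrow> B \<ge> S \<Longrightarrow> \<bar>U B - U S\<bar> \<le> M * S powr e"
    using increment_bound unfolding e_def by blast
  have lim0: "((\<lambda>r. M * r powr e) \<longlongrightarrow> 0) at_top"
    using tendsto_mult_right_zero[OF tendsto_neg_powr[OF _ filterlim_ident, of e]] assms by (simp add: e_def)
  have "Cauchy (\<lambda>k::nat. U (real k))"
  proof (rule metric_CauchyI)
    fix d :: real assume "d > 0"
    have "\<forall>\<^sub>F r in at_top. M * r powr e < d" using order_tendstoD(2)[OF lim0 \<open>d > 0\<close>] .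
    then obtain N where N: "\<And>r. r \<ge> N \<Longrightarrow> M * r powr e < d" by (auto simp: eventually_at_top_linorder)
    obtain N' :: nat where N': "real N' \<ge> max N S0" using real_arch_simple by blast
    have "dist (U (real m)) (U (real k)) < d" if "m \<ge> N'" "k \<ge> m" for m k
    proof -
      have "real m \<ge> max N S0" using N' that by linarith
      then show ?thesis using M(2)[of "real m" "real k"] N[of "real m"] that by (simp add: dist_real_def abs_minus_commute)
    qed
    then show "\<exists>K. \<forall>m\<ge>K. \<forall>k\<ge>K. dist (U (real m)) (U (real k)) < d"
      by (intro exI[of _ N'] allI impI) (metis dist_commute nle_le)
  qed
  then obtain l where l: "(\<lambda>k::nat. U (real k)) \<longlonglongrightarrow> l" using Cauchy_convergent_iff convergent_def by blast
  have bd: "\<bar>U r - l\<bar> \<le> M * r powr e" if r: "r \<ge> S0" for r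
  proof -
    have "(\<lambda>k::nat. \<bar>U (real k) - U r\<bar>) \<longlonglongrightarrow> \<bar>l - U r\<bar>" by (intro tendsto_intros l)
    moreover have "\<forall>\<^sub>F k in sequentially. \<bar>U (real k) - U r\<bar> \<le> M * r powr e"
    proof -
      obtain N :: nat where "r \<le> real N" using real_arch_simple by blast
      then show ?thesis using M(2)[OF r] by (intro eventually_sequentiallyI[of N]) force
    qed
    ultimately have "\<bar>l - U r\<bar> \<le> M * r powr e" by (rule tendsto_upperbound) simp
    then show ?thesis by (simp add: abs_minus_commute)
  qed
  have "(U \<longlongrightarrow> l) at_top"
  proof -
    have "((\<lambda>r. U r - l) \<longlongrightarrow> 0) at_top"
      by (rule Lim_null_comparison[OF _ lim0]) (use bd in \<open>auto simp: eventually_at_top_linorder\<close>)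
    then show ?thesis by (rule Lim_null[THEN iffD2])
  qed
  then show ?thesis using M(1) bd unfolding e_def by blast
qed

end

context radial_profile begin

lemma fast_decay_profile:
  assumes S0: "S0 \<ge> 1"
    and tail: "\<And>S B. S0 \<le> S \<Longrightarrow> S \<le> B \<Longrightarrow>
      integral {S..B} (\<lambda>r. r ^ (n - 1) * (\<omega> r)\<^sup>2 / r\<^sup>2) \<le> C * S powr (-2 * sqrt (real n - 1))"
  shows "\<exists>l. (U \<longlongrightarrow> l) at_top \<and> fast_profile_conclusion n U \<omega> l"
proof -
  define c where "c = sqrt (real n - 1)"
  have c: "c > 1" using n unfolding c_def by simp
  interpret fast_profile U \<omega> n c C S0
    by unfold_locales
       (use n c S0 dU tail in \<open>auto simp: c_def intro!: continuous_on_subset[OF \<omega>_cont]\<close>)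
  have e: "- real n / 2 - c + 2 < 0"
  proof (cases "n = 3")
    case True
    have "(1/2)\<^sup>2 < real n - 1" using True by (simp add: power2_eq_square)
    then have "1/2 < c" unfolding c_def by (rule real_less_rsqrt)
    then show ?thesis using True by simp
  next
    case False
    then have "real n \<ge> 4" using n by simp
    then show ?thesis using c by linarith
  qed
  obtain l M where l: "M > 0" "(U \<longlongrightarrow> l) at_top" "\<And>r. r \<ge> S0 \<Longrightarrow> \<bar>U r - l\<bar> \<le> M * r powr (- real n / 2 - c + 2)"
    using limit_exists[OF e] by blast
  define e where "e = - real n / 2 - c + 2"
  obtain K where K: "\<And>r. \<bar>U r\<bar> \<le> K" using U_bounded by (auto simp: bounded_iff)
  have "0 \<le> K" using K[of 0] by simp
  \<comment> \<open>The second summand covers \<open>{1..S0}\<close>: there \<open>r powr e\<close>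
    is at least \<open>S0 powr e\<close>, as \<open>e\<close> is negative, and
    \<open>K + \<bar>l\<bar>\<close> bounds the distance to the limit.\<close>
  define M' where "M' = M + (K + \<bar>l\<bar>) / S0 powr e"
  have bound: "\<bar>U r - l\<bar> \<le> M' * r powr e" if r: "r \<ge> 1" for r
  proof (cases "r \<ge> S0")
    case True
    have "M * r powr e \<le> M' * r powr e" unfolding M'_def using \<open>0 \<le> K\<close> by (intro mult_right_mono) auto
    then show ?thesis using l(3)[OF True] by (simp add: e_def)
  next
    case False
    have "S0 powr e \<le> r powr e" using False r e by (intro powr_mono2') (auto simp: e_def)
    then have "(K + \<bar>l\<bar>) * 1 \<le> (K + \<bar>l\<bar>) * (r powr e / S0 powr e)"
      using \<open>0 \<le> K\<close> S0 by (intro mult_left_mono) auto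
    moreover have "0 \<le> M * r powr e" using l(1) by simp
    moreover have "\<bar>U r - l\<bar> \<le> K + \<bar>l\<bar>" using K[of r] by linarith
    ultimately show ?thesis unfolding M'_def by (simp add: distrib_right)
  qed
  have "M' > 0" unfolding M'_def using l(1) \<open>0 \<le> K\<close> by (intro add_pos_nonneg) auto
  moreover obtain L where "\<And>r. r \<ge> 1 \<Longrightarrow> \<bar>\<omega> r\<bar> \<le> L" using \<omega>_bounded by blast
  ultimately have "fast_profile_conclusion n U \<omega> l"
    unfolding fast_profile_conclusion_def c_def[symmetric]
    using bound power_integral_bound unfolding e_def by blast
  then show ?thesis using l by blast
qed

lemma slow_decay_profile:
  assumes S0: "S0 \<ge> 1" and nz: "\<And>r. r \<ge> S0 \<Longrightarrow> \<omega> r \<noteq> 0"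
    and tail: "\<And>S B. S0 \<le> S \<Longrightarrow> S \<le> B \<Longrightarrow>
      integral {S..B} (\<lambda>r. 1 / (r ^ (n - 1) * (\<omega> r)\<^sup>2)) \<le> C * S powr (-2 * sqrt (real n - 1))"
  shows "\<exists>l. (U \<longlongrightarrow> l) at_top \<and> slow_profile_conclusion n U \<omega> l"
proof -
  define c where "c = sqrt (real n - 1)"
  \<comment> \<open>Without zeros the derivative keeps its sign, so multiplying by
    \<open>\<sigma>\<close> gives an increasing profile. It is bounded, hence convergent.\<close>
  define \<sigma> where "\<sigma> = sgn (\<omega> S0)"
  have \<sigma>: "\<sigma> * \<sigma> = 1" "\<bar>\<sigma>\<bar> = 1" using nz[of S0] by (auto simp: \<sigma>_def sgn_if)
  have pos: "\<sigma> * \<omega> r > 0" if r: "r \<ge> S0" for r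
  proof (rule ccontr)
    assume "\<not> ?thesis"
    then have "\<sigma> * \<omega> r \<le> 0" by simp
    moreover have "0 \<le> \<sigma> * \<omega> S0" by (simp add: \<sigma>_def sgn_if)
    moreover have "continuous_on {S0..r} (\<lambda>r. \<sigma> * \<omega> r)"
      by (intro continuous_intros Icc_cont) (use S0 in auto)
    ultimately obtain x where "S0 \<le> x" "\<sigma> * \<omega> x = 0" using IVT2'[of "\<lambda>r. \<sigma> * \<omega> r" r 0 S0] r by auto
    then show False using nz[of x] \<sigma> by auto
  qed
  have sq: "(\<sigma> * x)\<^sup>2 = x\<^sup>2" for x using \<sigma>(1) by (simp add: power_mult_distrib power2_eq_square)
  have n_ge_3: "n \<ge> 3" by (rule n)
  interpret slow_profile "\<lambda>r. \<sigma> * U r" "\<lambda>r. \<sigma> * \<omega> r" n c C S0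
    by unfold_locales
       (use n S0 tail pos in \<open>auto simp: c_def sq intro!: derivative_eq_intros dU continuous_intros continuous_on_subset[OF \<omega>_cont]\<close>)
  obtain M where M: "M > 0" "\<And>r. r \<ge> S0 \<Longrightarrow> \<sigma> * U (2 * r) - \<sigma> * U r \<ge> M * r powr (- real n / 2 + c + 2)"
    using doubling_increment_bound by blast
  have mono: "\<sigma> * U x \<le> \<sigma> * U y" if "S0 \<le> x" "x \<le> y" for x y
  proof (rule DERIV_nonneg_imp_nondecreasing[OF that(2)])
    fix t assume "x \<le> t" "t \<le> y"
    then show "\<exists>d. ((\<lambda>r. \<sigma> * U r) has_real_derivative d) (at t) \<and> 0 \<le> d"
      using that S0 pos[of t] by (intro exI[of _ "\<sigma> * \<omega> t"]) (auto intro!: derivative_eq_intros dU)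
  qed
  obtain K where K: "\<And>r. \<bar>U r\<bar> \<le> K" using U_bounded by (auto simp: bounded_iff)
  have K\<sigma>: "\<bar>\<sigma> * U r\<bar> \<le> K" for r using K[of r] \<sigma>(2) by (simp add: abs_mult)
  define L where "L = (SUP r\<in>{S0..}. \<sigma> * U r)"
  have bdd: "bdd_above ((\<lambda>r. \<sigma> * U r) ` {S0..})"
    using K\<sigma> by (intro bdd_aboveI2[of _ _ K]) (auto simp: abs_le_iff)
  have le_L: "\<sigma> * U r \<le> L" if "r \<ge> S0" for r
    unfolding L_def by (rule cSUP_upper[OF _ bdd]) (use that in auto)
  have limL: "((\<lambda>r. \<sigma> * U r) \<longlongrightarrow> L) at_top"
  proof (rule increasing_tendsto)
    show "\<forall>\<^sub>F r in at_top. \<sigma> * U r \<le> L" using le_L by (auto simp: eventually_at_top_linorder)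
    fix x assume "x < L"
    then obtain r where r: "r \<ge> S0" "x < \<sigma> * U r" unfolding L_def using less_cSUP_iff[OF _ bdd] by auto
    then have "x < \<sigma> * U s" if "s \<ge> r" for s using mono[of r s] that by auto
    then show "\<forall>\<^sub>F r in at_top. x < \<sigma> * U r" by (auto simp: eventually_at_top_linorder)
  qed
  define l where "l = \<sigma> * L"
  have Ul: "(U \<longlongrightarrow> l) at_top"
  proof -
    have "((\<lambda>r. \<sigma> * (\<sigma> * U r)) \<longlongrightarrow> \<sigma> * L) at_top" by (intro tendsto_intros limL)
    then show ?thesis using \<sigma>(1) by (simp add: l_def flip: mult.assoc)
  qed
  \<comment> \<open>By monotonicity the distance to the limit dominates the increment from
    \<open>r\<close> to \<open>2 * r\<close>.\<close>
  have lower: "M * r powr (- real n / 2 + c + 2) \<le> \<bar>U r - l\<bar>" if r: "r \<ge> S0" for r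
  proof -
    have "M * r powr (- real n / 2 + c + 2) \<le> L - \<sigma> * U r"
      using M(2)[OF r] le_L[of "2 * r"] r S0 by linarith
    also have "L - \<sigma> * U r = \<sigma> * (l - U r)" using \<sigma>(1) by (simp add: l_def right_diff_distrib flip: mult.assoc)
    also have "\<dots> \<le> \<bar>\<sigma> * (l - U r)\<bar>" by simp
    also have "\<dots> = \<bar>U r - l\<bar>" using \<sigma>(2) by (simp add: abs_mult abs_minus_commute)
    finally show ?thesis .
  qed
  \<comment> \<open>With a nonnegative exponent the lower bound would keep the profile at distance
    at least \<open>M\<close> from its own limit.\<close>
  have exp_neg: "- real n / 2 + c + 2 < 0"
  proof (rule ccontr)
    assume exp_ge: "\<not> ?thesis"
    have ge: "M \<le> \<bar>U r - l\<bar>" if "r \<ge> S0" for r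
    proof -
      have "1 \<le> r powr (- real n / 2 + c + 2)" using exp_ge that S0 by (intro ge_one_powr_ge_zero) auto
      then have "M * 1 \<le> M * r powr (- real n / 2 + c + 2)" using M(1) by (intro mult_left_mono) auto
      then show ?thesis using lower[OF that] by simp
    qed
    have "((\<lambda>r. \<bar>U r - l\<bar>) \<longlongrightarrow> \<bar>l - l\<bar>) at_top" by (intro tendsto_intros Ul)
    then have "M \<le> \<bar>l - l\<bar>"
      by (rule tendsto_lowerbound) (use ge in \<open>auto simp: eventually_at_top_linorder\<close>)
    then show False using M(1) by simp
  qed
  have n11: "n \<ge> 11"
  proof (rule ccontr)
    assume "\<not> n \<ge> 11"
    then have n10: "real n \<le> 10" by simp
    have n3: "real n \<ge> 3" using n_ge_3 by simp
    \<comment> \<open>This product is four times \<open>(n / 2 - 2)\<^sup>2 - (n - 1)\<close>; for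
      \<open>n \<le> 10\<close> it would make the exponent nonnegative.\<close>
    have "(real n - 2) * (real n - 10) \<le> 0" using n3 n10 by (intro mult_nonneg_nonpos) auto
    then have "(real n / 2 - 2)\<^sup>2 \<le> real n - 1" by (simp add: power2_eq_square field_simps)
    then have "\<bar>real n / 2 - 2\<bar> \<le> c" unfolding c_def by (rule real_le_rsqrt[of "\<bar>real n / 2 - 2\<bar>", simplified])
    then show False using exp_neg by linarith
  qed
  have unb: "\<not> (\<exists>D. \<forall>B\<ge>1. integral {1..B} (\<lambda>r. r ^ (n - 1) * \<bar>\<omega> r\<bar> powr p) \<le> D)"
    if p: "p \<ge> 1" "p * (real n / 2 - c - 1) \<le> real n" for p
  proof
    assume "\<exists>D. \<forall>B\<ge>1. integral {1..B} (\<lambda>r. r ^ (n - 1) * \<bar>\<omega> r\<bar> powr p) \<le> D"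
    then obtain D where D: "\<And>B. B \<ge> 1 \<Longrightarrow> integral {1..B} (\<lambda>r. r ^ (n - 1) * \<bar>\<omega> r\<bar> powr p) \<le> D" by blast
    obtain B where B: "B \<ge> S0" "integral {S0..B} (\<lambda>r. r ^ (n - 1) * (\<sigma> * \<omega> r) powr p) > D"
      using power_integral_unbounded[OF p] by blast
    have ii: "(\<lambda>r. r ^ (n - 1) * \<bar>\<omega> r\<bar> powr p) integrable_on {x..y}" if "x \<ge> 1" for x y
      by (intro integrable_continuous_real continuous_intros continuous_on_powr' Icc_cont) (use that p in auto)
    have "\<sigma> * \<omega> r = \<bar>\<omega> r\<bar>" if "r \<ge> S0" for r
      using pos[OF that] \<sigma>(2) by (metis abs_mult abs_of_pos mult_1)
    then have "integral {S0..B} (\<lambda>r. r ^ (n - 1) * (\<sigma> * \<omega> r) powr p) = integral {S0..B} (\<lambda>r. r ^ (n - 1) * \<bar>\<omega> r\<bar> powr p)"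
      by (intro integral_cong) auto
    also have "\<dots> \<le> integral {1..B} (\<lambda>r. r ^ (n - 1) * \<bar>\<omega> r\<bar> powr p)"
      by (rule integral_subset_le[OF _ ii ii]) (use S0 in auto)
    also have "\<dots> \<le> D" using D[of B] B S0 by auto
    finally show False using B by simp
  qed
  have "slow_profile_conclusion n U \<omega> l"
    unfolding slow_profile_conclusion_def c_def[symmetric] using n11 M(1) lower S0 unb by blast
  then show ?thesis using Ul by blast
qed

lemma profile_dichotomy:
  "\<exists>l. (U \<longlongrightarrow> l) at_top \<and> (slow_profile_conclusion n U \<omega> l \<or> fast_profile_conclusion n U \<omega> l)"
proof (rule eventually_zero_or_nonzero)
  fix S0 assume S0: "S0 > R" "\<And>r. r \<ge> S0 \<Longrightarrow> \<omega> r = 0"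
  have "\<exists>l. (U \<longlongrightarrow> l) at_top \<and> fast_profile_conclusion n U \<omega> l"
  \<comment> \<open>An eventually constant profile counts as fast decay, with tail constant
    0.\<close>
  proof (rule fast_decay_profile[of "max 1 S0" 0])
    fix S B assume "max 1 S0 \<le> S" "S \<le> B"
    then have "integral {S..B} (\<lambda>r. r ^ (n - 1) * (\<omega> r)\<^sup>2 / r\<^sup>2) = integral {S..B} (\<lambda>_. 0)"
      by (intro integral_cong) (use S0 in auto)
    then show "integral {S..B} (\<lambda>r. r ^ (n - 1) * (\<omega> r)\<^sup>2 / r\<^sup>2) \<le> 0 * S powr (- 2 * sqrt (real n - 1))" by simp
  qed auto
  then show ?thesis by blast
next
  fix S0 assume S0: "S0 > R" "\<And>r. r > S0 \<Longrightarrow> \<omega> r \<noteq> 0"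
  interpret hardy_weight "\<lambda>r. r ^ (n - 1) * (\<omega> r)\<^sup>2" "sqrt (real n - 1)" S0
  proof
    show "sqrt (real n - 1) > 0" "S0 > 0" using n S0 R by auto
    show "continuous_on {S0<..} (\<lambda>r. r ^ (n - 1) * (\<omega> r)\<^sup>2)"
      by (intro continuous_intros continuous_on_subset[OF \<omega>_cont]) (use S0 R in auto)
    show "0 < r ^ (n - 1) * (\<omega> r)\<^sup>2" if "r > S0" for r using that S0 R by simp
    show "0 \<le> integral {a..b} (hardy_integrand (sqrt (real n - 1)) (\<lambda>r. r ^ (n - 1) * (\<omega> r)\<^sup>2) \<eta> \<eta>')"
      if "S0 < a" "a < b" "C1_on a b \<eta> \<eta>'" "\<eta> a = 0" "\<eta> b = 0" for a b \<eta> \<eta>'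
      by (rule hardy_inequality) (use that S0 in auto)
  qed
  show ?thesis
  proof (rule decay_dichotomy)
    fix C S1 assume S1: "S1 > S0" "\<And>S B. S1 \<le> S \<Longrightarrow> S \<le> B \<Longrightarrow>
      integral {S..B} (\<lambda>r. r ^ (n - 1) * (\<omega> r)\<^sup>2 / r\<^sup>2) \<le> C * S powr (- 2 * sqrt (real n - 1))"
    have "\<exists>l. (U \<longlongrightarrow> l) at_top \<and> fast_profile_conclusion n U \<omega> l"
      by (rule fast_decay_profile[of "max 1 S1" C]) (use S1 in auto)
    then show ?thesis by blast
  next
    fix C S1 assume S1: "S1 > S0" "\<And>S B. S1 \<le> S \<Longrightarrow> S \<le> B \<Longrightarrow>
      integral {S..B} (\<lambda>r. 1 / (r ^ (n - 1) * (\<omega> r)\<^sup>2)) \<le> C * S powr (- 2 * sqrt (real n - 1))"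
    have "\<exists>l. (U \<longlongrightarrow> l) at_top \<and> slow_profile_conclusion n U \<omega> l"
      by (rule slow_decay_profile[of "max 1 S1" C]) (use S1 S0 in auto)
    then show ?thesis by blast
  qed
qed

end

section \<open>Integrals of radial functions\<close>

text \<open>Polar coordinates for radial integrands. Both measures give \<open>{..a}\<close> the
  volume of the ball of radius \<open>a\<close>, and half-lines determine a measure that is finite
  on them; the density is the derivative of the ball volume.\<close>

lemma distr_norm_lborel:
  "distr lborel borel (norm :: 'a::euclidean_space \<Rightarrow> real) =
   density lborel (\<lambda>r. ennreal (DIM('a) * unit_ball_vol DIM('a) * r ^ (DIM('a) - 1)) * indicator {0..} r)"
  (is "?L = ?R")
proof (rule measure_eqI_generator_eq[where E="range atMost" and \<Omega>=UNIV and A="\<lambda>i::nat. {..real i}"])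
  show "Int_stable (range atMost :: real set set)" by (auto simp: Int_stable_def)
  show "range atMost \<subseteq> Pow (UNIV :: real set)" by simp
  have "sets (borel :: real measure) = sigma_sets UNIV (range atMost)"
    by (subst borel_eq_atMost) simp
  then show "sets ?L = sigma_sets UNIV (range atMost)" "sets ?R = sigma_sets UNIV (range atMost)" by simp_all
  show "range (\<lambda>i::nat. {..real i}) \<subseteq> range atMost" by auto
  show "(\<Union>i::nat. {..real i}) = UNIV" by (auto intro: real_arch_simple)
  have L: "emeasure ?L {..a} = (if a \<ge> 0 then ennreal (unit_ball_vol DIM('a) * a ^ DIM('a)) else 0)" for a
  proof -
    have "emeasure ?L {..a} = emeasure lborel (cball (0::'a) a)"
      by (subst emeasure_distr) (auto simp: cball_def vimage_def intro!: arg_cong[where f="emeasure lborel"])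
    then show ?thesis by (simp add: emeasure_cball)
  qed
  have R: "emeasure ?R {..a} = (if a \<ge> 0 then ennreal (unit_ball_vol DIM('a) * a ^ DIM('a)) else 0)" for a
  proof -
    have "emeasure ?R {..a} = (\<integral>\<^sup>+r. ennreal (DIM('a) * unit_ball_vol DIM('a) * r ^ (DIM('a) - 1)) * indicator {0..a} r \<partial>lborel)"
      by (subst emeasure_density) (auto intro!: nn_integral_cong simp: indicator_def)
    also have "\<dots> = (if a \<ge> 0 then ennreal (unit_ball_vol DIM('a) * a ^ DIM('a)) else 0)"
    proof (cases "a \<ge> 0")
      case True
      have "(\<integral>\<^sup>+r. ennreal (DIM('a) * unit_ball_vol DIM('a) * r ^ (DIM('a) - 1)) * indicator {0..a} r \<partial>lborel)
         = ennreal (unit_ball_vol DIM('a) * a ^ DIM('a) - unit_ball_vol DIM('a) * 0 ^ DIM('a))"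
        by (rule nn_integral_FTC_Icc) (use True in \<open>auto intro!: derivative_eq_intros\<close>)
      then show ?thesis using True by simp
    qed simp
    finally show ?thesis .
  qed
  show "emeasure ?L X = emeasure ?R X" if "X \<in> range atMost" for X using that L R by auto
  show "emeasure ?L {..real i} \<noteq> \<infinity>" for i by (simp add: L)
qed

lemma nn_integral_radial:
  assumes [measurable]: "f \<in> borel_measurable borel"
  shows "(\<integral>\<^sup>+x. f (norm (x::'a::euclidean_space)) \<partial>lborel) =
    (\<integral>\<^sup>+r. ennreal (DIM('a) * unit_ball_vol DIM('a) * r ^ (DIM('a) - 1)) * indicator {0..} r * f r \<partial>lborel)"
proof -
  have "(\<integral>\<^sup>+x. f (norm (x::'a)) \<partial>lborel) = (\<integral>\<^sup>+r. f r \<partial>distr lborel borel (norm :: 'a \<Rightarrow> real))"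
    by (subst nn_integral_distr) auto
  then show ?thesis unfolding distr_norm_lborel by (subst (asm) nn_integral_density) auto
qed

lemma integral_radial:
  fixes q :: "real \<Rightarrow> real"
  assumes q: "continuous_on {a..b} q" and "0 < a" and q0: "\<And>r. r \<notin> {a..b} \<Longrightarrow> q r = 0"
  shows "(LINT x|lebesgue. q (norm (x::'a::euclidean_space))) =
     DIM('a) * unit_ball_vol DIM('a) * integral {a..b} (\<lambda>r. r ^ (DIM('a) - 1) * q r)"
proof -
  have "(\<lambda>r. indicator {a..b} r *\<^sub>R q r) \<in> borel_measurable borel"
    by (intro borel_measurable_continuous_on_indicator q) auto
  also have "(\<lambda>r. indicator {a..b} r *\<^sub>R q r) = q"
  proof
    fix r show "indicator {a..b} r *\<^sub>R q r = q r" using q0[of r] by (cases "r \<in> {a..b}") auto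
  qed
  finally have [measurable]: "q \<in> borel_measurable borel" .
  let ?d = "\<lambda>r. real DIM('a) * unit_ball_vol DIM('a) * r ^ (DIM('a) - 1)"
  have "(LINT x|lebesgue. q (norm (x::'a))) = (LINT x|lborel. q (norm (x::'a)))"
    by (rule integral_completion) auto
  also have "\<dots> = (LINT r|distr lborel borel (norm :: 'a \<Rightarrow> real). q r)"
    by (subst integral_distr) auto
  also have "distr lborel borel (norm :: 'a \<Rightarrow> real) = density lborel (\<lambda>r. ennreal (?d r * indicator {0..} r))"
    unfolding distr_norm_lborel by (intro arg_cong[where f="density lborel"]) (auto simp: indicator_def fun_eq_iff)
  also have "(LINT r|density lborel (\<lambda>r. ennreal (?d r * indicator {0..} r)). q r) =
      (LINT r|lborel. (?d r * indicator {0..} r) *\<^sub>R q r)"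
    by (rule integral_density) (auto simp: indicator_def)
  also have "\<dots> = (LINT r:{a..b}|lborel. ?d r * q r)"
    unfolding set_lebesgue_integral_def
    by (intro Bochner_Integration.integral_cong) (use q0 \<open>0 < a\<close> in \<open>auto simp: indicator_def\<close>)
  also have "\<dots> = integral {a..b} (\<lambda>r. ?d r * q r)"
    by (rule set_borel_integral_eq_integral)
       (auto intro!: borel_integrable_atLeastAtMost' continuous_intros q)
  also have "\<dots> = integral {a..b} (\<lambda>r. (DIM('a) * unit_ball_vol DIM('a)) * (r ^ (DIM('a) - 1) * q r))"
    by (simp add: mult_ac)
  finally show ?thesis by (simp only: integral_mult_right)
qed

text \<open>For a nonnegative integrand integrability means a finite integral, and monotone
  convergence along \<open>{1..real k}\<close> reduces this to bounded integrals over compact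
  intervals.\<close>

lemma radial_integrable_iff:
  fixes f :: "real \<Rightarrow> real"
  assumes f: "continuous_on {1..} f" and f0: "\<And>r. r \<ge> 1 \<Longrightarrow> f r \<ge> 0"
  shows "integrable (lebesgue_on {x::'a::euclidean_space. norm x > 1}) (\<lambda>x. f (norm x)) \<longleftrightarrow>
    (\<exists>C. \<forall>B\<ge>1. integral {1..B} (\<lambda>r. r ^ (DIM('a) - 1) * f r) \<le> C)"
proof -
  define V where "V = real DIM('a) * unit_ball_vol DIM('a)"
  have V: "V > 0" by (simp add: V_def)
  define h where "h = (\<lambda>r. indicator {1<..} r * f r)"
  have "(\<lambda>r. indicator {1<..} r *\<^sub>R f r) \<in> borel_measurable borel"
    by (intro borel_measurable_continuous_on_indicator continuous_on_subset[OF f]) auto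
  then have h_m[measurable]: "h \<in> borel_measurable borel" by (simp add: h_def)
  have h0: "h r \<ge> 0" for r using f0[of r] by (auto simp: h_def indicator_def)
  have O: "{x::'a. norm x > 1} \<in> sets lebesgue" "{x::'a. norm x > 1} \<in> sets borel"
    by (auto intro!: borel_open open_Collect_less continuous_intros)
  have "integrable (lebesgue_on {x::'a. norm x > 1}) (\<lambda>x. f (norm x)) \<longleftrightarrow>
     integrable lebesgue (\<lambda>x::'a. indicator {x::'a. norm x > 1} x *\<^sub>R f (norm x))"
    using O by (subst integrable_restrict_space) auto
  also have "(\<lambda>x::'a. indicator {x::'a. norm x > 1} x *\<^sub>R f (norm x)) = (\<lambda>x. h (norm x))"
    by (auto simp: h_def indicator_def fun_eq_iff)
  also have "integrable lebesgue (\<lambda>x::'a. h (norm x)) \<longleftrightarrow> integrable lborel (\<lambda>x::'a. h (norm x))"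
    by (rule integrable_completion) auto
  also have "\<dots> \<longleftrightarrow> (\<integral>\<^sup>+x. ennreal (h (norm (x::'a))) \<partial>lborel) < \<infinity>"
    using h0 by (simp add: integrable_iff_bounded)
  also have "(\<integral>\<^sup>+x. ennreal (h (norm (x::'a))) \<partial>lborel) =
     (\<integral>\<^sup>+r. ennreal (V * (r ^ (DIM('a) - 1) * h r)) \<partial>lborel)"
    unfolding nn_integral_radial[of "\<lambda>r. ennreal (h r)", simplified]
    by (intro nn_integral_cong) (auto simp: V_def h_def indicator_def ennreal_mult' f0 mult_ac simp flip: ennreal_mult'')
  also have "\<dots> < \<infinity> \<longleftrightarrow> (\<exists>C. \<forall>B\<ge>1. integral {1..B} (\<lambda>r. r ^ (DIM('a) - 1) * f r) \<le> C)"
  proof -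
    have part: "(\<integral>\<^sup>+r. ennreal (V * (r ^ (DIM('a) - 1) * h r)) * indicator {1..B} r \<partial>lborel) =
       ennreal (V * integral {1..B} (\<lambda>r. r ^ (DIM('a) - 1) * f r))" for B
    proof -
      have "(\<integral>\<^sup>+r. ennreal (V * (r ^ (DIM('a) - 1) * h r)) * indicator {1..B} r \<partial>lborel) =
         (\<integral>\<^sup>+r. ennreal (indicator {1..B} r *\<^sub>R (V * (r ^ (DIM('a) - 1) * f r))) \<partial>lborel)"
        \<comment> \<open>The integrands may differ at the radius 1, which belongs to
          \<open>{1..B}\<close> but not to the support of \<open>h\<close>.\<close>
        by (rule nn_integral_cong_AE)
           (use AE_lborel_singleton[of 1] in \<open>eventually_elim, auto simp: h_def indicator_def\<close>)
      also have "\<dots> = ennreal (LINT r:{1..B}|lborel. V * (r ^ (DIM('a) - 1) * f r))"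
        unfolding set_lebesgue_integral_def
      proof (rule nn_integral_eq_integral)
        have "set_integrable lborel {1..B} (\<lambda>r. V * (r ^ (DIM('a) - 1) * f r))"
          by (intro borel_integrable_atLeastAtMost' continuous_intros continuous_on_subset[OF f]) auto
        then show "integrable lborel (\<lambda>r. indicator {1..B} r *\<^sub>R (V * (r ^ (DIM('a) - 1) * f r)))"
          by (simp add: set_integrable_def)
      qed (use V f0 in \<open>auto simp: indicator_def\<close>)
      also have "(LINT r:{1..B}|lborel. V * (r ^ (DIM('a) - 1) * f r)) = integral {1..B} (\<lambda>r. V * (r ^ (DIM('a) - 1) * f r))"
        by (intro set_borel_integral_eq_integral borel_integrable_atLeastAtMost' continuous_intros continuous_on_subset[OF f]) auto
      also have "\<dots> = V * integral {1..B} (\<lambda>r. r ^ (DIM('a) - 1) * f r)"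
        by (rule integral_mult_right)
      finally show ?thesis .
    qed
    show ?thesis
    proof
      assume fin: "(\<integral>\<^sup>+r. ennreal (V * (r ^ (DIM('a) - 1) * h r)) \<partial>lborel) < \<infinity>"
      then obtain C where C: "(\<integral>\<^sup>+r. ennreal (V * (r ^ (DIM('a) - 1) * h r)) \<partial>lborel) = ennreal C" "C \<ge> 0"
        by (cases "\<integral>\<^sup>+r. ennreal (V * (r ^ (DIM('a) - 1) * h r)) \<partial>lborel") auto
      have "integral {1..B} (\<lambda>r. r ^ (DIM('a) - 1) * f r) \<le> C / V" for B
      proof -
        have "ennreal (V * integral {1..B} (\<lambda>r. r ^ (DIM('a) - 1) * f r)) \<le> ennreal C"
          unfolding part[symmetric] C(1)[symmetric]
          by (intro nn_integral_mono) (auto simp: indicator_def)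
        then show ?thesis using C V by (simp add: field_simps)
      qed
      then show "\<exists>C. \<forall>B\<ge>1. integral {1..B} (\<lambda>r. r ^ (DIM('a) - 1) * f r) \<le> C" by blast
    next
      assume "\<exists>C. \<forall>B\<ge>1. integral {1..B} (\<lambda>r. r ^ (DIM('a) - 1) * f r) \<le> C"
      then obtain C where C: "\<And>B. B \<ge> 1 \<Longrightarrow> integral {1..B} (\<lambda>r. r ^ (DIM('a) - 1) * f r) \<le> C" by blast
      have "(\<integral>\<^sup>+r. ennreal (V * (r ^ (DIM('a) - 1) * h r)) \<partial>lborel) =
         (\<integral>\<^sup>+r. (SUP k. ennreal (V * (r ^ (DIM('a) - 1) * h r)) * indicator {1..real k} r) \<partial>lborel)"
      proof (intro nn_integral_cong)
        fix r :: real
        show "ennreal (V * (r ^ (DIM('a) - 1) * h r)) = (SUP k. ennreal (V * (r ^ (DIM('a) - 1) * h r)) * indicator {1..real k} r)"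
        proof (cases "r > 1")
          case True
          obtain k where "r \<le> real k" using real_arch_simple by blast
          then show ?thesis using True
            by (intro antisym[OF SUP_upper2[of k] SUP_least]) (auto simp: indicator_def)
        next
          case False
          then show ?thesis by (simp add: h_def)
        qed
      qed
      also have "\<dots> = (SUP k. (\<integral>\<^sup>+r. ennreal (V * (r ^ (DIM('a) - 1) * h r)) * indicator {1..real k} r \<partial>lborel))"
        by (rule nn_integral_monotone_convergence_SUP)
           (auto simp: incseq_def le_fun_def indicator_def)
      also have "\<dots> \<le> ennreal (V * max C 0)"
      proof (rule SUP_least)
        fix k :: nat
        have "integral {1..real k} (\<lambda>r. r ^ (DIM('a) - 1) * f r) \<le> max C 0"
          using C[of "real k"] by (cases "k \<ge> 1") (auto simp: max_def)
        then show "(\<integral>\<^sup>+r. ennreal (V * (r ^ (DIM('a) - 1) * h r)) * indicator {1..real k} r \<partial>lborel) \<le> ennreal (V * max C 0)"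
          unfolding part using V by (intro ennreal_leI mult_left_mono) auto
      qed
      finally show "(\<integral>\<^sup>+r. ennreal (V * (r ^ (DIM('a) - 1) * h r)) \<partial>lborel) < \<infinity>"
        by (rule le_less_trans) simp
    qed
  qed
  finally show ?thesis .
qed

section \<open>Radial functions on Euclidean space\<close>

lemma partial_deriv_eq:
  "(f has_derivative f') (at x) \<Longrightarrow> partial_deriv b f x = f' b"
  by (simp add: partial_deriv_def flip: frechet_derivative_at)

lemma has_derivative_frechet:
  "f differentiable (at x) \<Longrightarrow> (f has_derivative frechet_derivative f (at x)) (at x)"
  by (simp add: frechet_derivative_works)

lemma has_real_derivative_along_line:
  assumes "f differentiable (at (r *\<^sub>R e))"
  shows "((\<lambda>r. f (r *\<^sub>R e)) has_real_derivative partial_deriv e f (r *\<^sub>R e)) (at r)"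
proof -
  let ?f' = "frechet_derivative f (at (r *\<^sub>R e))"
  have f: "(f has_derivative ?f') (at (r *\<^sub>R e))" using assms by (rule has_derivative_frechet)
  have "((\<lambda>r. r *\<^sub>R e) has_derivative (\<lambda>h. h *\<^sub>R e)) (at r)" by (auto intro!: derivative_eq_intros)
  from diff_chain_at[OF this f] have "((\<lambda>r. f (r *\<^sub>R e)) has_derivative (\<lambda>h. ?f' (h *\<^sub>R e))) (at r)"
    by (simp add: o_def)
  moreover have "?f' (h *\<^sub>R e) = ?f' e * h" for h
    using linear_frechet_derivative[OF assms] by (simp add: linear_scale)
  ultimately show ?thesis by (simp add: has_field_derivative_def partial_deriv_def fun_eq_iff)
qed

lemma has_derivative_radial:
  assumes "x \<noteq> 0" "(V has_real_derivative V') (at (norm x))"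
  shows "((\<lambda>y. V (norm y)) has_derivative (\<lambda>h. V' * (x \<bullet> h / norm x))) (at x)"
proof -
  have "(norm has_derivative (\<lambda>h. x \<bullet> h / norm x)) (at x)"
    using has_derivative_norm[OF assms(1)] by (simp add: sgn_div_norm inner_commute divide_inverse mult.commute)
  from diff_chain_at[OF this assms(2)[unfolded has_field_derivative_def]] show ?thesis
    by (simp add: o_def)
qed

lemma sum_inner_square: "(\<Sum>b\<in>Basis. (x \<bullet> b)\<^sup>2) = (norm (x::'a::euclidean_space))\<^sup>2"
  unfolding power2_norm_eq_inner euclidean_inner[of x x] by (simp add: power2_eq_square)

lemma norm_gradient_radial:
  assumes "x \<noteq> 0" "(V has_real_derivative V') (at (norm x))"
  shows "norm (gradient (\<lambda>y. V (norm y)) x) = \<bar>V'\<bar>"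
proof -
  have "gradient (\<lambda>y. V (norm y)) x = (\<Sum>b\<in>Basis. (V' / norm x) *\<^sub>R ((x \<bullet> b) *\<^sub>R b))"
    unfolding gradient_def partial_deriv_eq[OF has_derivative_radial[OF assms]] by (simp add: mult.commute)
  also have "\<dots> = (V' / norm x) *\<^sub>R x"
    unfolding scaleR_sum_right[symmetric] euclidean_representation by (rule refl)
  finally show ?thesis using assms(1) by simp
qed

lemma laplacian_radial:
  fixes x :: "'a::euclidean_space"
  assumes x: "x \<noteq> 0" and V: "\<And>r. r > 0 \<Longrightarrow> (V has_real_derivative V' r) (at r)"
    and V': "(V' has_real_derivative V'') (at (norm x))"
  shows "laplacian (\<lambda>y. V (norm y)) x = V'' + (real DIM('a) - 1) / norm x * V' (norm x)"
proof -
  define s where "s = norm x"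
  have s: "s > 0" using x by (simp add: s_def)
  have pd: "partial_deriv b (partial_deriv b (\<lambda>y. V (norm y))) x =
      V'' * ((x \<bullet> b)\<^sup>2 / s\<^sup>2) + V' s * (1 / s - (x \<bullet> b)\<^sup>2 / s ^ 3)" if b: "b \<in> Basis" for b
  proof -
    have eq: "partial_deriv b (\<lambda>y. V (norm y)) y = V' (norm y) * (y \<bullet> b / norm y)" if "y \<noteq> 0" for y
      using partial_deriv_eq[OF has_derivative_radial[OF that V]] that by simp
    have n: "((\<lambda>y. norm y) has_derivative (\<lambda>h. x \<bullet> h / s)) (at x)"
      using has_derivative_radial[OF x, of "\<lambda>r. r" 1] by (simp add: s_def)
    have "((\<lambda>y. y \<bullet> b / norm y) has_derivative (\<lambda>h. (h \<bullet> b * s - (x \<bullet> b) * (x \<bullet> h / s)) / (s * s))) (at x)"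
      using x by (auto intro!: derivative_eq_intros n simp: s_def)
    from has_derivative_mult[OF has_derivative_radial[OF x V'] this]
    have "((\<lambda>y. V' (norm y) * (y \<bullet> b / norm y)) has_derivative
        (\<lambda>h. V' s * ((h \<bullet> b * s - (x \<bullet> b) * (x \<bullet> h / s)) / (s * s)) + V'' * (x \<bullet> h / s) * (x \<bullet> b / s))) (at x)"
      by (simp add: s_def)
    then have "(partial_deriv b (\<lambda>y. V (norm y)) has_derivative
        (\<lambda>h. V' s * ((h \<bullet> b * s - (x \<bullet> b) * (x \<bullet> h / s)) / (s * s)) + V'' * (x \<bullet> h / s) * (x \<bullet> b / s))) (at x)"
      by (rule has_derivative_transform_within_open[of _ _ _ _ "- {0}"]) (use x eq in auto)
    from partial_deriv_eq[OF this] b show ?thesis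
      using s by (simp add: power2_eq_square power3_eq_cube field_simps)
  qed
  have "laplacian (\<lambda>y. V (norm y)) x =
     V'' / s\<^sup>2 * (\<Sum>b\<in>Basis. (x \<bullet> b)\<^sup>2) + V' s * (DIM('a) / s - (\<Sum>b\<in>Basis. (x \<bullet> b)\<^sup>2) / s ^ 3)"
    unfolding laplacian_def
    by (simp add: pd sum.distrib sum_subtractf right_diff_distrib flip: sum_distrib_left sum_divide_distrib)
  also have "\<dots> = V'' + (real DIM('a) - 1) / s * V' s"
    unfolding sum_inner_square s_def[symmetric] using s by (simp add: field_simps power2_eq_square power3_eq_cube)
  finally show ?thesis by (simp add: s_def)
qed

text \<open>The norm is singular only at the origin, and \<open>V\<close> vanishes near 0.
  Continuity of the partial derivatives is checked on two overlapping open sets, the punctured space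
  and a ball.\<close>

lemma Ck_1_radial:
  fixes V V' :: "real \<Rightarrow> real"
  assumes a: "a > 0" and V: "\<And>r. (V has_real_derivative V' r) (at r)" and V': "continuous_on UNIV V'"
    and V0: "\<And>r. r < a \<Longrightarrow> V r = 0"
  shows "Ck 1 (\<lambda>x::'a::euclidean_space. V (norm x))"
proof -
  have V'0: "V' r = 0" if "r < a" for r
  proof -
    have "(V has_real_derivative 0) (at r)"
      by (rule has_field_derivative_transform_within_open[of "\<lambda>_. 0" _ _ "{..<a}", OF DERIV_const]) (use that V0 in auto)
    then show ?thesis using V DERIV_unique by blast
  qed
  have near0: "((\<lambda>x::'a. V (norm x)) has_derivative (\<lambda>_. 0)) (at x)" if "norm x < a" for x
    by (rule has_derivative_transform_within_open[of "\<lambda>_. 0" _ _ _ "ball 0 a"]) (use that V0 in auto)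
  \<comment> \<open>At the origin the formula is also correct: its factor \<open>0 / 0\<close> is 0
    by convention, which agrees with the derivative of a locally vanishing function.\<close>
  have d: "((\<lambda>x::'a. V (norm x)) has_derivative (\<lambda>h. V' (norm x) * (x \<bullet> h / norm x))) (at x)" for x
  proof (cases "x = 0")
    case True
    then show ?thesis using near0[of x] a by simp
  next
    case False
    then show ?thesis by (rule has_derivative_radial[OF _ V])
  qed
  have "continuous_on UNIV (partial_deriv b (\<lambda>x::'a. V (norm x)))" for b
  proof -
    have pd: "partial_deriv b (\<lambda>x::'a. V (norm x)) = (\<lambda>x. V' (norm x) * (x \<bullet> b / norm x))"
      using partial_deriv_eq[OF d] by auto
    have "continuous_on (- {0}) (\<lambda>x::'a. V' (norm x) * (x \<bullet> b / norm x))"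
      by (intro continuous_intros continuous_on_compose2[OF V']) auto
    moreover have "continuous_on (ball 0 a) (\<lambda>x::'a. V' (norm x) * (x \<bullet> b / norm x))"
      by (rule continuous_on_eq[of _ "\<lambda>_. 0"]) (use V'0 in auto)
    ultimately have "continuous_on (- {0} \<union> ball 0 a) (\<lambda>x::'a. V' (norm x) * (x \<bullet> b / norm x))"
      by (intro continuous_on_open_Un) auto
    moreover have "- {0} \<union> ball 0 a = (UNIV :: 'a set)" using a by auto
    ultimately show ?thesis unfolding pd by simp
  qed
  then show ?thesis using d by (auto simp: differentiable_def)
qed

text \<open>A ball of radius \<open>R\<close> contains the exceptional compact set, so radial
  functions supported in a shell beyond \<open>R\<close> are admissible. The positive surface factor
  of the radial integral is divided out.\<close>

lemma radial_stability:
  fixes u :: "'a::euclidean_space \<Rightarrow> real"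
  assumes st: "stable_outside_compact g u" and g': "continuous_on UNIV (deriv g)"
    and u: "\<And>x. u x = U (norm x)" and U: "continuous_on {0<..} U"
  obtains R where "R > 0" "\<And>a b V V'. R < a \<Longrightarrow> a < b \<Longrightarrow> (\<And>r. (V has_real_derivative V' r) (at r)) \<Longrightarrow>
      continuous_on UNIV V' \<Longrightarrow> (\<And>r. r \<notin> {a..b} \<Longrightarrow> V r = 0) \<Longrightarrow>
      0 \<le> integral {a..b} (\<lambda>r. r ^ (DIM('a) - 1) * ((V' r)\<^sup>2 - deriv g (U r) * (V r)\<^sup>2))"
proof -
  obtain K where K: "compact K" "\<And>v. Ck 1 v \<Longrightarrow> compact (closure {x. v x \<noteq> 0}) \<Longrightarrow> closure {x. v x \<noteq> 0} \<subseteq> UNIV - K \<Longrightarrow>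
     0 \<le> (LINT x|lebesgue. (norm (gradient v x))\<^sup>2 - deriv g (u x) * (v x)\<^sup>2)"
    using st unfolding stable_outside_compact_def by blast
  obtain R where R: "R > 0" "\<And>x. x \<in> K \<Longrightarrow> norm x \<le> R"
    using compact_imp_bounded[OF K(1)] bounded_pos by blast
  show thesis
  proof (rule that[OF R(1)])
    fix a b V V'
    assume ab: "R < a" "a < b" and V: "\<And>r. (V has_real_derivative V' r) (at r)" and V': "continuous_on UNIV V'"
      and V0: "\<And>r. r \<notin> {a..b} \<Longrightarrow> V r = 0"
    have a0: "a > 0" using ab R by simp
    define v where "v = (\<lambda>x::'a. V (norm x))"
    have sub: "closure {x. v x \<noteq> 0} \<subseteq> {x. a \<le> norm x \<and> norm x \<le> b}"
    proof (rule closure_minimal)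
      show "{x. v x \<noteq> 0} \<subseteq> {x. a \<le> norm x \<and> norm x \<le> b}" using V0 by (force simp: v_def)
      show "closed {x::'a. a \<le> norm x \<and> norm x \<le> b}"
        by (intro closed_Collect_conj closed_Collect_le continuous_intros)
    qed
    have "bounded (closure {x. v x \<noteq> 0})" by (rule bounded_subset[of "cball 0 b"]) (use sub in auto)
    then have comp: "compact (closure {x. v x \<noteq> 0})" by (simp add: compact_eq_bounded_closed)
    have "Ck 1 v" unfolding v_def by (rule Ck_1_radial[OF a0 V V' V0]) auto
    then have "0 \<le> (LINT x|lebesgue. (norm (gradient v x))\<^sup>2 - deriv g (u x) * (v x)\<^sup>2)"
      using comp by (rule K(2)) (use sub R ab in fastforce)
    define q where "q = (\<lambda>r. (V' r)\<^sup>2 - deriv g (U r) * (V r)\<^sup>2)"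
    have V'0: "V' r = 0" if "r \<notin> {a..b}" for r
    proof -
      have "(V has_real_derivative 0) (at r)"
        by (rule has_field_derivative_transform_within_open[of "\<lambda>_. 0" _ _ "- {a..b}", OF DERIV_const]) (use that V0 in auto)
      then show ?thesis using V DERIV_unique by blast
    qed
    have q0: "q r = 0" if "r \<notin> {a..b}" for r using V0[OF that] V'0[OF that] by (simp add: q_def)
    have cV: "continuous_on A V" for A by (rule DERIV_continuous_on[OF has_field_derivative_at_within[OF V]])
    have qc: "continuous_on {a..b} q"
      unfolding q_def
      by (intro continuous_intros continuous_on_subset[OF V'] cV continuous_on_compose2[OF g' continuous_on_subset[OF U]])
         (use a0 in auto)
    have "(norm (gradient v x))\<^sup>2 - deriv g (u x) * (v x)\<^sup>2 = q (norm x)" for x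
    proof (cases "x = 0")
      case False
      then show ?thesis using norm_gradient_radial[OF False V] by (simp add: q_def v_def u)
    next
      case True
      have "((\<lambda>x::'a. V (norm x)) has_derivative (\<lambda>_. 0)) (at 0)"
        by (rule has_derivative_transform_within_open[of "\<lambda>_. 0" _ _ _ "ball 0 a"]) (use a0 V0 in auto)
      then have "gradient v 0 = 0" unfolding gradient_def v_def by (simp add: partial_deriv_eq)
      then show ?thesis using True q0[of 0] V0[of 0] a0 by (simp add: v_def)
    qed
    then have "0 \<le> (LINT x|lebesgue. q (norm (x::'a)))"
      using \<open>0 \<le> (LINT x|lebesgue. (norm (gradient v x))\<^sup>2 - deriv g (u x) * (v x)\<^sup>2)\<close> by simp
    also have "\<dots> = DIM('a) * unit_ball_vol DIM('a) * integral {a..b} (\<lambda>r. r ^ (DIM('a) - 1) * q r)"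
      by (rule integral_radial[OF qc a0 q0])
    finally have "0 \<le> DIM('a) * unit_ball_vol DIM('a) * integral {a..b} (\<lambda>r. r ^ (DIM('a) - 1) * q r)" .
    moreover have "0 < DIM('a) * unit_ball_vol DIM('a)" by simp
    ultimately have "0 \<le> integral {a..b} (\<lambda>r. r ^ (DIM('a) - 1) * q r)"
      by (metis mult_pos_neg not_le)
    then show "0 \<le> integral {a..b} (\<lambda>r. r ^ (DIM('a) - 1) * ((V' r)\<^sup>2 - deriv g (U r) * (V r)\<^sup>2))"
      by (simp only: q_def)
  qed
qed

text \<open>The profile is the restriction of \<open>u\<close> to an axis, so the chain rule gives
  its derivatives at every real \<open>r\<close>, including 0 and negative values. The equation with
  its term in \<open>1 / r\<close> needs \<open>r > 0\<close>.\<close>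

lemma radial_classical_solution:
  fixes u :: "'a::euclidean_space \<Rightarrow> real"
  assumes sol: "classical_solution g u" and rad: "radial u"
  defines "e \<equiv> (SOME b. b \<in> (Basis :: 'a set))"
  defines "\<omega> \<equiv> \<lambda>r. partial_deriv e u (r *\<^sub>R e)"
  defines "\<omega>' \<equiv> \<lambda>r. partial_deriv e (partial_deriv e u) (r *\<^sub>R e)"
  shows "(profile u has_real_derivative \<omega> r) (at r)"
    and "(\<omega> has_real_derivative \<omega>' r) (at r)"
    and "u x = profile u (norm x)"
    and "r > 0 \<Longrightarrow> \<omega>' r = - g (profile u r) - (real DIM('a) - 1) / r * \<omega> r"
    and "x \<noteq> 0 \<Longrightarrow> norm (gradient u x) = \<bar>\<omega> (norm x)\<bar>"
    and "continuous_on UNIV (gradient u)"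
proof -
  have e: "e \<in> Basis" unfolding e_def by (rule someI_ex) (use nonempty_Basis in blast)
  have C2: "\<And>x. u differentiable (at x)" "\<And>b x. b \<in> Basis \<Longrightarrow> partial_deriv b u differentiable (at x)"
    using sol by (auto simp: classical_solution_def numeral_2_eq_2)
  have U: "profile u = (\<lambda>r. u (r *\<^sub>R e))" by (simp add: fun_eq_iff profile_def e_def)
  show dU: "(profile u has_real_derivative \<omega> r) (at r)" for r
    unfolding U \<omega>_def by (rule has_real_derivative_along_line[OF C2(1)])
  show d\<omega>: "(\<omega> has_real_derivative \<omega>' r) (at r)" for r
    unfolding \<omega>_def \<omega>'_def by (rule has_real_derivative_along_line[OF C2(2)[OF e]])
  have uU: "u x = profile u (norm x)" for x
  proof -
    have "norm x = norm (norm x *\<^sub>R e)" using e by simp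
    then show ?thesis using rad unfolding radial_def U by blast
  qed
  then show "u x = profile u (norm x)" .
  have u_eq: "u = (\<lambda>x. profile u (norm x))" by (rule ext) (rule uU)
  show "norm (gradient u x) = \<bar>\<omega> (norm x)\<bar>" if "x \<noteq> 0"
    using norm_gradient_radial[OF that dU] unfolding u_eq[symmetric] .
  show "\<omega>' r = - g (profile u r) - (real DIM('a) - 1) / r * \<omega> r" if r: "r > 0"
  proof -
    have x: "r *\<^sub>R e \<noteq> 0" "norm (r *\<^sub>R e) = r" using r e by auto
    have "laplacian (\<lambda>x. profile u (norm x)) (r *\<^sub>R e) = \<omega>' r + (real DIM('a) - 1) / r * \<omega> r"
      using laplacian_radial[OF x(1) dU d\<omega>] unfolding x(2) .
    then have "laplacian u (r *\<^sub>R e) = \<omega>' r + (real DIM('a) - 1) / r * \<omega> r"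
      by (simp only: u_eq[symmetric])
    moreover have "- laplacian u (r *\<^sub>R e) = g (profile u r)"
      using sol by (simp add: classical_solution_def U)
    ultimately show ?thesis by linarith
  qed
  have "continuous_on UNIV (partial_deriv b u)" if "b \<in> Basis" for b
    by (intro continuous_at_imp_continuous_on ballI differentiable_imp_continuous_within C2 that)
  then show "continuous_on UNIV (gradient u)"
    unfolding gradient_def by (intro continuous_intros)
qed

section \<open>The main result\<close>

lemma in_Lp_radial_iff:
  fixes u :: "'a::euclidean_space \<Rightarrow> real"
  assumes grad: "\<And>x. x \<noteq> 0 \<Longrightarrow> norm (gradient u x) = \<bar>\<omega> (norm x)\<bar>"
    and cont: "continuous_on UNIV (gradient u)" and \<omega>: "continuous_on {1..} \<omega>" and p: "p > 0"
  shows "in_Lp (ereal p) (UNIV - closure (ball 0 1)) (\<lambda>x. norm (gradient u x)) \<longleftrightarrow>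
    (\<exists>D. \<forall>B\<ge>1. integral {1..B} (\<lambda>r. r ^ (DIM('a) - 1) * \<bar>\<omega> r\<bar> powr p) \<le> D)"
proof -
  have S: "UNIV - closure (ball (0::'a) 1) = {x. norm x > 1}" by auto
  have m: "(\<lambda>x. norm (gradient u x)) \<in> borel_measurable (lebesgue_on {x. norm x > 1})"
  proof (intro measurable_restrict_space1 measurable_completion)
    show "(\<lambda>x. norm (gradient u x)) \<in> borel_measurable lborel"
      using borel_measurable_continuous_onI[OF continuous_on_norm[OF cont]] by simp
  qed
  have "integrable (lebesgue_on {x. norm x > 1}) (\<lambda>x. \<bar>norm (gradient u x)\<bar> powr p) \<longleftrightarrow>
     integrable (lebesgue_on {x::'a. norm x > 1}) (\<lambda>x. \<bar>\<omega> (norm x)\<bar> powr p)"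
  proof (rule Bochner_Integration.integrable_cong[OF refl])
    fix x :: 'a assume "x \<in> space (lebesgue_on {x. norm x > 1})"
    then have "x \<noteq> 0" by auto
    then show "\<bar>norm (gradient u x)\<bar> powr p = \<bar>\<omega> (norm x)\<bar> powr p" by (simp add: grad)
  qed
  also have "\<dots> \<longleftrightarrow> (\<exists>D. \<forall>B\<ge>1. integral {1..B} (\<lambda>r. r ^ (DIM('a) - 1) * \<bar>\<omega> r\<bar> powr p) \<le> D)"
  proof (rule radial_integrable_iff)
    show "continuous_on {1..} (\<lambda>r. \<bar>\<omega> r\<bar> powr p)"
      by (intro continuous_on_powr' continuous_intros \<omega>) (use p in auto)
  qed simp
  finally show ?thesis using m unfolding S in_Lp_def by simp
qed

lemma in_Lp_infinity_radial:
  fixes u :: "'a::euclidean_space \<Rightarrow> real"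
  assumes grad: "\<And>x. x \<noteq> 0 \<Longrightarrow> norm (gradient u x) = \<bar>\<omega> (norm x)\<bar>"
    and cont: "continuous_on UNIV (gradient u)" and L: "\<And>r. r \<ge> 1 \<Longrightarrow> \<bar>\<omega> r\<bar> \<le> L"
  shows "in_Lp \<infinity> (UNIV - closure (ball 0 1)) (\<lambda>x. norm (gradient u x))"
proof -
  have S: "UNIV - closure (ball (0::'a) 1) = {x. norm x > 1}" by auto
  have m: "(\<lambda>x. norm (gradient u x)) \<in> borel_measurable (lebesgue_on {x. norm x > 1})"
  proof (intro measurable_restrict_space1 measurable_completion)
    show "(\<lambda>x. norm (gradient u x)) \<in> borel_measurable lborel"
      using borel_measurable_continuous_onI[OF continuous_on_norm[OF cont]] by simp
  qed
  have "\<bar>norm (gradient u x)\<bar> \<le> L" if "norm x > 1" for x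
  proof -
    have "x \<noteq> 0" using that by auto
    then show ?thesis using grad[of x] L[of "norm x"] that by simp
  qed
  then have "AE x in lebesgue_on {x. norm x > 1}. \<bar>norm (gradient u x)\<bar> \<le> L"
    by (intro AE_I2) simp
  then show ?thesis using m unfolding S in_Lp_def by auto
qed

theorem corollary1p4:
  fixes g :: "real \<Rightarrow> real" and u :: "real^'n \<Rightarrow> real"
  assumes "CARD('n) \<ge> 3"
    and "g C1_differentiable_on UNIV"
    and "classical_solution g u"
    and "bounded (range u)"
    and "radial u"
    and "stable_outside_compact g u"
  shows "\<exists>u_inf. (profile u \<longlongrightarrow> u_inf) at_top \<and>
           (slow_decay u u_inf \<or> fast_decay u u_inf) \<and>
           \<not> (slow_decay u u_inf \<and> fast_decay u u_inf)"
proof -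
  define N where "N = real CARD('n)"
  define c where "c = sqrt (N - 1)"
  have N: "N \<ge> 3" using assms(1) by (simp add: N_def)
  define e where "e = (SOME b. b \<in> (Basis :: (real^'n) set))"
  define \<omega> where "\<omega> = (\<lambda>r. partial_deriv e u (r *\<^sub>R e))"
  define \<omega>' where "\<omega>' = (\<lambda>r. partial_deriv e (partial_deriv e u) (r *\<^sub>R e))"
  have rc1: "(profile u has_real_derivative \<omega> r) (at r)"
    and rc2: "(\<omega> has_real_derivative \<omega>' r) (at r)"
    and rc3: "u x = profile u (norm x)"
    and rc4: "r > 0 \<Longrightarrow> \<omega>' r = - g (profile u r) - (N - 1) / r * \<omega> r"
    and rc5: "x \<noteq> 0 \<Longrightarrow> norm (gradient u x) = \<bar>\<omega> (norm x)\<bar>"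
    and rc6: "continuous_on UNIV (gradient u)" for r x
    using radial_classical_solution[OF assms(3,5)] unfolding \<omega>_def \<omega>'_def e_def N_def by simp_all
  obtain g' where g': "\<And>x. (g has_real_derivative g' x) (at x)" "continuous_on UNIV g'"
    using assms(2) unfolding C1_differentiable_on_def has_real_derivative_iff_has_vector_derivative by auto
  have "deriv g = g'" using DERIV_imp_deriv[OF g'(1)] by auto
  then have dg: "(g has_real_derivative deriv g x) (at x)" "continuous_on UNIV (deriv g)" for x
    using g' by auto
  have Ucont: "continuous_on {0<..} (profile u)"
    by (intro continuous_at_imp_continuous_on ballI DERIV_isCont[OF rc1])
  obtain R where R: "R > 0" "\<And>a b V V'. R < a \<Longrightarrow> a < b \<Longrightarrow> (\<And>r. (V has_real_derivative V' r) (at r)) \<Longrightarrow>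
      continuous_on UNIV V' \<Longrightarrow> (\<And>r. r \<notin> {a..b} \<Longrightarrow> V r = 0) \<Longrightarrow>
      0 \<le> integral {a..b} (\<lambda>r. r ^ (CARD('n) - 1) * ((V' r)\<^sup>2 - deriv g (profile u r) * (V r)\<^sup>2))"
    using radial_stability[OF assms(6) dg(2) rc3 Ucont] by auto
  have "bounded (range (profile u))"
    by (rule bounded_subset[OF assms(4)]) (auto simp: profile_def)
  then interpret radial_profile g "profile u" \<omega> \<omega>' "CARD('n)" R
  proof (unfold_locales, goal_cases)
    case (7 r)
    then show ?case using rc4 by (simp only: N_def)
  next
    case (9 a b V V')
    show ?case by (rule R(2)[OF 9(2-6)])
  qed (use assms(1) R(1) dg rc1 rc2 in auto)
  obtain l where l: "(profile u \<longlongrightarrow> l) at_top"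
    "slow_profile_conclusion CARD('n) (profile u) \<omega> l \<or> fast_profile_conclusion CARD('n) (profile u) \<omega> l"
    using profile_dichotomy by blast
  have \<omega>_cont1: "continuous_on {1..} \<omega>" by (rule continuous_on_subset[OF \<omega>_cont]) auto
  have Lp: "in_Lp (ereal p) (UNIV - closure (ball 0 1)) (\<lambda>x. norm (gradient u x)) \<longleftrightarrow>
    (\<exists>D. \<forall>B\<ge>1. integral {1..B} (\<lambda>r. r ^ (CARD('n) - 1) * \<bar>\<omega> r\<bar> powr p) \<le> D)" if "p > 0" for p
    using in_Lp_radial_iff[OF rc5 rc6 \<omega>_cont1 that] by simp
  have two: "(2::ereal) = ereal 2" by simp
  have slow: "slow_decay u l" if s: "slow_profile_conclusion CARD('n) (profile u) \<omega> l"
  proof -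
    have n11: "CARD('n) \<ge> 11" using s by (simp add: slow_profile_conclusion_def)
    have lb: "\<exists>M>0. \<exists>r0\<ge>1. \<forall>r\<ge>r0. M * r powr (- N / 2 + c + 2) \<le> \<bar>profile u r - l\<bar>"
      and nLp: "\<And>p. p \<ge> 1 \<Longrightarrow> p * (N / 2 - c - 1) \<le> N \<Longrightarrow>
        \<not> in_Lp (ereal p) (UNIV - closure (ball 0 1)) (\<lambda>x. norm (gradient u x))"
      using s Lp unfolding slow_profile_conclusion_def N_def[symmetric] c_def[symmetric] by auto
    have "N \<ge> 11" using n11 by (simp add: N_def)
    \<comment> \<open>Positivity of this denominator is what allows the condition on
      \<open>p\<close> to be multiplied out. In terms of \<open>x = N / 2 - 1\<close> it says
      \<open>2 * x + 1 < x\<^sup>2\<close>.\<close>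
    have d0: "N / 2 - c - 1 > 0"
    proof -
      define x where "x = N / 2 - 1"
      have "3\<^sup>2 \<le> (x - 1)\<^sup>2" using \<open>N \<ge> 11\<close> by (intro power_mono) (auto simp: x_def)
      then have "2 * x + 1 < x\<^sup>2" unfolding power2_diff by simp
      then have "N - 1 < (N / 2 - 1)\<^sup>2" by (simp add: x_def)
      then have "c < N / 2 - 1" unfolding c_def by (rule real_less_lsqrt[rotated -1]) (use \<open>N \<ge> 11\<close> in auto)
      then show ?thesis by simp
    qed
    have all: "\<not> in_Lp p (UNIV - closure (ball 0 1)) (\<lambda>x. norm (gradient u x))"
      if p: "1 \<le> p" "p \<le> ereal (N / (N / 2 - c - 1))" for p
    proof -
      obtain q where q: "p = ereal q" using p by (cases p) auto
      then have "q \<ge> 1" "q \<le> N / (N / 2 - c - 1)" using p by (auto simp: one_ereal_def)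
      then show ?thesis using nLp[of q] d0 q by (simp add: pos_le_divide_eq)
    qed
    have "\<not> in_Lp 2 (UNIV - closure (ball 0 1)) (\<lambda>x. norm (gradient u x))"
    proof -
      have "0 \<le> c" using N by (simp add: c_def)
      then have "2 * (N / 2 - c - 1) \<le> N" by simp
      then show ?thesis unfolding two by (intro nLp) auto
    qed
    then show ?thesis
      unfolding slow_decay_def Let_def N_def[symmetric] c_def[symmetric] using n11 lb all by blast
  qed
  have fast: "fast_decay u l" if f: "fast_profile_conclusion CARD('n) (profile u) \<omega> l"
  proof -
    have ub: "\<exists>M>0. \<forall>r\<ge>1. \<bar>profile u r - l\<bar> \<le> M * r powr (- N / 2 - c + 2)"
      and inLp: "\<And>p. p > 0 \<Longrightarrow> N < p * (N / 2 + c - 1) \<Longrightarrow>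
        in_Lp (ereal p) (UNIV - closure (ball 0 1)) (\<lambda>x. norm (gradient u x))"
      using f Lp unfolding fast_profile_conclusion_def N_def[symmetric] c_def[symmetric] by auto
    have c1: "c > 1" using N by (simp add: c_def)
    then have d0: "N / 2 + c - 1 > 0" using N by simp
    obtain L where L: "\<And>r. r \<ge> 1 \<Longrightarrow> \<bar>\<omega> r\<bar> \<le> L" using \<omega>_bounded by blast
    have all: "in_Lp p (UNIV - closure (ball 0 1)) (\<lambda>x. norm (gradient u x))"
      if p: "ereal (N / (N / 2 + c - 1)) < p" "p \<le> \<infinity>" for p
    proof (cases p)
      case (real q)
      then have q: "N / (N / 2 + c - 1) < q" using p by simp
      have "0 < N / (N / 2 + c - 1)" using N d0 by simp
      then have "0 < q" using q by (rule less_trans)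
      moreover have "N < q * (N / 2 + c - 1)" using q d0 by (simp add: pos_divide_less_eq)
      ultimately have "in_Lp (ereal q) (UNIV - closure (ball 0 1)) (\<lambda>x. norm (gradient u x))" by (rule inLp)
      then show ?thesis using real by simp
    next
      case PInf
      then show ?thesis using in_Lp_infinity_radial[OF rc5 rc6 L] by simp
    qed (use p in auto)
    \<comment> \<open>The exponent 2 lies above the threshold because
      \<open>2 * (N / 2 + c - 1) = N + 2 * (c - 1)\<close> and \<open>c > 1\<close>.\<close>
    have "in_Lp 2 (UNIV - closure (ball 0 1)) (\<lambda>x. norm (gradient u x))"
      using inLp[of 2] c1 unfolding two by simp
    then show ?thesis
      unfolding fast_decay_def Let_def N_def[symmetric] c_def[symmetric] using ub all by blast
  qed
  \<comment> \<open>The square-integrability clauses of the two alternatives contradict each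
    other.\<close>
  have "\<not> (slow_decay u l \<and> fast_decay u l)"
    unfolding slow_decay_def fast_decay_def Let_def by blast
  then show ?thesis using l slow fast by blast
qed

end
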